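(* Let $G$ be an abelian group, let $k$ be a commutative $G$-ring, let $n$ be a natural number and let $\delta\in k$. Let $G\mathcal{TL}_n(\delta)$ be the $G$-Temperley-Lieb algebra over $k$. If $\delta$ is invertible, then there is an isomorphism of graded $k$-modules $$\mathrm{Tor}_{\star}^{G\mathcal{TL}_n(\delta)}(\mathbf{1},\mathbf{1})\cong \mathrm{Tor}_{\star}^{k[G^n]}(\mathbf{1},\mathbf{1}).$$
   Context: A commutative $G$-ring is a unital commutative ring $k$ together with a group homomorphism $G\to\mathrm{Aut}(k)$ to the group of ring automorphisms; the action of $g\in G$ on $\lambda\in k$ is written $g\lambda$. A $G$-Temperley-Lieb $n$-diagram is a graph on two columns (left and right) of $n$ nodes in which each node is connected to exactly one other node by an edge (left-to-left, right-to-right and left-to-right edges are all allowed), which is planar (edges can be drawn between the two columns without crossings), and in which each edge is labelled by an element of $G$. The $G$-Temperley-Lieb algebra $G\mathcal{TL}_n(\delta)$ consists of formal $k$-linear combinations of $G$-Temperley-Lieb $n$-diagrams. The product $x\cdot y$ of two diagrams is the $k$-bilinear extension of: identify the right-hand nodes of $x$ with the left-hand nodes of $y$, forget the middle nodes, label each edge formed by concatenation with the product of the group elements along it, and replace each closed loop formed in the middle by a factor $g\delta\in k$, where $g\in G$ is the product of all the labels on the loop. The trivial module $\mathbf{1}$ of $G\mathcal{TL}_n(\delta)$ is a copy of $k$ (as a left and as a right module) on which diagrams with no left-to-left and no right-to-right connections act as $1$ and all other diagrams act as $0$. For the (untwisted) group algebra $k[G^n]$, $\mathbf{1}$ is $k$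 with every group element acting as $1$. *)

theory Defs
  imports "HOL-Analysis.Analysis" "HOL-Algebra.Algebra"
begin

section \<open>Modules over a possibly noncommutative ring\<close>

locale left_module = R?: ring A + M?: abelian_group M
  for A :: "('a, 'z) ring_scheme" (structure) and M :: "('a, 'm, 'x) module_scheme" (structure) +
  assumes lsmult_closed: "\<lbrakk>a \<in> carrier A; x \<in> carrier M\<rbrakk> \<Longrightarrow> a \<odot>\<^bsub>M\<^esub> x \<in> carrier M"
    and lsmult_l_distr: "\<lbrakk>a \<in> carrier A; b \<in> carrier A; x \<in> carrier M\<rbrakk> \<Longrightarrow>
      (a \<oplus>\<^bsub>A\<^esub> b) \<odot>\<^bsub>M\<^esub> x = a \<odot>\<^bsub>M\<^esub> x \<oplus>\<^bsub>M\<^esub> b \<odot>\<^bsub>M\<^esub> x"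
    and lsmult_r_distr: "\<lbrakk>a \<in> carrier A; x \<in> carrier M; y \<in> carrier M\<rbrakk> \<Longrightarrow>
      a \<odot>\<^bsub>M\<^esub> (x \<oplus>\<^bsub>M\<^esub> y) = a \<odot>\<^bsub>M\<^esub> x \<oplus>\<^bsub>M\<^esub> a \<odot>\<^bsub>M\<^esub> y"
    and lsmult_assoc: "\<lbrakk>a \<in> carrier A; b \<in> carrier A; x \<in> carrier M\<rbrakk> \<Longrightarrow>
      (a \<otimes>\<^bsub>A\<^esub> b) \<odot>\<^bsub>M\<^esub> x = a \<odot>\<^bsub>M\<^esub> (b \<odot>\<^bsub>M\<^esub> x)"
    and lsmult_one: "x \<in> carrier M \<Longrightarrow> \<one>\<^bsub>A\<^esub> \<odot>\<^bsub>M\<^esub> x = x"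

definition lin_hom ::
  "('a, 'x) ring_scheme \<Rightarrow> ('a, 'm, 'y) module_scheme \<Rightarrow> ('a, 'n, 'z) module_scheme \<Rightarrow> ('m \<Rightarrow> 'n) set" where
  "lin_hom A M N = {h \<in> carrier M \<rightarrow> carrier N.
     (\<forall>x\<in>carrier M. \<forall>y\<in>carrier M. h (x \<oplus>\<^bsub>M\<^esub> y) = h x \<oplus>\<^bsub>N\<^esub> h y) \<and>
     (\<forall>a\<in>carrier A. \<forall>x\<in>carrier M. h (a \<odot>\<^bsub>M\<^esub> x) = a \<odot>\<^bsub>N\<^esub> h x)}"

definition module_isomorphic ::
  "('a, 'x) ring_scheme \<Rightarrow> ('a, 'm, 'y) module_scheme \<Rightarrow> ('a, 'n, 'z) module_scheme \<Rightarrow> bool" where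
  "module_isomorphic A M N \<longleftrightarrow> (\<exists>h\<in>lin_hom A M N. bij_betw h (carrier M) (carrier N))"

text \<open>The ring-multiplication fields of the record type \<^type>\<open>module\<close> carry no meaning for a mere
  module, as in \<^locale>\<open>module\<close>; they are left unspecified.\<close>

definition free_module :: "('a, 'x) ring_scheme \<Rightarrow> 's set \<Rightarrow> ('a, 's \<Rightarrow> 'a) module" where
  "free_module A S = \<lparr>
     carrier = {f. (\<forall>s. f s \<in> carrier A) \<and> (\<forall>s. s \<notin> S \<longrightarrow> f s = \<zero>\<^bsub>A\<^esub>) \<and> finite {s. f s \<noteq> \<zero>\<^bsub>A\<^esub>}},
     monoid.mult = undefined, monoid.one = undefined,
     ring.zero = (\<lambda>s. \<zero>\<^bsub>A\<^esub>),
     ring.add = (\<lambda>f g s. f s \<oplus>\<^bsub>A\<^esub> g s),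
     module.smult = (\<lambda>a f s. a \<otimes>\<^bsub>A\<^esub> f s)\<rparr>"

definition single :: "('a, 'x) ring_scheme \<Rightarrow> 's \<Rightarrow> 's \<Rightarrow> 'a" where
  "single A s = (\<lambda>t. if t = s then \<one>\<^bsub>A\<^esub> else \<zero>\<^bsub>A\<^esub>)"

definition submodule_span :: "('a, 'x) ring_scheme \<Rightarrow> ('a, 'm, 'y) module_scheme \<Rightarrow> 'm set \<Rightarrow> 'm set" where
  "submodule_span A M Y = \<Inter> {H. submodule H A M \<and> Y \<subseteq> H}"

definition quot_module :: "('a, 'm, 'y) module_scheme \<Rightarrow> 'm set \<Rightarrow> ('a, 'm set) module" where
  "quot_module M N = \<lparr>
     carrier = a_rcosets\<^bsub>M\<^esub> N,
     monoid.mult = undefined, monoid.one = undefined,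
     ring.zero = N,
     ring.add = set_add M,
     module.smult = (\<lambda>a Y. \<Union>x\<in>Y. N +>\<^bsub>M\<^esub> (a \<odot>\<^bsub>M\<^esub> x))\<rparr>"


section \<open>Projective resolutions\<close>

text \<open>Projective means direct summand of a free module. Index sets \<open>S\<close> inside the element type of
  \<open>P\<close> suffice, because every module \<open>P\<close> is a quotient of the free module on \<open>carrier P\<close>, and a
  projective \<open>P\<close> is a direct summand of that.\<close>

definition projective :: "('a, 'x) ring_scheme \<Rightarrow> ('a, 'p, 'y) module_scheme \<Rightarrow> bool" where
  "projective A P \<longleftrightarrow> left_module A P \<and>
     (\<exists>S :: 'p set. \<exists>i \<in> lin_hom A P (free_module A S). \<exists>r \<in> lin_hom A (free_module A S) P.
        \<forall>x\<in>carrier P. r (i x) = x)"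

definition projective_resolution ::
  "('a, 'x) ring_scheme \<Rightarrow> ('a, 'm, 'y) module_scheme \<Rightarrow>
   (nat \<Rightarrow> ('a, 'p, 'z) module_scheme) \<Rightarrow> (nat \<Rightarrow> 'p \<Rightarrow> 'p) \<Rightarrow> ('p \<Rightarrow> 'm) \<Rightarrow> bool" where
  "projective_resolution A M P d e \<longleftrightarrow>
     (\<forall>i. projective A (P i)) \<and>
     (\<forall>i. d i \<in> lin_hom A (P (Suc i)) (P i)) \<and>
     e \<in> lin_hom A (P 0) M \<and>
     e ` carrier (P 0) = carrier M \<and>
     d 0 ` carrier (P (Suc 0)) = {x \<in> carrier (P 0). e x = \<zero>\<^bsub>M\<^esub>} \<and>
     (\<forall>i. d (Suc i) ` carrier (P (Suc (Suc i))) = {x \<in> carrier (P (Suc i)). d i x = \<zero>\<^bsub>P i\<^esub>})"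


section \<open>Tensor products over a \<open>k\<close>-algebra, and Tor\<close>

text \<open>Throughout, \<open>A\<close> is a \<open>k\<close>-algebra, \<open>N\<close> a left \<open>A\<close>-module and \<open>M\<close> a right \<open>A\<close>-module.
  For a right module, \<open>a \<odot>\<^bsub>M\<^esub> m\<close> stands for the product of \<open>m\<close> with \<open>a\<close> on the right.
  The last family of relations makes \<open>k\<close> act on the tensor product through \<open>r \<mapsto> r \<odot>\<^bsub>A\<^esub> \<one>\<^bsub>A\<^esub>\<close>.\<close>

definition tensor_relations ::
  "('k, 'x) ring_scheme \<Rightarrow> ('k, 'a, 'y) module_scheme \<Rightarrow> ('a, 'm, 'u) module_scheme \<Rightarrow>
   ('a, 'n, 'v) module_scheme \<Rightarrow> (('m \<times> 'n \<Rightarrow> 'k) \<times> ('m \<times> 'n \<Rightarrow> 'k)) set" where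
  "tensor_relations k A M N =
     (let F = free_module k (carrier M \<times> carrier N); g = (\<lambda>m n. single k (m, n)) in
       {(g (m \<oplus>\<^bsub>M\<^esub> m') n, g m n \<oplus>\<^bsub>F\<^esub> g m' n) | m m' n.
          m \<in> carrier M \<and> m' \<in> carrier M \<and> n \<in> carrier N} \<union>
       {(g m (n \<oplus>\<^bsub>N\<^esub> n'), g m n \<oplus>\<^bsub>F\<^esub> g m n') | m n n'.
          m \<in> carrier M \<and> n \<in> carrier N \<and> n' \<in> carrier N} \<union>
       {(g (a \<odot>\<^bsub>M\<^esub> m) n, g m (a \<odot>\<^bsub>N\<^esub> n)) | a m n.
          a \<in> carrier A \<and> m \<in> carrier M \<and> n \<in> carrier N} \<union>
       {(g ((r \<odot>\<^bsub>A\<^esub> \<one>\<^bsub>A\<^esub>) \<odot>\<^bsub>M\<^esub> m) n, r \<odot>\<^bsub>F\<^esub> g m n) | r m n.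
          r \<in> carrier k \<and> m \<in> carrier M \<and> n \<in> carrier N})"

definition tensor_kernel ::
  "('k, 'x) ring_scheme \<Rightarrow> ('k, 'a, 'y) module_scheme \<Rightarrow> ('a, 'm, 'u) module_scheme \<Rightarrow>
   ('a, 'n, 'v) module_scheme \<Rightarrow> ('m \<times> 'n \<Rightarrow> 'k) set" where
  "tensor_kernel k A M N =
     (let F = free_module k (carrier M \<times> carrier N) in
       submodule_span k F {x \<ominus>\<^bsub>F\<^esub> y | x y. (x, y) \<in> tensor_relations k A M N})"

definition tensor ::
  "('k, 'x) ring_scheme \<Rightarrow> ('k, 'a, 'y) module_scheme \<Rightarrow> ('a, 'm, 'u) module_scheme \<Rightarrow>
   ('a, 'n, 'v) module_scheme \<Rightarrow> ('k, ('m \<times> 'n \<Rightarrow> 'k) set) module" where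
  "tensor k A M N =
     quot_module (free_module k (carrier M \<times> carrier N)) (tensor_kernel k A M N)"

definition pushforward :: "('k, 'x) ring_scheme \<Rightarrow> ('s \<Rightarrow> 't) \<Rightarrow> ('s \<Rightarrow> 'k) \<Rightarrow> 't \<Rightarrow> 'k" where
  "pushforward k u f = (\<lambda>t. \<Oplus>\<^bsub>k\<^esub>s\<in>{s. f s \<noteq> \<zero>\<^bsub>k\<^esub> \<and> u s = t}. f s)"

text \<open>The map \<open>id \<otimes> h\<close> from \<open>tensor k A M N\<close> to \<open>tensor k A M N'\<close>, on cosets of formal
  combinations of pairs.\<close>

definition tensor_map ::
  "('k, 'x) ring_scheme \<Rightarrow> ('k, 'a, 'y) module_scheme \<Rightarrow> ('a, 'm, 'u) module_scheme \<Rightarrow>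
   ('a, 'n, 'v) module_scheme \<Rightarrow> ('n' \<Rightarrow> 'n) \<Rightarrow> ('m \<times> 'n' \<Rightarrow> 'k) set \<Rightarrow> ('m \<times> 'n \<Rightarrow> 'k) set" where
  "tensor_map k A M N' h Y =
     (\<Union>f\<in>Y. tensor_kernel k A M N' +>\<^bsub>free_module k (carrier M \<times> carrier N')\<^esub>
        pushforward k (\<lambda>(m, n). (m, h n)) f)"

text \<open>\<open>Tor k A M P d q\<close> is the \<open>q\<close>-th homology of the complex of \<open>k\<close>-modules obtained by tensoring
  \<open>(P, d)\<close> with \<open>M\<close> over \<open>A\<close>; here \<open>d i\<close> maps \<open>P (Suc i)\<close> to \<open>P i\<close>. When \<open>(P, d)\<close> is a projective
  resolution of \<open>N\<close>, it is the \<open>q\<close>-th Tor group of \<open>M\<close> and \<open>N\<close> over \<open>A\<close>.\<close>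

definition Tor ::
  "('k, 'x) ring_scheme \<Rightarrow> ('k, 'a, 'y) module_scheme \<Rightarrow> ('a, 'm, 'u) module_scheme \<Rightarrow>
   (nat \<Rightarrow> ('a, 'p, 'v) module_scheme) \<Rightarrow> (nat \<Rightarrow> 'p \<Rightarrow> 'p) \<Rightarrow> nat \<Rightarrow>
   ('k, ('m \<times> 'p \<Rightarrow> 'k) set set) module" where
  "Tor k A M P d q =
     (let C = (\<lambda>i. tensor k A M (P i));
          D = (\<lambda>i. tensor_map k A M (P i) (d i));
          Z = {x \<in> carrier (C q). case q of 0 \<Rightarrow> True | Suc i \<Rightarrow> D i x = \<zero>\<^bsub>C i\<^esub>};
          B = D q ` carrier (C (Suc q))
      in quot_module ((C q)\<lparr>carrier := Z\<rparr>) B)"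


section \<open>Algebras with a multiplicative basis up to scalars\<close>

text \<open>The free \<open>k\<close>-module on \<open>B\<close> with product the bilinear extension of
  \<open>x \<cdot> y = c x y \<cdot> p x y\<close> for \<open>x, y \<in> B\<close>, and with unit \<open>u \<in> B\<close>.\<close>

definition basis_algebra ::
  "('k, 'x) ring_scheme \<Rightarrow> 'b set \<Rightarrow> ('b \<Rightarrow> 'b \<Rightarrow> 'b) \<Rightarrow> ('b \<Rightarrow> 'b \<Rightarrow> 'k) \<Rightarrow> 'b \<Rightarrow> ('k, 'b \<Rightarrow> 'k) module" where
  "basis_algebra k B p c u = (free_module k B)\<lparr>
     monoid.mult := (\<lambda>f g z.
       \<Oplus>\<^bsub>k\<^esub>w\<in>{(x, y). f x \<noteq> \<zero>\<^bsub>k\<^esub> \<and> g y \<noteq> \<zero>\<^bsub>k\<^esub> \<and> p x y = z}.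
         f (fst w) \<otimes>\<^bsub>k\<^esub> g (snd w) \<otimes>\<^bsub>k\<^esub> c (fst w) (snd w)),
     monoid.one := single k u\<rparr>"

text \<open>A copy of \<open>k\<close> on which basis elements in \<open>T\<close> act as \<open>1\<close> and all other basis elements as
  \<open>0\<close>. As \<open>k\<close> is commutative, the same record serves as a left and as a right module.\<close>

definition trivial_module :: "('k, 'x) ring_scheme \<Rightarrow> 'b set \<Rightarrow> ('b \<Rightarrow> 'k, 'k) module" where
  "trivial_module k T = \<lparr>
     carrier = carrier k, monoid.mult = undefined, monoid.one = undefined,
     ring.zero = \<zero>\<^bsub>k\<^esub>, ring.add = ring.add k,
     module.smult = (\<lambda>f r. (\<Oplus>\<^bsub>k\<^esub>b\<in>{b \<in> T. f b \<noteq> \<zero>\<^bsub>k\<^esub>}. f b) \<otimes>\<^bsub>k\<^esub> r)\<rparr>"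

definition group_algebra :: "('k, 'x) ring_scheme \<Rightarrow> ('h, 'y) monoid_scheme \<Rightarrow> ('k, 'h \<Rightarrow> 'k) module" where
  "group_algebra k H = basis_algebra k (carrier H) (monoid.mult H) (\<lambda>x y. \<one>\<^bsub>k\<^esub>) \<one>\<^bsub>H\<^esub>"

definition group_trivial :: "('k, 'x) ring_scheme \<Rightarrow> ('h, 'y) monoid_scheme \<Rightarrow> ('h \<Rightarrow> 'k, 'k) module" where
  "group_trivial k H = trivial_module k (carrier H)"

abbreviation group_power :: "('g, 'x) monoid_scheme \<Rightarrow> nat \<Rightarrow> (nat \<Rightarrow> 'g) monoid" where
  "group_power G n \<equiv> product_group {..<n} (\<lambda>_. G)"


section \<open>Commutative \<open>G\<close>-rings\<close>

definition ring_aut_group :: "('k, 'x) ring_scheme \<Rightarrow> ('k \<Rightarrow> 'k) monoid" where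
  "ring_aut_group k = BijGroup (carrier k)\<lparr>carrier := ring_iso k k \<inter> Bij (carrier k)\<rparr>"

definition commutative_G_ring ::
  "('g, 'y) monoid_scheme \<Rightarrow> ('k, 'x) ring_scheme \<Rightarrow> ('g \<Rightarrow> 'k \<Rightarrow> 'k) \<Rightarrow> bool" where
  "commutative_G_ring G k act \<longleftrightarrow> cring k \<and> act \<in> hom G (ring_aut_group k)"


section \<open>Labelled Temperley--Lieb diagrams\<close>

text \<open>A node is a pair (column, height); a diagram has columns 0 (left) and 1 (right). A diagram is
  its set of labelled edges, an edge being given by its set of two end nodes.\<close>

type_synonym node = "nat \<times> nat"
type_synonym 'g diagram = "(node set \<times> 'g) set"

definition point :: "node \<Rightarrow> real ^ 2" where
  "point v = vector [real (fst v), real (snd v)]"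

text \<open>A drawing: pairwise disjoint arcs joining the nodes, running strictly between the columns.\<close>

definition planar :: "'g diagram \<Rightarrow> bool" where
  "planar E \<longleftrightarrow> (\<exists>\<gamma> :: node set \<times> 'g \<Rightarrow> real \<Rightarrow> real ^ 2.
     (\<forall>x\<in>E. arc (\<gamma> x) \<and> {pathstart (\<gamma> x), pathfinish (\<gamma> x)} = point ` fst x \<and>
        path_image (\<gamma> x) - point ` fst x \<subseteq> {z. 0 < z $ 1 \<and> z $ 1 < 1}) \<and>
     (\<forall>x\<in>E. \<forall>y\<in>E. x \<noteq> y \<longrightarrow> path_image (\<gamma> x) \<inter> path_image (\<gamma> y) = {}))"

definition diagrams :: "('g, 'y) monoid_scheme \<Rightarrow> nat \<Rightarrow> 'g diagram set" where
  "diagrams G n = {E.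
     (\<forall>(e, g)\<in>E. e \<subseteq> {0, 1} \<times> {..<n} \<and> card e = 2 \<and> g \<in> carrier G) \<and>
     (\<forall>v \<in> {0, 1} \<times> {..<n}. \<exists>!x. x \<in> E \<and> v \<in> fst x) \<and>
     planar E}"

definition identity_diagram :: "('g, 'y) monoid_scheme \<Rightarrow> nat \<Rightarrow> 'g diagram" where
  "identity_diagram G n = {({(0, i), (1, i)}, \<one>\<^bsub>G\<^esub>) | i. i < n}"

text \<open>Identifying the right nodes of \<open>x\<close> with the left nodes of \<open>y\<close> gives a graph on columns
  0, 1, 2 with 1 the middle column. Edges are tagged by the diagram they come from, since \<open>x\<close> and
  \<open>y\<close> may both have an edge with the same end nodes and label. The components, as sets of tagged
  edges, are paths (with two nodes in the outer columns) or closed loops (with none).\<close>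

definition glue :: "'g diagram \<Rightarrow> 'g diagram \<Rightarrow> (bool \<times> node set \<times> 'g) set" where
  "glue x y = {(False, e, g) | e g. (e, g) \<in> x} \<union>
     {(True, (\<lambda>(c, i). (Suc c, i)) ` e, g) | e g. (e, g) \<in> y}"

definition components :: "'g diagram \<Rightarrow> 'g diagram \<Rightarrow> (bool \<times> node set \<times> 'g) set set" where
  "components x y = glue x y //
     {(a, b). a \<in> glue x y \<and> b \<in> glue x y \<and> fst (snd a) \<inter> fst (snd b) \<noteq> {}}\<^sup>+"

definition component_label :: "('g, 'y) monoid_scheme \<Rightarrow> (bool \<times> node set \<times> 'g) set \<Rightarrow> 'g" where
  "component_label G C = (\<Otimes>\<^bsub>G\<^esub>a\<in>C. snd (snd a))"

definition outer_nodes :: "(bool \<times> node set \<times> 'g) set \<Rightarrow> node set" where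
  "outer_nodes C = {v \<in> (\<Union>a\<in>C. fst (snd a)). fst v \<noteq> 1}"

definition diagram_comp :: "('g, 'y) monoid_scheme \<Rightarrow> 'g diagram \<Rightarrow> 'g diagram \<Rightarrow> 'g diagram" where
  "diagram_comp G x y =
     {((\<lambda>(c, i). (if c = 0 then 0 else 1, i)) ` outer_nodes C, component_label G C) | C.
        C \<in> components x y \<and> outer_nodes C \<noteq> {}}"

definition loop_factor ::
  "('g, 'y) monoid_scheme \<Rightarrow> ('k, 'x) ring_scheme \<Rightarrow> ('g \<Rightarrow> 'k \<Rightarrow> 'k) \<Rightarrow> 'k \<Rightarrow> 'g diagram \<Rightarrow> 'g diagram \<Rightarrow> 'k" where
  "loop_factor G k act \<delta> x y =
     (\<Otimes>\<^bsub>k\<^esub>C\<in>{C \<in> components x y. outer_nodes C = {}}. act (component_label G C) \<delta>)"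

definition GTL ::
  "('g, 'y) monoid_scheme \<Rightarrow> ('k, 'x) ring_scheme \<Rightarrow> ('g \<Rightarrow> 'k \<Rightarrow> 'k) \<Rightarrow> nat \<Rightarrow> 'k \<Rightarrow> ('k, 'g diagram \<Rightarrow> 'k) module" where
  "GTL G k act n \<delta> =
     basis_algebra k (diagrams G n) (diagram_comp G) (loop_factor G k act \<delta>) (identity_diagram G n)"

definition GTL_trivial ::
  "('g, 'y) monoid_scheme \<Rightarrow> ('k, 'x) ring_scheme \<Rightarrow> nat \<Rightarrow> ('g diagram \<Rightarrow> 'k, 'k) module" where
  "GTL_trivial G k n = trivial_module k
     {E \<in> diagrams G n. \<forall>(e, g)\<in>E. \<not> e \<subseteq> {0} \<times> UNIV \<and> \<not> e \<subseteq> {1} \<times> UNIV}"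

end

theory Submission
  imports Defs
begin

text \<open>Let \<open>A\<close> be the Temperley--Lieb algebra, \<open>I\<close> its ideal spanned by the diagrams with a
  left-to-left edge; \<open>A / I\<close> is \<open>k[G\<^sup>n]\<close>, since a planar diagram without such an edge consists of \<open>n\<close>
  parallel labelled strands. Given projective resolutions \<open>P\<close> over \<open>A\<close> and \<open>Q\<close> over \<open>A / I\<close>, it is enough
  that \<open>P / I P\<close> is again exact: then \<open>P \<rightarrow> Q\<close> and \<open>Q \<rightarrow> P / I P\<close> are inverse up to homotopy modulo \<open>I\<close>,
  and \<open>\<one> \<otimes> P = P / K P\<close> only sees \<open>P / I P\<close>, where \<open>K \<supseteq> I\<close> is the augmentation ideal.

  For exactness it is enough that \<open>I P\<close> is acyclic (augmentation included, as \<open>I\<close> kills \<open>\<one>\<close>). By planarity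
  every diagram in \<open>I\<close> has a left edge between adjacent nodes, so \<open>I\<close> is the sum of the right ideals \<open>E A\<close>
  where \<open>E\<close> runs over the diagrams with one labelled cup and cap at the places \<open>j, j + 1\<close>, and straight
  strands elsewhere. As the scalar of a loop is invertible, \<open>E\<close> is idempotent up to a unit, so \<open>E P\<close> is
  acyclic. Adding the \<open>E\<close> one after the other in the order of \<open>j\<close>, the new \<open>E A\<close> meets the sum \<open>U\<close> of the
  earlier ones only in \<open>E V\<close>, where \<open>V \<subseteq> U\<close> belongs to the places before \<open>j - 1\<close>, and acyclicity of \<open>U P\<close>
  and \<open>V P\<close> passes to \<open>(U + E A) P\<close>.\<close>

section \<open>Modules, quotients and free modules\<close>

text \<open>Two facts about diagrams are not proved with graphs. That they span a ring, in
  particular that composition is associative, is part of what a resolution by modules says. That a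
  composite is again a diagram follows because the product lies in the algebra and its coefficient,
  a product of translates of the unit \<delta>, is nonzero; hence the zero ring is set apart.
  Planarity of a given diagram is used through one fact: two arcs of a drawing never have
  alternating ends around the strip. \<open>E A\<close> is the span of the diagrams with the given
  labelled left cup, since composition keeps the left edges of the first factor and \<open>E\<close>
  fixes each such diagram. Intersections of these right ideals can therefore be read off from sets
  of diagrams. Cups at the same place with different labels, and cups at adjacent places, share a
  node and exclude each other; cups further away are left alone by \<open>E\<close>. As the group
  may be infinite, the labels at one place are exhausted by finite sets.\<close>

lemma (in abelian_group) minus_eq_zero_iff:
  assumes "x \<in> carrier G" "y \<in> carrier G" shows "x \<ominus> y = \<zero> \<longleftrightarrow> x = y"
proof
  assume "x \<ominus> y = \<zero>"
  then have "x \<oplus> \<ominus> y \<oplus> y = y" using assms by (simp add: a_minus_def)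
  then show "x = y" using assms by (simp add: a_assoc l_neg)
qed (use assms in \<open>simp add: a_minus_def r_neg\<close>)

context left_module
begin

lemma lsmult_l_null: 
  assumes "x \<in> carrier M" shows "\<zero>\<^bsub>A\<^esub> \<odot>\<^bsub>M\<^esub> x = \<zero>\<^bsub>M\<^esub>"
proof -
  have "\<zero>\<^bsub>A\<^esub> \<odot>\<^bsub>M\<^esub> x \<oplus>\<^bsub>M\<^esub> \<zero>\<^bsub>A\<^esub> \<odot>\<^bsub>M\<^esub> x = \<zero>\<^bsub>A\<^esub> \<odot>\<^bsub>M\<^esub> x"
    using lsmult_l_distr[of "\<zero>\<^bsub>A\<^esub>" "\<zero>\<^bsub>A\<^esub>" x] assms by simp
  then show ?thesis
    using assms lsmult_closed[of "\<zero>\<^bsub>A\<^esub>" x] M.add.l_cancel_one by auto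
qed

lemma lsmult_r_null: 
  assumes "a \<in> carrier A" shows "a \<odot>\<^bsub>M\<^esub> \<zero>\<^bsub>M\<^esub> = \<zero>\<^bsub>M\<^esub>"
proof -
  have "a \<odot>\<^bsub>M\<^esub> \<zero>\<^bsub>M\<^esub> \<oplus>\<^bsub>M\<^esub> a \<odot>\<^bsub>M\<^esub> \<zero>\<^bsub>M\<^esub> = a \<odot>\<^bsub>M\<^esub> \<zero>\<^bsub>M\<^esub>"
    using lsmult_r_distr[of a "\<zero>\<^bsub>M\<^esub>" "\<zero>\<^bsub>M\<^esub>"] assms by simp
  then show ?thesis
    using assms lsmult_closed[of a "\<zero>\<^bsub>M\<^esub>"] M.add.l_cancel_one by auto
qed

lemma lsmult_l_minus: 
  assumes "a \<in> carrier A" "x \<in> carrier M" shows "(\<ominus>\<^bsub>A\<^esub> a) \<odot>\<^bsub>M\<^esub> x = \<ominus>\<^bsub>M\<^esub> (a \<odot>\<^bsub>M\<^esub> x)"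
proof -
  have "(\<ominus>\<^bsub>A\<^esub> a) \<odot>\<^bsub>M\<^esub> x \<oplus>\<^bsub>M\<^esub> a \<odot>\<^bsub>M\<^esub> x = \<zero>\<^bsub>M\<^esub>"
    using lsmult_l_distr[of "\<ominus>\<^bsub>A\<^esub> a" a x] assms lsmult_l_null by (simp add: R.l_neg)
  then show ?thesis using assms lsmult_closed M.minus_equality by simp
qed

lemma lsmult_r_minus: 
  assumes "a \<in> carrier A" "x \<in> carrier M" shows "a \<odot>\<^bsub>M\<^esub> (\<ominus>\<^bsub>M\<^esub> x) = \<ominus>\<^bsub>M\<^esub> (a \<odot>\<^bsub>M\<^esub> x)"
proof -
  have "a \<odot>\<^bsub>M\<^esub> (\<ominus>\<^bsub>M\<^esub> x) \<oplus>\<^bsub>M\<^esub> a \<odot>\<^bsub>M\<^esub> x = \<zero>\<^bsub>M\<^esub>"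
    using lsmult_r_distr[of a "\<ominus>\<^bsub>M\<^esub> x" x] assms lsmult_r_null by (simp add: M.l_neg)
  then show ?thesis using assms lsmult_closed M.minus_equality by simp
qed

lemma lsmult_diff: 
  assumes "a \<in> carrier A" "x \<in> carrier M" "y \<in> carrier M"
  shows "a \<odot>\<^bsub>M\<^esub> (x \<ominus>\<^bsub>M\<^esub> y) = a \<odot>\<^bsub>M\<^esub> x \<ominus>\<^bsub>M\<^esub> a \<odot>\<^bsub>M\<^esub> y"
  using assms by (simp add: a_minus_def lsmult_r_distr lsmult_r_minus)

lemma submoduleI:
  assumes "H \<subseteq> carrier M" "\<zero>\<^bsub>M\<^esub> \<in> H"
    and "\<And>x y. \<lbrakk>x \<in> H; y \<in> H\<rbrakk> \<Longrightarrow> x \<oplus>\<^bsub>M\<^esub> y \<in> H"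
    and "\<And>a x. \<lbrakk>a \<in> carrier A; x \<in> H\<rbrakk> \<Longrightarrow> a \<odot>\<^bsub>M\<^esub> x \<in> H"
  shows "submodule H A M"
proof -
  have "\<ominus>\<^bsub>M\<^esub> x \<in> H" if "x \<in> H" for x
    using that assms(1) assms(4)[of "\<ominus>\<^bsub>A\<^esub> \<one>\<^bsub>A\<^esub>" x] lsmult_l_minus[of "\<one>\<^bsub>A\<^esub>" x] lsmult_one[of x] by auto
  then show ?thesis
    using assms by (intro submodule.intro subgroup.intro submodule_axioms.intro) (auto simp: a_inv_def)
qed

end

lemma submoduleD:
  assumes "submodule H A M"
  shows "H \<subseteq> carrier M" "\<zero>\<^bsub>M\<^esub> \<in> H"
    "\<And>x y. \<lbrakk>x \<in> H; y \<in> H\<rbrakk> \<Longrightarrow> x \<oplus>\<^bsub>M\<^esub> y \<in> H"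
    "\<And>a x. \<lbrakk>a \<in> carrier A; x \<in> H\<rbrakk> \<Longrightarrow> a \<odot>\<^bsub>M\<^esub> x \<in> H"
    "\<And>x. x \<in> H \<Longrightarrow> \<ominus>\<^bsub>M\<^esub> x \<in> H"
  using submodule.axioms[OF assms] submodule.smult_closed[OF assms]
  by (auto simp: subgroup_def a_inv_def)

lemma lin_homI:
  assumes "\<And>x. x \<in> carrier M \<Longrightarrow> h x \<in> carrier N"
    and "\<And>x y. \<lbrakk>x \<in> carrier M; y \<in> carrier M\<rbrakk> \<Longrightarrow> h (x \<oplus>\<^bsub>M\<^esub> y) = h x \<oplus>\<^bsub>N\<^esub> h y"
    and "\<And>a x. \<lbrakk>a \<in> carrier A; x \<in> carrier M\<rbrakk> \<Longrightarrow> h (a \<odot>\<^bsub>M\<^esub> x) = a \<odot>\<^bsub>N\<^esub> h x"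
  shows "h \<in> lin_hom A M N"
  using assms by (simp add: lin_hom_def)

lemma lin_homD:
  assumes "h \<in> lin_hom A M N"
  shows "\<And>x. x \<in> carrier M \<Longrightarrow> h x \<in> carrier N"
    and "\<And>x y. \<lbrakk>x \<in> carrier M; y \<in> carrier M\<rbrakk> \<Longrightarrow> h (x \<oplus>\<^bsub>M\<^esub> y) = h x \<oplus>\<^bsub>N\<^esub> h y"
    and "\<And>a x. \<lbrakk>a \<in> carrier A; x \<in> carrier M\<rbrakk> \<Longrightarrow> h (a \<odot>\<^bsub>M\<^esub> x) = a \<odot>\<^bsub>N\<^esub> h x"
  using assms by (auto simp: lin_hom_def)

lemma left_module_abelian_group: "left_module A M \<Longrightarrow> abelian_group M"
  by (simp add: left_module_def)

lemma left_module_ring: "left_module A M \<Longrightarrow> ring A"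
  by (simp add: left_module_def)

lemma lin_hom_zero:
  assumes "h \<in> lin_hom A M N" "abelian_group M" "abelian_group N"
  shows "h \<zero>\<^bsub>M\<^esub> = \<zero>\<^bsub>N\<^esub>"
proof -
  interpret M: abelian_group M by fact
  interpret N: abelian_group N by fact
  have "h \<zero>\<^bsub>M\<^esub> \<oplus>\<^bsub>N\<^esub> h \<zero>\<^bsub>M\<^esub> = h \<zero>\<^bsub>M\<^esub>"
    using lin_homD(2)[OF assms(1), of "\<zero>\<^bsub>M\<^esub>" "\<zero>\<^bsub>M\<^esub>"] by simp
  then show ?thesis using lin_homD(1)[OF assms(1)] N.add.l_cancel_one by auto
qed

lemma lin_hom_minus:
  assumes "h \<in> lin_hom A M N" "abelian_group M" "abelian_group N" "x \<in> carrier M"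
  shows "h (\<ominus>\<^bsub>M\<^esub> x) = \<ominus>\<^bsub>N\<^esub> h x"
proof -
  interpret M: abelian_group M by fact
  interpret N: abelian_group N by fact
  have "h (\<ominus>\<^bsub>M\<^esub> x) \<oplus>\<^bsub>N\<^esub> h x = \<zero>\<^bsub>N\<^esub>"
    using lin_homD(2)[OF assms(1), of "\<ominus>\<^bsub>M\<^esub> x" x] lin_hom_zero[OF assms(1-3)] assms(4) by (simp add: M.l_neg)
  then show ?thesis using lin_homD(1)[OF assms(1)] assms(4) N.minus_equality by simp
qed

lemma lin_hom_diff:
  assumes "h \<in> lin_hom A M N" "abelian_group M" "abelian_group N" "x \<in> carrier M" "y \<in> carrier M"
  shows "h (x \<ominus>\<^bsub>M\<^esub> y) = h x \<ominus>\<^bsub>N\<^esub> h y"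
  using assms lin_hom_minus[OF assms(1-3)] lin_homD(2)[OF assms(1)] abelian_group.a_inv_closed[OF assms(2)]
  by (simp add: a_minus_def)

lemma lin_hom_comp:
  assumes "f \<in> lin_hom A L M" "g \<in> lin_hom A M N"
  shows "g \<circ> f \<in> lin_hom A L N"
  using lin_homD[OF assms(1)] lin_homD[OF assms(2)] by (intro lin_homI) auto

lemma lin_hom_sub:
  assumes "f \<in> lin_hom A M N" "g \<in> lin_hom A M N" "left_module A M" "left_module A N"
  shows "(\<lambda>x. f x \<ominus>\<^bsub>N\<^esub> g x) \<in> lin_hom A M N"
proof -
  interpret M: left_module A M by fact
  interpret N: left_module A N by fact
  show ?thesis
    using lin_homD[OF assms(1)] lin_homD[OF assms(2)]
    by (intro lin_homI)
      (auto simp: a_minus_def N.M.minus_add N.M.a_ac N.lsmult_r_distr N.lsmult_r_minus)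
qed

text \<open>No law of \<open>N\<close> is assumed; each is carried over from \<open>M\<close> along
  the surjection. Quotients become modules this way, and so does the trivial module as the target of
  the augmentation of a resolution.\<close>

lemma left_module_image:
  assumes "left_module A M" and h: "h \<in> lin_hom A M N" and onto: "h ` carrier M = carrier N"
    and hz: "h \<zero>\<^bsub>M\<^esub> = \<zero>\<^bsub>N\<^esub>"
  shows "left_module A N"
proof -
  interpret left_module A M by fact
  note hD = lin_homD(2,3)[OF h, symmetric]
  have ex: "\<exists>x'\<in>carrier M. x = h x'" if "x \<in> carrier N" for x using that onto by auto
  show ?thesis
  proof (intro left_module.intro left_module_axioms.intro abelian_groupI)
    show "ring A" by (rule R.ring_axioms)
  next
    fix x y assume "x \<in> carrier N" "y \<in> carrier N"
    then obtain x' y' where "x' \<in> carrier M" "y' \<in> carrier M" "x = h x'" "y = h y'" using ex by blast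
    then show "x \<oplus>\<^bsub>N\<^esub> y \<in> carrier N" "x \<oplus>\<^bsub>N\<^esub> y = y \<oplus>\<^bsub>N\<^esub> x"
      using lin_homD(1)[OF h] by (auto simp: hD M.a_comm)
  next
    show "\<zero>\<^bsub>N\<^esub> \<in> carrier N" using lin_homD(1)[OF h M.zero_closed] by (simp add: hz)
  next
    fix x y z assume "x \<in> carrier N" "y \<in> carrier N" "z \<in> carrier N"
    then obtain x' y' z' where "x' \<in> carrier M" "y' \<in> carrier M" "z' \<in> carrier M" "x = h x'" "y = h y'" "z = h z'"
      using ex by metis
    then show "x \<oplus>\<^bsub>N\<^esub> y \<oplus>\<^bsub>N\<^esub> z = x \<oplus>\<^bsub>N\<^esub> (y \<oplus>\<^bsub>N\<^esub> z)"
      by (simp add: hD M.a_assoc)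
  next
    fix x assume "x \<in> carrier N"
    then obtain x' where x': "x' \<in> carrier M" "x = h x'" using ex by blast
    then show "\<zero>\<^bsub>N\<^esub> \<oplus>\<^bsub>N\<^esub> x = x" by (simp add: hD flip: hz)
    show "\<exists>y\<in>carrier N. y \<oplus>\<^bsub>N\<^esub> x = \<zero>\<^bsub>N\<^esub>"
      using x' lin_homD(1)[OF h] by (intro bexI[of _ "h (\<ominus>\<^bsub>M\<^esub> x')"]) (auto simp: hD M.l_neg hz)
    show "\<one>\<^bsub>A\<^esub> \<odot>\<^bsub>N\<^esub> x = x" using x' by (simp add: hD lsmult_one)
  next
    fix a x assume "a \<in> carrier A" "x \<in> carrier N"
    moreover from this obtain x' where "x' \<in> carrier M" "x = h x'" using ex by blast
    ultimately show "a \<odot>\<^bsub>N\<^esub> x \<in> carrier N" using lin_homD(1)[OF h] by (simp add: hD lsmult_closed)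
  next
    fix a b x assume "a \<in> carrier A" "b \<in> carrier A" "x \<in> carrier N"
    moreover from this obtain x' where "x' \<in> carrier M" "x = h x'" using ex by blast
    ultimately show "(a \<oplus>\<^bsub>A\<^esub> b) \<odot>\<^bsub>N\<^esub> x = a \<odot>\<^bsub>N\<^esub> x \<oplus>\<^bsub>N\<^esub> b \<odot>\<^bsub>N\<^esub> x"
      "(a \<otimes>\<^bsub>A\<^esub> b) \<odot>\<^bsub>N\<^esub> x = a \<odot>\<^bsub>N\<^esub> (b \<odot>\<^bsub>N\<^esub> x)"
      by (simp_all add: hD lsmult_l_distr lsmult_assoc lsmult_closed)
  next
    fix a x y assume "a \<in> carrier A" "x \<in> carrier N" "y \<in> carrier N"
    moreover from this obtain x' y' where "x' \<in> carrier M" "y' \<in> carrier M" "x = h x'" "y = h y'" using ex by metis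
    ultimately show "a \<odot>\<^bsub>N\<^esub> (x \<oplus>\<^bsub>N\<^esub> y) = a \<odot>\<^bsub>N\<^esub> x \<oplus>\<^bsub>N\<^esub> a \<odot>\<^bsub>N\<^esub> y"
      by (simp add: hD lsmult_r_distr lsmult_closed)
  qed
qed

lemma left_module_submodule:
  assumes "left_module A M" "submodule H A M"
  shows "left_module A (M\<lparr>carrier := H\<rparr>)"
proof -
  interpret left_module A M by fact
  note H = submoduleD[OF assms(2)]
  have HM: "x \<in> carrier M" if "x \<in> H" for x using that H(1) by auto
  show ?thesis
  proof (intro left_module.intro left_module_axioms.intro abelian_groupI)
    show "ring A" by (rule R.ring_axioms)
    show "\<exists>y\<in>carrier (M\<lparr>carrier := H\<rparr>). y \<oplus>\<^bsub>M\<lparr>carrier := H\<rparr>\<^esub> x = \<zero>\<^bsub>M\<lparr>carrier := H\<rparr>\<^esub>"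
      if "x \<in> carrier (M\<lparr>carrier := H\<rparr>)" for x
      using that H(5)[of x] HM[of x] M.l_neg[of x] by auto
  qed (auto simp: H HM M.a_ac lsmult_r_distr lsmult_l_distr lsmult_assoc lsmult_one)
qed

section \<open>Quotients by a submodule\<close>

context
  fixes A :: "('a, 'x) ring_scheme" and M :: "('a, 'm, 'y) module_scheme" and N
  assumes M: "left_module A M" and N: "submodule N A M"
begin

interpretation M: left_module A M by (rule M)
interpretation N: abelian_subgroup N M
  using N by (intro abelian_subgroupI3 additive_subgroupI) (simp_all add: submodule_def M.abelian_group_axioms)

lemma quot_carrier: "carrier (quot_module M N) = (\<lambda>x. N +>\<^bsub>M\<^esub> x) ` carrier M"
  by (auto simp: quot_module_def A_RCOSETS_def')

lemma quot_eq_iff: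
  assumes "x \<in> carrier M" "y \<in> carrier M"
  shows "N +>\<^bsub>M\<^esub> x = N +>\<^bsub>M\<^esub> y \<longleftrightarrow> x \<ominus>\<^bsub>M\<^esub> y \<in> N"
proof
  have sub: "N \<subseteq> carrier M" "subgroup N (add_monoid M)" using N.a_subset N.a_subgroup by auto
  show "x \<ominus>\<^bsub>M\<^esub> y \<in> N" if "N +>\<^bsub>M\<^esub> x = N +>\<^bsub>M\<^esub> y"
    using M.M.a_coset_add_inv2[OF that assms sub(1)] M.M.a_coset_join1[of N "x \<ominus>\<^bsub>M\<^esub> y"] sub assms
    by (simp add: a_minus_def)
  show "N +>\<^bsub>M\<^esub> x = N +>\<^bsub>M\<^esub> y" if "x \<ominus>\<^bsub>M\<^esub> y \<in> N"
    using M.M.a_coset_add_inv1[of N x y] M.M.a_coset_join2[of "x \<ominus>\<^bsub>M\<^esub> y" N] that sub assms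
    by (simp add: a_minus_def)
qed

lemma quot_zero: "\<zero>\<^bsub>quot_module M N\<^esub> = N +>\<^bsub>M\<^esub> \<zero>\<^bsub>M\<^esub>"
  using N.a_subset by (simp add: quot_module_def)

lemma quot_eq_zero_iff:
  assumes "x \<in> carrier M"
  shows "N +>\<^bsub>M\<^esub> x = \<zero>\<^bsub>quot_module M N\<^esub> \<longleftrightarrow> x \<in> N"
  using assms quot_eq_iff[OF assms M.M.zero_closed] by (simp add: quot_zero a_minus_def M.M.minus_equality[of "\<zero>\<^bsub>M\<^esub>" "\<zero>\<^bsub>M\<^esub>"])

lemma quot_proj_hom: "(\<lambda>x. N +>\<^bsub>M\<^esub> x) \<in> lin_hom A M (quot_module M N)"
proof (rule lin_homI)
  show "N +>\<^bsub>M\<^esub> x \<in> carrier (quot_module M N)" if "x \<in> carrier M" for x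
    using that by (simp add: quot_carrier)
  show "N +>\<^bsub>M\<^esub> (x \<oplus>\<^bsub>M\<^esub> y) = (N +>\<^bsub>M\<^esub> x) \<oplus>\<^bsub>quot_module M N\<^esub> (N +>\<^bsub>M\<^esub> y)"
    if "x \<in> carrier M" "y \<in> carrier M" for x y
    using that by (simp add: quot_module_def N.a_rcos_sum)
  show "N +>\<^bsub>M\<^esub> (a \<odot>\<^bsub>M\<^esub> x) = a \<odot>\<^bsub>quot_module M N\<^esub> (N +>\<^bsub>M\<^esub> x)"
    if a: "a \<in> carrier A" and x: "x \<in> carrier M" for a x
  proof -
    \<comment> \<open>Scalars act on a coset by a union over its representatives. All of them give
      the same coset, so the union is that coset and the action is the usual one.\<close>
    have const: "N +>\<^bsub>M\<^esub> (a \<odot>\<^bsub>M\<^esub> y) = N +>\<^bsub>M\<^esub> (a \<odot>\<^bsub>M\<^esub> x)" if "y \<in> N +>\<^bsub>M\<^esub> x" for y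
    proof -
      have y: "y \<in> carrier M" using that M.M.a_r_coset_subset_G[OF N.a_subset x] by auto
      have "N +>\<^bsub>M\<^esub> y = N +>\<^bsub>M\<^esub> x"
        using M.M.a_repr_independence[OF that x N.a_subgroup] by simp
      then have "y \<ominus>\<^bsub>M\<^esub> x \<in> N" using quot_eq_iff x y by blast
      then have "a \<odot>\<^bsub>M\<^esub> (y \<ominus>\<^bsub>M\<^esub> x) \<in> N" using submoduleD(4)[OF N] a by blast
      then show ?thesis using a x y quot_eq_iff by (simp add: M.lsmult_diff M.lsmult_closed)
    qed
    have "(\<Union>y\<in>N +>\<^bsub>M\<^esub> x. N +>\<^bsub>M\<^esub> (a \<odot>\<^bsub>M\<^esub> y)) = N +>\<^bsub>M\<^esub> (a \<odot>\<^bsub>M\<^esub> x)"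
    proof (rule SUP_eq_const)
      show "N +>\<^bsub>M\<^esub> x \<noteq> {}" using N.a_rcos_self[OF x] by blast
    qed (rule const)
    then show ?thesis by (simp add: quot_module_def)
  qed
qed

lemma left_module_quot: "left_module A (quot_module M N)"
  by (rule left_module_image[OF M quot_proj_hom]) (simp_all add: quot_carrier quot_zero)

end

text \<open>The first isomorphism theorem without a quotient: both targets are images of
  \<open>L\<close> with the same kernel. It serves to compare two Tor modules that are presented by
  the same cycles.\<close>

lemma iso_of_same_kernel:
  assumes L: "left_module R L" and T: "left_module R T" "left_module R T'"
    and p: "p \<in> lin_hom R L T" "p ` carrier L = carrier T"
    and q: "q \<in> lin_hom R L T'" "q ` carrier L = carrier T'"
    and ker: "\<And>x. x \<in> carrier L \<Longrightarrow> p x = \<zero>\<^bsub>T\<^esub> \<longleftrightarrow> q x = \<zero>\<^bsub>T'\<^esub>"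
  shows "module_isomorphic R T T'"
proof -
  interpret L: left_module R L by fact
  interpret T: left_module R T by fact
  interpret T': left_module R T' by fact
  have kerd: "p x = p y \<longleftrightarrow> q x = q y" if "x \<in> carrier L" "y \<in> carrier L" for x y
  proof -
    have "p x = p y \<longleftrightarrow> p (x \<ominus>\<^bsub>L\<^esub> y) = \<zero>\<^bsub>T\<^esub>"
      using that lin_homD(1)[OF p(1)] lin_hom_diff[OF p(1) L.M.abelian_group_axioms T.M.abelian_group_axioms]
      by (simp add: T.M.minus_eq_zero_iff)
    moreover have "q x = q y \<longleftrightarrow> q (x \<ominus>\<^bsub>L\<^esub> y) = \<zero>\<^bsub>T'\<^esub>"
      using that lin_homD(1)[OF q(1)] lin_hom_diff[OF q(1) L.M.abelian_group_axioms T'.M.abelian_group_axioms]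
      by (simp add: T'.M.minus_eq_zero_iff)
    moreover have "x \<ominus>\<^bsub>L\<^esub> y \<in> carrier L" using that by simp
    ultimately show ?thesis using ker by blast
  qed
  \<comment> \<open>A set-theoretic section of \<open>p\<close>. As the kernels agree,
    \<open>q\<close> is constant on the fibres of \<open>p\<close>, so \<open>q\<close> after
    \<open>s\<close> is linear although \<open>s\<close> need not be.\<close>
  define s where "s t = (SOME x. x \<in> carrier L \<and> p x = t)" for t
  have s: "s t \<in> carrier L \<and> p (s t) = t" if "t \<in> carrier T" for t
  proof -
    have "t \<in> p ` carrier L" using that by (simp only: p(2))
    then have "\<exists>x. x \<in> carrier L \<and> p x = t" by (elim imageE) auto
    then show ?thesis unfolding s_def by (rule someI_ex)
  qed
  define h where "h t = q (s t)" for t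
  have h: "h (p x) = q x" if "x \<in> carrier L" for x
    using s[of "p x"] kerd[of "s (p x)" x] that lin_homD(1)[OF p(1)] by (simp add: h_def)
  have ex: "\<exists>x\<in>carrier L. t = p x" if "t \<in> carrier T" for t using s[OF that] by metis
  have "h \<in> lin_hom R T T'"
  proof (rule lin_homI)
    show "h t \<in> carrier T'" if "t \<in> carrier T" for t
      using s[OF that] lin_homD(1)[OF q(1)] by (simp add: h_def)
    fix t u assume "t \<in> carrier T" "u \<in> carrier T"
    then obtain x y where "x \<in> carrier L" "y \<in> carrier L" "t = p x" "u = p y" using ex by metis
    then show "h (t \<oplus>\<^bsub>T\<^esub> u) = h t \<oplus>\<^bsub>T'\<^esub> h u"
      using lin_homD(2)[OF p(1), symmetric] lin_homD(2)[OF q(1)] by (simp add: h)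
  next
    fix a t assume "a \<in> carrier R" "t \<in> carrier T"
    moreover from this obtain x where "x \<in> carrier L" "t = p x" using ex by metis
    ultimately show "h (a \<odot>\<^bsub>T\<^esub> t) = a \<odot>\<^bsub>T'\<^esub> h t"
      using lin_homD(3)[OF p(1), symmetric] lin_homD(3)[OF q(1)] by (simp add: h L.lsmult_closed)
  qed
  moreover have "bij_betw h (carrier T) (carrier T')"
  proof -
    have "inj_on h (carrier T)"
    proof (rule inj_onI)
      fix t u assume tu: "t \<in> carrier T" "u \<in> carrier T" and eq: "h t = h u"
      obtain x y where "x \<in> carrier L" "y \<in> carrier L" "t = p x" "u = p y" using ex tu by metis
      then show "t = u" using eq kerd[of x y] by (simp add: h)
    qed
    moreover have "h ` carrier T = carrier T'"
      unfolding p(2)[symmetric] q(2)[symmetric] image_image using h by (intro image_cong) auto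
    ultimately show ?thesis by (simp add: bij_betw_def)
  qed
  ultimately show ?thesis unfolding module_isomorphic_def by blast
qed

section \<open>Free modules and their universal property\<close>

lemma free_module_simps [simp]:
  "\<zero>\<^bsub>free_module A S\<^esub> = (\<lambda>s. \<zero>\<^bsub>A\<^esub>)"
  "f \<oplus>\<^bsub>free_module A S\<^esub> g = (\<lambda>s. f s \<oplus>\<^bsub>A\<^esub> g s)"
  "a \<odot>\<^bsub>free_module A S\<^esub> f = (\<lambda>s. a \<otimes>\<^bsub>A\<^esub> f s)"
  by (simp_all add: free_module_def)

lemma free_module_carrier:
  "f \<in> carrier (free_module A S) \<longleftrightarrow>
     (\<forall>s. f s \<in> carrier A) \<and> (\<forall>s. s \<notin> S \<longrightarrow> f s = \<zero>\<^bsub>A\<^esub>) \<and> finite {s. f s \<noteq> \<zero>\<^bsub>A\<^esub>}"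
  by (simp add: free_module_def)

lemma left_module_free:
  assumes "ring A" shows "left_module A (free_module A S)"
proof -
  interpret ring A by fact
  show ?thesis
  proof (intro left_module.intro left_module_axioms.intro abelian_groupI)
    show "ring A" by fact
    show "f \<oplus>\<^bsub>free_module A S\<^esub> g \<in> carrier (free_module A S)"
      if "f \<in> carrier (free_module A S)" "g \<in> carrier (free_module A S)" for f g
    proof -
      have "{s. f s \<oplus>\<^bsub>A\<^esub> g s \<noteq> \<zero>\<^bsub>A\<^esub>} \<subseteq> {s. f s \<noteq> \<zero>\<^bsub>A\<^esub>} \<union> {s. g s \<noteq> \<zero>\<^bsub>A\<^esub>}" by auto
      then have "finite {s. f s \<oplus>\<^bsub>A\<^esub> g s \<noteq> \<zero>\<^bsub>A\<^esub>}"
        using that by (elim finite_subset) (simp add: free_module_carrier)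
      then show ?thesis using that by (simp add: free_module_carrier)
    qed
    show "a \<odot>\<^bsub>free_module A S\<^esub> f \<in> carrier (free_module A S)"
      if "a \<in> carrier A" "f \<in> carrier (free_module A S)" for a f
    proof -
      have "{s. a \<otimes>\<^bsub>A\<^esub> f s \<noteq> \<zero>\<^bsub>A\<^esub>} \<subseteq> {s. f s \<noteq> \<zero>\<^bsub>A\<^esub>}" using that(1) by auto
      then have "finite {s. a \<otimes>\<^bsub>A\<^esub> f s \<noteq> \<zero>\<^bsub>A\<^esub>}"
        using that by (elim finite_subset) (simp add: free_module_carrier)
      then show ?thesis using that by (simp add: free_module_carrier)
    qed
    show "\<exists>g\<in>carrier (free_module A S). g \<oplus>\<^bsub>free_module A S\<^esub> f = \<zero>\<^bsub>free_module A S\<^esub>"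
      if "f \<in> carrier (free_module A S)" for f
    proof (rule bexI[of _ "\<lambda>s. \<ominus>\<^bsub>A\<^esub> f s"])
      have eq: "{s. \<ominus>\<^bsub>A\<^esub> f s \<noteq> \<zero>\<^bsub>A\<^esub>} = {s. f s \<noteq> \<zero>\<^bsub>A\<^esub>}"
        using that by (auto simp: free_module_carrier)
      show "(\<lambda>s. \<ominus>\<^bsub>A\<^esub> f s) \<in> carrier (free_module A S)"
        using that unfolding free_module_carrier eq by auto
    qed (use that in \<open>auto simp: free_module_carrier l_neg\<close>)
  qed (auto simp: free_module_carrier a_ac l_distr r_distr m_assoc)
qed

lemma single_closed:
  assumes "ring A" "s \<in> S" shows "single A s \<in> carrier (free_module A S)"
proof -
  interpret ring A by fact
  have "finite {t. single A s t \<noteq> \<zero>\<^bsub>A\<^esub>}"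
    by (rule finite_subset[of _ "{s}"]) (auto simp: single_def)
  then show ?thesis using assms by (auto simp: free_module_carrier single_def)
qed

lemma free_module_induct [consumes 2, case_names P0 add]:
  assumes f: "f \<in> carrier (free_module A S)" and A: "ring A"
    and P0: "P (\<lambda>s. \<zero>\<^bsub>A\<^esub>)"
    and add: "\<And>a s g. \<lbrakk>a \<in> carrier A; s \<in> S; g \<in> carrier (free_module A S); P g\<rbrakk> \<Longrightarrow>
      P (a \<odot>\<^bsub>free_module A S\<^esub> single A s \<oplus>\<^bsub>free_module A S\<^esub> g)"
  shows "P f"
proof -
  interpret ring A by fact
  \<comment> \<open>The induction is on a finite set that contains the support: deleting one
    coefficient then leads into the smaller set, whether or not that coefficient was zero.\<close>
  have "finite T \<Longrightarrow> f \<in> carrier (free_module A S) \<Longrightarrow> {s. f s \<noteq> \<zero>\<^bsub>A\<^esub>} \<subseteq> T \<Longrightarrow> P f" for T f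
  proof (induction T arbitrary: f rule: finite_induct)
    case empty
    then have "f = (\<lambda>s. \<zero>\<^bsub>A\<^esub>)" by auto
    then show ?case using P0 by simp
  next
    case (insert t T)
    define g where "g = f(t := \<zero>\<^bsub>A\<^esub>)"
    have fin: "finite {s. g s \<noteq> \<zero>\<^bsub>A\<^esub>}" "{s. g s \<noteq> \<zero>\<^bsub>A\<^esub>} \<subseteq> T"
      using insert.hyps insert.prems by (auto simp: g_def intro: finite_subset[of _ T])
    have g: "g \<in> carrier (free_module A S)"
      using insert.prems fin by (auto simp: free_module_carrier g_def)
    have f: "f = f t \<odot>\<^bsub>free_module A S\<^esub> single A t \<oplus>\<^bsub>free_module A S\<^esub> g"
      using insert.prems by (auto simp: single_def g_def free_module_carrier)
    show ?case
    proof (cases "t \<in> S")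
      case True
      show ?thesis
        by (subst f, rule add) (use True g insert fin in \<open>auto simp: free_module_carrier\<close>)
    next
      case False
      then have "f = g" using insert.prems by (auto simp: g_def free_module_carrier)
      then show ?thesis using insert.IH g fin by simp
    qed
  qed
  then show ?thesis using f by (auto simp: free_module_carrier)
qed

definition free_lift ::
  "('a, 'x) ring_scheme \<Rightarrow> ('a, 'm, 'y) module_scheme \<Rightarrow> ('s \<Rightarrow> 'm) \<Rightarrow> ('s \<Rightarrow> 'a) \<Rightarrow> 'm" where
  "free_lift A M y f = (\<Oplus>\<^bsub>M\<^esub>s\<in>{s. f s \<noteq> \<zero>\<^bsub>A\<^esub>}. f s \<odot>\<^bsub>M\<^esub> y s)"

context left_module
begin

text \<open>The supports of two arguments differ, but their sums can be compared only over a common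
  index set; hence any finite set between the support and \<open>S\<close> is allowed.\<close>

lemma free_lift_superset:
  assumes "f \<in> carrier (free_module A S)" "y \<in> S \<rightarrow> carrier M"
    and "finite T" "{s. f s \<noteq> \<zero>\<^bsub>A\<^esub>} \<subseteq> T" "T \<subseteq> S"
  shows "free_lift A M y f = (\<Oplus>\<^bsub>M\<^esub>s\<in>T. f s \<odot>\<^bsub>M\<^esub> y s)"
  unfolding free_lift_def
proof (rule M.add.finprod_mono_neutral_cong_left)
  show "f i \<odot>\<^bsub>M\<^esub> y i = \<zero>\<^bsub>M\<^esub>" if "i \<in> T - {s. f s \<noteq> \<zero>\<^bsub>A\<^esub>}" for i
    using that assms(2,5) lsmult_l_null by auto
  show "(\<lambda>s. f s \<odot>\<^bsub>M\<^esub> y s) \<in> T \<rightarrow> carrier M"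
    using assms by (fastforce simp: free_module_carrier intro: lsmult_closed)
qed (use assms in auto)

lemma free_lift_hom:
  assumes y: "y \<in> S \<rightarrow> carrier M"
  shows "free_lift A M y \<in> lin_hom A (free_module A S) M"
proof (rule lin_homI)
  note F = free_module_carrier
  have yc: "f s \<odot>\<^bsub>M\<^esub> y s \<in> carrier M" if "f \<in> carrier (free_module A S)" "s \<in> S" for f s
    using that y by (auto simp: F intro: lsmult_closed)
  have supp: "{s. f s \<noteq> \<zero>\<^bsub>A\<^esub>} \<subseteq> S" if "f \<in> carrier (free_module A S)" for f
    using that by (auto simp: F)
  interpret FM: left_module A "free_module A S" by (rule left_module_free[OF R.ring_axioms])
  show "free_lift A M y f \<in> carrier M" if "f \<in> carrier (free_module A S)" for f
    unfolding free_lift_def using yc[OF that] supp[OF that] by (intro M.finsum_closed) auto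
  show "free_lift A M y (f \<oplus>\<^bsub>free_module A S\<^esub> g) = free_lift A M y f \<oplus>\<^bsub>M\<^esub> free_lift A M y g"
    if f: "f \<in> carrier (free_module A S)" and g: "g \<in> carrier (free_module A S)" for f g
  proof -
    define T where "T = {s. f s \<noteq> \<zero>\<^bsub>A\<^esub>} \<union> {s. g s \<noteq> \<zero>\<^bsub>A\<^esub>}"
    have "finite T" using f g by (simp add: T_def F)
    moreover have "T \<subseteq> S" using supp[OF f] supp[OF g] by (simp add: T_def)
    moreover have "{s. (f \<oplus>\<^bsub>free_module A S\<^esub> g) s \<noteq> \<zero>\<^bsub>A\<^esub>} \<subseteq> T" by (auto simp: T_def)
    ultimately have T: "finite T" "T \<subseteq> S" "{s. f s \<noteq> \<zero>\<^bsub>A\<^esub>} \<subseteq> T" "{s. g s \<noteq> \<zero>\<^bsub>A\<^esub>} \<subseteq> T"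
      "{s. (f \<oplus>\<^bsub>free_module A S\<^esub> g) s \<noteq> \<zero>\<^bsub>A\<^esub>} \<subseteq> T"
      by (auto simp: T_def)
    have fg: "f \<oplus>\<^bsub>free_module A S\<^esub> g \<in> carrier (free_module A S)" using f g by (rule FM.M.a_closed)
    have "free_lift A M y (f \<oplus>\<^bsub>free_module A S\<^esub> g) =
        (\<Oplus>\<^bsub>M\<^esub>s\<in>T. f s \<odot>\<^bsub>M\<^esub> y s \<oplus>\<^bsub>M\<^esub> g s \<odot>\<^bsub>M\<^esub> y s)"
      unfolding free_lift_superset[OF fg y T(1,5,2)]
      using T(2) y f g yc by (intro M.add.finprod_cong') (auto simp: F intro!: lsmult_l_distr)
    also have "\<dots> = free_lift A M y f \<oplus>\<^bsub>M\<^esub> free_lift A M y g"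
      unfolding free_lift_superset[OF f y T(1,3,2)] free_lift_superset[OF g y T(1,4,2)]
      using T(2) yc f g by (intro M.add.finprod_multf) auto
    finally show ?thesis .
  qed
  show "free_lift A M y (a \<odot>\<^bsub>free_module A S\<^esub> f) = a \<odot>\<^bsub>M\<^esub> free_lift A M y f"
    if a: "a \<in> carrier A" and f: "f \<in> carrier (free_module A S)" for a f
  proof -
    define T where "T = {s. f s \<noteq> \<zero>\<^bsub>A\<^esub>}"
    have T: "finite T" "T \<subseteq> S" "{s. f s \<noteq> \<zero>\<^bsub>A\<^esub>} \<subseteq> T"
      "{s. (a \<odot>\<^bsub>free_module A S\<^esub> f) s \<noteq> \<zero>\<^bsub>A\<^esub>} \<subseteq> T"
      using a f by (auto simp: T_def F)
    have af: "a \<odot>\<^bsub>free_module A S\<^esub> f \<in> carrier (free_module A S)" using a f by (rule FM.lsmult_closed)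
    have sum: "(\<Oplus>\<^bsub>M\<^esub>s\<in>U. (a \<otimes>\<^bsub>A\<^esub> f s) \<odot>\<^bsub>M\<^esub> y s) = a \<odot>\<^bsub>M\<^esub> (\<Oplus>\<^bsub>M\<^esub>s\<in>U. f s \<odot>\<^bsub>M\<^esub> y s)"
      if "finite U" "U \<subseteq> S" for U
      using that
    proof (induction U rule: finite_induct)
      case empty then show ?case using a by (simp add: lsmult_r_null)
    next
      case (insert u U)
      have "f s \<in> carrier A" for s using f by (simp add: F)
      moreover have "y s \<in> carrier M" if "s \<in> S" for s using that y by auto
      moreover have "(\<lambda>s. f s \<odot>\<^bsub>M\<^esub> y s) \<in> U \<rightarrow> carrier M" using yc[OF f] insert by auto
      moreover have "(\<lambda>s. (a \<otimes>\<^bsub>A\<^esub> f s) \<odot>\<^bsub>M\<^esub> y s) \<in> U \<rightarrow> carrier M" using yc[OF af] insert by auto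
      ultimately show ?case using insert a
        by (simp add: M.finsum_insert lsmult_closed lsmult_r_distr lsmult_assoc)
    qed
    show ?thesis
      unfolding free_lift_superset[OF af y T(1,4,2)] free_lift_superset[OF f y T(1,3,2)]
      using sum[OF T(1,2)] by simp
  qed
qed

lemma free_lift_single:
  assumes "y \<in> S \<rightarrow> carrier M" "s \<in> S"
  shows "free_lift A M y (single A s) = y s"
proof -
  have "free_lift A M y (single A s) = (\<Oplus>\<^bsub>M\<^esub>t\<in>{s}. single A s t \<odot>\<^bsub>M\<^esub> y t)"
    by (rule free_lift_superset[OF single_closed assms(1)])
      (use assms in \<open>auto simp: single_def intro: R.ring_axioms\<close>)
  then show ?thesis using assms by (simp add: single_def lsmult_one Pi_iff)
qed

end

lemma lin_hom_free_eqI: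
  assumes "ring A" "left_module A N"
    and f: "f \<in> lin_hom A (free_module A S) N" and g: "g \<in> lin_hom A (free_module A S) N"
    and eq: "\<And>s. s \<in> S \<Longrightarrow> f (single A s) = g (single A s)"
    and x: "x \<in> carrier (free_module A S)"
  shows "f x = g x"
  using x assms(1)
proof (induction x rule: free_module_induct)
  case P0
  show ?case
    using lin_hom_zero[OF f left_module_abelian_group[OF left_module_free[OF assms(1)]] left_module_abelian_group[OF assms(2)]]
      lin_hom_zero[OF g left_module_abelian_group[OF left_module_free[OF assms(1)]] left_module_abelian_group[OF assms(2)]]
    by simp
next
  case (add a s h)
  interpret FM: left_module A "free_module A S" by (rule left_module_free[OF assms(1)])
  note s = single_closed[OF assms(1) add.hyps(2)]
  show ?case
    unfolding lin_homD(2)[OF f FM.lsmult_closed[OF add.hyps(1) s] add.hyps(3)]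
      lin_homD(2)[OF g FM.lsmult_closed[OF add.hyps(1) s] add.hyps(3)]
      lin_homD(3)[OF f add.hyps(1) s] lin_homD(3)[OF g add.hyps(1) s] eq[OF add.hyps(2)] add.IH ..
qed


section \<open>Comparison of resolutions\<close>

text \<open>Projectivity is replaced by lifting against a single map \<open>p\<close>, with a
  condition on images instead of surjectivity. The comparison of resolutions will also start from
  modules that lift only against certain maps.\<close>

definition lifts_through ::
  "('a, 'x) ring_scheme \<Rightarrow> ('a, 'p, 'y) module_scheme \<Rightarrow> ('a, 'm, 'u) module_scheme \<Rightarrow>
   ('a, 'n, 'v) module_scheme \<Rightarrow> ('m \<Rightarrow> 'n) \<Rightarrow> bool" where
  "lifts_through A P M N p \<longleftrightarrow> (\<forall>h\<in>lin_hom A P N. h ` carrier P \<subseteq> p ` carrier M \<longrightarrow>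
     (\<exists>h'\<in>lin_hom A P M. \<forall>x\<in>carrier P. p (h' x) = h x))"

text \<open>Preimages of the generators extend to the free module by its universal property. The
  lift is that extension after the inclusion \<open>i\<close>, since \<open>r\<close> after
  \<open>i\<close> is the identity.\<close>

lemma projective_lifts:
  assumes P: "projective A P" and M: "left_module A M" and N: "left_module A N"
    and p: "p \<in> lin_hom A M N"
  shows "lifts_through A P M N p"
  unfolding lifts_through_def
proof (intro ballI impI)
  fix h assume h: "h \<in> lin_hom A P N" and im: "h ` carrier P \<subseteq> p ` carrier M"
  interpret M: left_module A M by fact
  note R = M.R.ring_axioms
  obtain S i r where i: "i \<in> lin_hom A P (free_module A (S::'c set))"
    and r: "r \<in> lin_hom A (free_module A S) P" and ri: "\<forall>x\<in>carrier P. r (i x) = x"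
    using P unfolding projective_def by blast
  have "\<exists>m\<in>carrier M. p m = h (r (single A s))" if "s \<in> S" for s
    using im lin_homD(1)[OF r single_closed[OF R that]] by (metis imageE image_subset_iff)
  then obtain y where y: "\<And>s. s \<in> S \<Longrightarrow> y s \<in> carrier M \<and> p (y s) = h (r (single A s))" by metis
  then have yS: "y \<in> S \<rightarrow> carrier M" by auto
  define h' where "h' = free_lift A M y \<circ> i"
  have "h' \<in> lin_hom A P M" unfolding h'_def by (rule lin_hom_comp[OF i M.free_lift_hom[OF yS]])
  moreover have "p (h' x) = h x" if x: "x \<in> carrier P" for x
  proof -
    have "(p \<circ> free_lift A M y) (i x) = (h \<circ> r) (i x)"
      by (rule lin_hom_free_eqI[OF R N lin_hom_comp[OF M.free_lift_hom[OF yS] p] lin_hom_comp[OF r h]])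
        (use y M.free_lift_single[OF yS] lin_homD(1)[OF i x] in auto)
    then show ?thesis using ri x by (simp add: h'_def)
  qed
  ultimately show "\<exists>h'\<in>lin_hom A P M. \<forall>x\<in>carrier P. p (h' x) = h x" by blast
qed

text \<open>Projectivity is left out: a quotient complex, or the restriction of a resolution along a
  ring map, can be exact without being projective over the ring at hand.\<close>

definition resolution ::
  "('a, 'x) ring_scheme \<Rightarrow> ('a, 'm, 'y) module_scheme \<Rightarrow>
   (nat \<Rightarrow> ('a, 'p, 'z) module_scheme) \<Rightarrow> (nat \<Rightarrow> 'p \<Rightarrow> 'p) \<Rightarrow> ('p \<Rightarrow> 'm) \<Rightarrow> bool" where
  "resolution A M P d e \<longleftrightarrow>
     (\<forall>i. left_module A (P i)) \<and>
     (\<forall>i. d i \<in> lin_hom A (P (Suc i)) (P i)) \<and>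
     e \<in> lin_hom A (P 0) M \<and>
     e ` carrier (P 0) = carrier M \<and>
     d 0 ` carrier (P (Suc 0)) = {x \<in> carrier (P 0). e x = \<zero>\<^bsub>M\<^esub>} \<and>
     (\<forall>i. d (Suc i) ` carrier (P (Suc (Suc i))) = {x \<in> carrier (P (Suc i)). d i x = \<zero>\<^bsub>P i\<^esub>})"

lemma projective_resolution_iff:
  "projective_resolution A M P d e \<longleftrightarrow> (\<forall>i. projective A (P i)) \<and> resolution A M P d e"
  by (auto simp: projective_resolution_def resolution_def projective_def)

lemma resolutionD:
  assumes "resolution A M P d e"
  shows "left_module A (P i)" "d i \<in> lin_hom A (P (Suc i)) (P i)" "e \<in> lin_hom A (P 0) M"
    "e ` carrier (P 0) = carrier M"
    "x \<in> carrier (P (Suc 0)) \<Longrightarrow> e (d 0 x) = \<zero>\<^bsub>M\<^esub>"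
    "x \<in> carrier (P (Suc (Suc i))) \<Longrightarrow> d i (d (Suc i) x) = \<zero>\<^bsub>P i\<^esub>"
    "\<lbrakk>x \<in> carrier (P 0); e x = \<zero>\<^bsub>M\<^esub>\<rbrakk> \<Longrightarrow> x \<in> d 0 ` carrier (P (Suc 0))"
    "\<lbrakk>x \<in> carrier (P (Suc i)); d i x = \<zero>\<^bsub>P i\<^esub>\<rbrakk> \<Longrightarrow> x \<in> d (Suc i) ` carrier (P (Suc (Suc i)))"
  using assms unfolding resolution_def by blast+

lemma chain_map_exists:
  assumes P: "resolution A M P dP eP" and Q: "resolution A M Q dQ eQ"
    and lift0: "lifts_through A (P 0) (Q 0) M eQ"
    and lift: "\<And>i. lifts_through A (P (Suc i)) (Q (Suc i)) (Q i) (dQ i)"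
  obtains f where "\<And>i. f i \<in> lin_hom A (P i) (Q i)"
    and "\<And>x. x \<in> carrier (P 0) \<Longrightarrow> eQ (f 0 x) = eP x"
    and "\<And>i x. x \<in> carrier (P (Suc i)) \<Longrightarrow> dQ i (f (Suc i) x) = f i (dP i x)"
proof -
  note P = resolutionD[OF P] and Q = resolutionD[OF Q]
  \<comment> \<open>The invariant of the recursion: \<open>f\<close> respects the augmentations in
    degree 0 and carries cycles to cycles above. That is what makes the image of a boundary a
    boundary, so that the next lift exists.\<close>
  let ?ok = "\<lambda>n f. f \<in> lin_hom A (P n) (Q n) \<and> (case n of
      0 \<Rightarrow> \<forall>x\<in>carrier (P 0). eQ (f x) = eP x
    | Suc m \<Rightarrow> \<forall>x\<in>carrier (P n). dP m x = \<zero>\<^bsub>P m\<^esub> \<longrightarrow> dQ m (f x) = \<zero>\<^bsub>Q m\<^esub>)"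
  have "\<exists>f. \<forall>n. ?ok n (f n) \<and> (\<forall>x\<in>carrier (P (Suc n)). dQ n (f (Suc n) x) = f n (dP n x))"
  proof (rule dependent_nat_choice)
    have "eP ` carrier (P 0) \<subseteq> eQ ` carrier (Q 0)" using P(4) Q(4) by simp
    then show "\<exists>f. ?ok 0 f" using lift0 P(3) unfolding lifts_through_def by (auto simp: Bex_def)
  next
    fix f n assume f: "?ok n f"
    have fd: "f \<circ> dP n \<in> lin_hom A (P (Suc n)) (Q n)" using f P(2) by (blast intro: lin_hom_comp)
    have "f (dP n x) \<in> dQ n ` carrier (Q (Suc n))" if x: "x \<in> carrier (P (Suc n))" for x
    proof -
      have dx: "dP n x \<in> carrier (P n)" using lin_homD(1)[OF P(2) x] .
      have fdx: "f (dP n x) \<in> carrier (Q n)" using lin_homD(1)[OF fd x] by simp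
      show ?thesis
      proof (cases n)
        case 0
        then show ?thesis using f dx fdx P(5) x Q(7) by simp
      next
        case (Suc m)
        then show ?thesis using f dx fdx P(6) x Q(8) by simp
      qed
    qed
    then have "(f \<circ> dP n) ` carrier (P (Suc n)) \<subseteq> dQ n ` carrier (Q (Suc n))" by auto
    then obtain g where g: "g \<in> lin_hom A (P (Suc n)) (Q (Suc n))"
      "\<And>x. x \<in> carrier (P (Suc n)) \<Longrightarrow> dQ n (g x) = f (dP n x)"
      using lift[of n] fd unfolding lifts_through_def by fastforce
    moreover have "f \<zero>\<^bsub>P n\<^esub> = \<zero>\<^bsub>Q n\<^esub>"
      using f lin_hom_zero[of f] P(1) Q(1) by (blast intro: left_module_abelian_group)
    ultimately show "\<exists>g. ?ok (Suc n) g \<and> (\<forall>x\<in>carrier (P (Suc n)). dQ n (g x) = f (dP n x))"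
      by auto
  qed
  then obtain f where f: "\<forall>n. ?ok n (f n) \<and> (\<forall>x\<in>carrier (P (Suc n)). dQ n (f (Suc n) x) = f n (dP n x))" ..
  show thesis
    by (rule that[of f]) (use f spec[OF f, of 0] in auto)
qed

lemma null_homotopy_exists:
  assumes P: "resolution A M P dP eP" and Q: "resolution A N Q dQ eQ"
    and lift: "\<And>i. lifts_through A (P i) (Q (Suc i)) (Q i) (dQ i)"
    and h: "\<And>i. h i \<in> lin_hom A (P i) (Q i)"
    and h0: "\<And>x. x \<in> carrier (P 0) \<Longrightarrow> eQ (h 0 x) = \<zero>\<^bsub>N\<^esub>"
    and hd: "\<And>i x. x \<in> carrier (P (Suc i)) \<Longrightarrow> dQ i (h (Suc i) x) = h i (dP i x)"
  obtains s where "\<And>i. s i \<in> lin_hom A (P i) (Q (Suc i))"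
    and "\<And>x. x \<in> carrier (P 0) \<Longrightarrow> h 0 x = dQ 0 (s 0 x)"
    and "\<And>i x. x \<in> carrier (P (Suc i)) \<Longrightarrow>
      h (Suc i) x = dQ (Suc i) (s (Suc i) x) \<oplus>\<^bsub>Q (Suc i)\<^esub> s i (dP i x)"
proof -
  note P = resolutionD[OF P] and Q = resolutionD[OF Q]
  note ab = left_module_abelian_group[OF Q(1)] left_module_abelian_group[OF P(1)]
  \<comment> \<open>The invariant of the recursion: the homotopy equation holds on cycles, where its
    term \<open>s (dP x)\<close> is absent. It makes \<open>h - s dP\<close> take values in cycles
    one degree higher, hence in boundaries.\<close>
  let ?ok = "\<lambda>n s. s \<in> lin_hom A (P n) (Q (Suc n)) \<and> (\<forall>x\<in>carrier (P n).
      (case n of 0 \<Rightarrow> True | Suc m \<Rightarrow> dP m x = \<zero>\<^bsub>P m\<^esub>) \<longrightarrow> dQ n (s x) = h n x)"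
  let ?next = "\<lambda>n s t. \<forall>x\<in>carrier (P (Suc n)).
      dQ (Suc n) (t x) = h (Suc n) x \<ominus>\<^bsub>Q (Suc n)\<^esub> s (dP n x)"
  have "\<exists>s. \<forall>n. ?ok n (s n) \<and> ?next n (s n) (s (Suc n))"
  proof (rule dependent_nat_choice)
    have "h 0 ` carrier (P 0) \<subseteq> dQ 0 ` carrier (Q (Suc 0))"
      using Q(7)[OF lin_homD(1)[OF h] h0] by auto
    then show "\<exists>s. ?ok 0 s" using lift[of 0] h[of 0] unfolding lifts_through_def by (auto simp: Bex_def)
  next
    fix s n assume s: "?ok n s"
    let ?k = "\<lambda>x. h (Suc n) x \<ominus>\<^bsub>Q (Suc n)\<^esub> (s \<circ> dP n) x"
    have sd: "s \<circ> dP n \<in> lin_hom A (P (Suc n)) (Q (Suc n))" using s P(2) by (blast intro: lin_hom_comp)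
    have k: "?k \<in> lin_hom A (P (Suc n)) (Q (Suc n))"
      by (rule lin_hom_sub[OF h sd P(1) Q(1)])
    have "?k x \<in> dQ (Suc n) ` carrier (Q (Suc (Suc n)))" if x: "x \<in> carrier (P (Suc n))" for x
    proof (rule Q(8))
      show "?k x \<in> carrier (Q (Suc n))" by (rule lin_homD(1)[OF k x])
      have dx: "dP n x \<in> carrier (P n)" using lin_homD(1)[OF P(2) x] .
      have "dQ n (s (dP n x)) = h n (dP n x)"
        using s dx P(6) x by (cases n) auto
      then have "dQ n (?k x) = h n (dP n x) \<ominus>\<^bsub>Q n\<^esub> h n (dP n x)"
        using lin_hom_diff[OF Q(2) ab(1) ab(1) lin_homD(1)[OF h x] lin_homD(1)[OF sd x]] hd[OF x] by simp
      then show "dQ n (?k x) = \<zero>\<^bsub>Q n\<^esub>"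
        using abelian_group.minus_eq_zero_iff[OF ab(1)] lin_homD(1)[OF h dx] by simp
    qed
    then have "?k ` carrier (P (Suc n)) \<subseteq> dQ (Suc n) ` carrier (Q (Suc (Suc n)))" by blast
    then obtain t where t: "t \<in> lin_hom A (P (Suc n)) (Q (Suc (Suc n)))"
      "\<And>x. x \<in> carrier (P (Suc n)) \<Longrightarrow> dQ (Suc n) (t x) = ?k x"
      using lift[of "Suc n"] k unfolding lifts_through_def by blast
    have "s \<zero>\<^bsub>P n\<^esub> = \<zero>\<^bsub>Q (Suc n)\<^esub>" using s lin_hom_zero[OF _ ab(2) ab(1)] by blast
    moreover have "y \<ominus>\<^bsub>Q (Suc n)\<^esub> \<zero>\<^bsub>Q (Suc n)\<^esub> = y" if "y \<in> carrier (Q (Suc n))" for y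
    proof -
      interpret Q: abelian_group "Q (Suc n)" by (rule ab)
      show ?thesis using that Q.minus_equality[of "\<zero>\<^bsub>Q (Suc n)\<^esub>" "\<zero>\<^bsub>Q (Suc n)\<^esub>"] by (simp add: a_minus_def)
    qed
    ultimately have "dQ (Suc n) (t x) = h (Suc n) x" if "x \<in> carrier (P (Suc n))" "dP n x = \<zero>\<^bsub>P n\<^esub>" for x
      using t(2)[OF that(1)] that(2) lin_homD(1)[OF h that(1)]
      by simp
    then show "\<exists>t. ?ok (Suc n) t \<and> ?next n s t" using t by auto
  qed
  then obtain s where s: "\<forall>n. ?ok n (s n) \<and> ?next n (s n) (s (Suc n))" ..
  show thesis
  proof (rule that[of s])
    show "s i \<in> lin_hom A (P i) (Q (Suc i))" for i using s by blast
    show "h 0 x = dQ 0 (s 0 x)" if "x \<in> carrier (P 0)" for x using spec[OF s, of 0] that by simp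
    show "h (Suc i) x = dQ (Suc i) (s (Suc i) x) \<oplus>\<^bsub>Q (Suc i)\<^esub> s i (dP i x)"
      if x: "x \<in> carrier (P (Suc i))" for i x
    proof -
      interpret Q: abelian_group "Q (Suc i)" by (rule ab)
      have "s i (dP i x) \<in> carrier (Q (Suc i))" using lin_homD(1)[OF _ lin_homD(1)[OF P(2) x], of "s i"] s by blast
      then show ?thesis using s x lin_homD(1)[OF h x] by (simp add: a_minus_def Q.a_assoc Q.l_neg)
    qed
  qed
qed

section \<open>Submodules spanned by products\<close>

text \<open>The additive subgroup \<open>J M\<close> for an arbitrary set \<open>J\<close> of
  scalars; signs are absorbed by \<open>x\<close>. It is a submodule if \<open>J\<close> is stable
  under multiplication from the left, which the right ideals used later need not be.\<close>

inductive_set smult_span :: "('a, 'm, 'y) module_scheme \<Rightarrow> 'a set \<Rightarrow> 'm set" for M J where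
  zero: "\<zero>\<^bsub>M\<^esub> \<in> smult_span M J"
| add: "\<lbrakk>a \<in> J; x \<in> carrier M; u \<in> smult_span M J\<rbrakk> \<Longrightarrow> a \<odot>\<^bsub>M\<^esub> x \<oplus>\<^bsub>M\<^esub> u \<in> smult_span M J"

lemma smult_span_least:
  assumes "u \<in> smult_span M J" "\<zero>\<^bsub>M\<^esub> \<in> H"
    and "\<And>x y. \<lbrakk>x \<in> H; y \<in> H\<rbrakk> \<Longrightarrow> x \<oplus>\<^bsub>M\<^esub> y \<in> H"
    and "\<And>a x. \<lbrakk>a \<in> J; x \<in> carrier M\<rbrakk> \<Longrightarrow> a \<odot>\<^bsub>M\<^esub> x \<in> H"
  shows "u \<in> H"
  using assms(1) by induction (auto intro: assms)

lemma smult_span_mono: "J \<subseteq> J' \<Longrightarrow> smult_span M J \<subseteq> smult_span M J'"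
proof
  fix u assume "J \<subseteq> J'" "u \<in> smult_span M J"
  from this(2,1) show "u \<in> smult_span M J'" by induction (auto intro: smult_span.intros)
qed

context left_module
begin

lemma smult_span_closed:
  assumes "J \<subseteq> carrier A" "u \<in> smult_span M J" shows "u \<in> carrier M"
  using assms(2) by induction (use assms(1) in \<open>auto intro!: lsmult_closed\<close>)

lemma smult_span_base:
  assumes "J \<subseteq> carrier A" "a \<in> J" "x \<in> carrier M" shows "a \<odot>\<^bsub>M\<^esub> x \<in> smult_span M J"
  using smult_span.add[OF assms(2,3) smult_span.zero] lsmult_closed[of a x] assms by auto

lemma smult_span_add:
  assumes J: "J \<subseteq> carrier A" and "u \<in> smult_span M J" "v \<in> smult_span M J"
  shows "u \<oplus>\<^bsub>M\<^esub> v \<in> smult_span M J"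
  using assms(2)
proof induction
  case zero then show ?case using assms smult_span_closed[OF J] by simp
next
  case (add a x u)
  then have "a \<odot>\<^bsub>M\<^esub> x \<oplus>\<^bsub>M\<^esub> (u \<oplus>\<^bsub>M\<^esub> v) \<in> smult_span M J" by (intro smult_span.add)
  then show ?case
    using add J smult_span_closed[OF J] assms(3) by (simp add: M.a_assoc lsmult_closed subsetD)
qed

lemma smult_span_smult:
  assumes J: "J \<subseteq> carrier A" and b: "b \<in> carrier A" and bJ: "\<And>a. a \<in> J \<Longrightarrow> b \<otimes>\<^bsub>A\<^esub> a \<in> J'"
    and u: "u \<in> smult_span M J"
  shows "b \<odot>\<^bsub>M\<^esub> u \<in> smult_span M J'"
  using u
proof induction
  case zero then show ?case using b by (simp add: lsmult_r_null smult_span.zero)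
next
  case (add a x u)
  then have "b \<odot>\<^bsub>M\<^esub> (a \<odot>\<^bsub>M\<^esub> x \<oplus>\<^bsub>M\<^esub> u) = (b \<otimes>\<^bsub>A\<^esub> a) \<odot>\<^bsub>M\<^esub> x \<oplus>\<^bsub>M\<^esub> b \<odot>\<^bsub>M\<^esub> u"
    using J b smult_span_closed[OF J] by (simp add: lsmult_r_distr lsmult_assoc lsmult_closed subsetD)
  then show ?case using add bJ by (simp add: smult_span.add)
qed

lemma smult_span_minus:
  assumes J: "J \<subseteq> carrier A" and u: "u \<in> smult_span M J"
  shows "\<ominus>\<^bsub>M\<^esub> u \<in> smult_span M J"
  using u
proof induction
  case zero
  have "\<ominus>\<^bsub>M\<^esub> \<zero>\<^bsub>M\<^esub> = \<zero>\<^bsub>M\<^esub>" by (rule M.minus_equality) auto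
  then show ?case by (simp only: smult_span.zero)
next
  case (add a x u)
  then have "\<ominus>\<^bsub>M\<^esub> (a \<odot>\<^bsub>M\<^esub> x \<oplus>\<^bsub>M\<^esub> u) = a \<odot>\<^bsub>M\<^esub> (\<ominus>\<^bsub>M\<^esub> x) \<oplus>\<^bsub>M\<^esub> \<ominus>\<^bsub>M\<^esub> u"
    using J smult_span_closed[OF J] by (simp add: M.minus_add lsmult_r_minus lsmult_closed subsetD)
  then show ?case using add by (simp add: smult_span.add)
qed

lemma smult_span_submodule:
  assumes "J \<subseteq> carrier A" "\<And>a b. \<lbrakk>a \<in> J; b \<in> carrier A\<rbrakk> \<Longrightarrow> b \<otimes>\<^bsub>A\<^esub> a \<in> J"
  shows "submodule (smult_span M J) A M"
  using assms smult_span_closed smult_span.zero smult_span_add smult_span_smult[OF assms(1), of _ J]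
  by (intro submoduleI) auto

end

lemma smult_span_hom:
  assumes M: "left_module A M" "left_module A N" and h: "h \<in> lin_hom A M N"
    and J: "J \<subseteq> carrier A" and u: "u \<in> smult_span M J"
  shows "h u \<in> smult_span N J"
  using u
proof induction
  case zero
  then show ?case
    using lin_hom_zero[OF h left_module_abelian_group[OF M(1)] left_module_abelian_group[OF M(2)]]
    by (simp add: smult_span.zero)
next
  case (add a x u)
  then have "a \<in> carrier A" "u \<in> carrier M" "a \<odot>\<^bsub>M\<^esub> x \<in> carrier M"
    using J left_module.smult_span_closed[OF M(1) J] left_module.lsmult_closed[OF M(1)] by auto
  then show ?case
    using add lin_homD[OF h] by (simp add: smult_span.add)
qed


section \<open>Tensor products with the trivial module of an augmented algebra\<close>

text \<open>\<open>\<phi>\<close> is any function, so that the record can also be formed along a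
  set-theoretic section of a ring surjection. On modules killed by the kernel this inverts
  restriction along the surjection.\<close>

definition restrict_scalars :: "('b \<Rightarrow> 'a) \<Rightarrow> ('a, 'm, 'y) module_scheme \<Rightarrow> ('b, 'm) module" where
  "restrict_scalars \<phi> M = \<lparr>carrier = carrier M, monoid.mult = undefined, monoid.one = undefined,
     ring.zero = \<zero>\<^bsub>M\<^esub>, ring.add = ring.add M, module.smult = (\<lambda>b x. \<phi> b \<odot>\<^bsub>M\<^esub> x)\<rparr>"

lemma restrict_scalars_simps [simp]:
  "carrier (restrict_scalars \<phi> M) = carrier M"
  "\<zero>\<^bsub>restrict_scalars \<phi> M\<^esub> = \<zero>\<^bsub>M\<^esub>"
  "x \<oplus>\<^bsub>restrict_scalars \<phi> M\<^esub> y = x \<oplus>\<^bsub>M\<^esub> y"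
  "b \<odot>\<^bsub>restrict_scalars \<phi> M\<^esub> x = \<phi> b \<odot>\<^bsub>M\<^esub> x"
  by (simp_all add: restrict_scalars_def)

lemma restrict_scalars_minus [simp]:
  "\<ominus>\<^bsub>restrict_scalars \<phi> M\<^esub> x = \<ominus>\<^bsub>M\<^esub> x" "x \<ominus>\<^bsub>restrict_scalars \<phi> M\<^esub> y = x \<ominus>\<^bsub>M\<^esub> y"
  by (simp_all add: a_minus_def a_inv_def m_inv_def)

lemma left_module_restrict_scalars:
  assumes "left_module A M" "ring B" "\<phi> \<in> ring_hom B A"
  shows "left_module B (restrict_scalars \<phi> M)"
proof -
  interpret left_module A M by fact
  interpret B: ring B by fact
  note phi = ring_hom_closed[OF assms(3)] ring_hom_add[OF assms(3)] ring_hom_mult[OF assms(3)] ring_hom_one[OF assms(3)]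
  show ?thesis
    by (intro left_module.intro left_module_axioms.intro abelian_groupI assms)
      (auto simp: phi M.a_ac lsmult_closed lsmult_l_distr lsmult_r_distr lsmult_assoc lsmult_one
        intro: bexI[OF _ M.a_inv_closed] M.l_neg)
qed

lemma lin_hom_restrict_scalars:
  assumes "h \<in> lin_hom A M N" "\<phi> \<in> carrier B \<rightarrow> carrier A"
  shows "h \<in> lin_hom B (restrict_scalars \<phi> M) (restrict_scalars \<phi> N)"
  using lin_homD[OF assms(1)] funcset_mem[OF assms(2)] by (intro lin_homI) auto

text \<open>Making the augmentation a parameter gives the trivial modules of both algebras one
  common form.\<close>

definition aug_module :: "('k, 'x) ring_scheme \<Rightarrow> ('a \<Rightarrow> 'k) \<Rightarrow> ('a, 'k) module" where
  "aug_module k \<epsilon> = \<lparr>carrier = carrier k, monoid.mult = undefined, monoid.one = undefined,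
     ring.zero = \<zero>\<^bsub>k\<^esub>, ring.add = ring.add k, module.smult = (\<lambda>a r. \<epsilon> a \<otimes>\<^bsub>k\<^esub> r)\<rparr>"

lemma aug_module_simps [simp]:
  "carrier (aug_module k \<epsilon>) = carrier k"
  "\<zero>\<^bsub>aug_module k \<epsilon>\<^esub> = \<zero>\<^bsub>k\<^esub>"
  "x \<oplus>\<^bsub>aug_module k \<epsilon>\<^esub> y = x \<oplus>\<^bsub>k\<^esub> y"
  "a \<odot>\<^bsub>aug_module k \<epsilon>\<^esub> x = \<epsilon> a \<otimes>\<^bsub>k\<^esub> x"
  by (simp_all add: aug_module_def)

lemma finsum_free_apply:
  assumes "ring A" "finite I" "\<And>i. i \<in> I \<Longrightarrow> F i \<in> carrier (free_module A S)"
  shows "(\<Oplus>\<^bsub>free_module A S\<^esub>i\<in>I. F i) t = (\<Oplus>\<^bsub>A\<^esub>i\<in>I. F i t)"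
  using assms(2,3)
proof (induction I rule: finite_induct)
  interpret A: ring A by fact
  interpret F: left_module A "free_module A S" by (rule left_module_free[OF assms(1)])
  {
    case empty show ?case by simp
  next
    case (insert i I)
    have "(\<lambda>j. F j t) \<in> I \<rightarrow> carrier A" "F i t \<in> carrier A"
      using insert.prems by (auto simp: free_module_carrier)
    moreover have "F \<in> I \<rightarrow> carrier (free_module A S)" "F i \<in> carrier (free_module A S)"
      using insert.prems by auto
    ultimately show ?case
      using insert by (simp add: F.M.finsum_insert A.finsum_insert)
  }
qed

text \<open>Linearity of \<open>pushforward\<close>, and its value on generators, then come from the
  universal property.\<close>

lemma pushforward_eq_free_lift:
  assumes A: "ring A" and u: "u \<in> S \<rightarrow> S'" and f: "f \<in> carrier (free_module A S)"
  shows "pushforward A u f = free_lift A (free_module A S') (\<lambda>s. single A (u s)) f"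
proof
  fix t
  interpret ring A by fact
  interpret F': left_module A "free_module A S'" by (rule left_module_free[OF A])
  have f': "f s \<in> carrier A" for s using f by (simp add: free_module_carrier)
  have fin: "finite {s. f s \<noteq> \<zero>\<^bsub>A\<^esub>}" "{s. f s \<noteq> \<zero>\<^bsub>A\<^esub>} \<subseteq> S" using f by (auto simp: free_module_carrier)
  have "free_lift A (free_module A S') (\<lambda>s. single A (u s)) f t =
      (\<Oplus>\<^bsub>A\<^esub>s\<in>{s. f s \<noteq> \<zero>\<^bsub>A\<^esub>}. (f s \<odot>\<^bsub>free_module A S'\<^esub> single A (u s)) t)"
    unfolding free_lift_def
    by (rule finsum_free_apply[OF A fin(1)], rule F'.lsmult_closed[OF f'], rule single_closed[OF A])
      (use fin(2) u in auto)
  also have "\<dots> = (\<Oplus>\<^bsub>A\<^esub>s\<in>{s. f s \<noteq> \<zero>\<^bsub>A\<^esub> \<and> u s = t}. f s)"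
    by (rule add.finprod_mono_neutral_cong_right) (use fin f' in \<open>auto simp: single_def\<close>)
  finally show "pushforward A u f t = free_lift A (free_module A S') (\<lambda>s. single A (u s)) f t"
    by (simp add: pushforward_def)
qed

lemma submodule_span_submodule:
  assumes M: "left_module A M" and Y: "Y \<subseteq> carrier M"
  shows "submodule (submodule_span A M Y) A M"
proof -
  interpret left_module A M by fact
  have "submodule (carrier M) A M" by (rule submoduleI) (auto simp: lsmult_closed)
  then have "submodule_span A M Y \<subseteq> carrier M" using Y by (auto simp: submodule_span_def)
  then show ?thesis
    by (rule submoduleI) (auto simp: submodule_span_def submoduleD)
qed

lemma submodule_vimage:
  assumes M: "left_module A M" and N: "left_module A N" and h: "h \<in> lin_hom A M N"
    and H: "submodule H A N"
  shows "submodule {x \<in> carrier M. h x \<in> H} A M"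
proof -
  interpret M: left_module A M by fact
  show ?thesis
    using lin_hom_zero[OF h left_module_abelian_group[OF M] left_module_abelian_group[OF N]]
      submoduleD[OF H] lin_homD[OF h]
    by (intro M.submoduleI) (auto simp: M.lsmult_closed)
qed

lemma submodule_image:
  assumes M: "left_module A M" and N: "left_module A N" and h: "h \<in> lin_hom A M N"
    and H: "submodule H A M"
  shows "submodule (h ` H) A N"
proof -
  interpret N: left_module A N by fact
  have H': "x \<in> carrier M" if "x \<in> H" for x using submoduleD(1)[OF H] that by auto
  show ?thesis
  proof (rule N.submoduleI)
    show "h ` H \<subseteq> carrier N" using H' lin_homD(1)[OF h] by auto
    show "\<zero>\<^bsub>N\<^esub> \<in> h ` H"
      using lin_hom_zero[OF h left_module_abelian_group[OF M] left_module_abelian_group[OF N]]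
        submoduleD(2)[OF H] by (metis imageI)
    show "x \<oplus>\<^bsub>N\<^esub> y \<in> h ` H" if "x \<in> h ` H" "y \<in> h ` H" for x y
      using that lin_homD(2)[OF h, symmetric] submoduleD(3)[OF H] H' by auto
    show "a \<odot>\<^bsub>N\<^esub> x \<in> h ` H" if "a \<in> carrier A" "x \<in> h ` H" for a x
      using that lin_homD(3)[OF h, symmetric] submoduleD(4)[OF H] H' by auto
  qed
qed

text \<open>The part of an algebra that matters for tensoring with the trivial module: scalars enter
  through the unit, elements of \<open>A\<close> act on \<open>k\<close> through \<epsilon>, and
  \<epsilon> splits the unit.\<close>

locale augmented_algebra = k?: cring k + A?: ring A
  for k :: "('k, 'x) ring_scheme" and A :: "('k, 'a, 'y) module_scheme" +
  fixes \<epsilon> :: "'a \<Rightarrow> 'k"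
  assumes unit_hom: "(\<lambda>r. r \<odot>\<^bsub>A\<^esub> \<one>\<^bsub>A\<^esub>) \<in> ring_hom k A"
    and aug_hom: "\<epsilon> \<in> ring_hom A k"
    and aug_unit: "r \<in> carrier k \<Longrightarrow> \<epsilon> (r \<odot>\<^bsub>A\<^esub> \<one>\<^bsub>A\<^esub>) = r"
begin

definition unit :: "'k \<Rightarrow> 'a" where "unit r = r \<odot>\<^bsub>A\<^esub> \<one>\<^bsub>A\<^esub>"

definition aug_ideal :: "'a set" where "aug_ideal = {a \<in> carrier A. \<epsilon> a = \<zero>\<^bsub>k\<^esub>}"

definition aug_span :: "('a, 'm, 'z) module_scheme \<Rightarrow> 'm set" where
  "aug_span N = smult_span N aug_ideal"

abbreviation scalars :: "('a, 'm, 'z) module_scheme \<Rightarrow> ('k, 'm) module" where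
  "scalars N \<equiv> restrict_scalars unit N"

lemma unit_ring_hom: "unit \<in> ring_hom k A"
  using unit_hom by (simp add: unit_def[abs_def])

lemmas unit_simps =
  ring_hom_closed[OF unit_ring_hom] ring_hom_add[OF unit_ring_hom] ring_hom_mult[OF unit_ring_hom]
  ring_hom_one[OF unit_ring_hom]

lemmas aug_simps =
  ring_hom_closed[OF aug_hom] ring_hom_add[OF aug_hom] ring_hom_mult[OF aug_hom] ring_hom_one[OF aug_hom]

lemma aug_unit': "r \<in> carrier k \<Longrightarrow> \<epsilon> (unit r) = r"
  by (simp add: unit_def aug_unit)

lemma aug_diff:
  assumes "a \<in> carrier A" "b \<in> carrier A" shows "\<epsilon> (a \<ominus>\<^bsub>A\<^esub> b) = \<epsilon> a \<ominus>\<^bsub>k\<^esub> \<epsilon> b"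
proof -
  have "\<epsilon> (\<ominus>\<^bsub>A\<^esub> b) \<oplus>\<^bsub>k\<^esub> \<epsilon> b = \<epsilon> \<zero>\<^bsub>A\<^esub>"
    using assms aug_simps(2)[of "\<ominus>\<^bsub>A\<^esub> b" b] by (simp add: A.l_neg)
  moreover have "\<epsilon> \<zero>\<^bsub>A\<^esub> = \<zero>\<^bsub>k\<^esub>" 
    using aug_simps(2)[of "\<zero>\<^bsub>A\<^esub>" "\<zero>\<^bsub>A\<^esub>"] aug_simps(1)[of "\<zero>\<^bsub>A\<^esub>"] k.add.l_cancel_one by simp
  ultimately have "\<epsilon> (\<ominus>\<^bsub>A\<^esub> b) = \<ominus>\<^bsub>k\<^esub> \<epsilon> b"
    using assms aug_simps(1) k.minus_equality by simp
  then show ?thesis using assms by (simp add: a_minus_def aug_simps)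
qed

lemma aug_ideal_subset: "aug_ideal \<subseteq> carrier A"
  by (auto simp: aug_ideal_def)

lemma aug_ideal_mult: "\<lbrakk>a \<in> aug_ideal; b \<in> carrier A\<rbrakk> \<Longrightarrow> b \<otimes>\<^bsub>A\<^esub> a \<in> aug_ideal"
  by (simp add: aug_ideal_def aug_simps)

lemma left_module_scalars: "left_module A N \<Longrightarrow> left_module k (scalars N)"
  by (rule left_module_restrict_scalars[OF _ k.ring_axioms unit_ring_hom])

lemma lin_hom_scalars: "h \<in> lin_hom A M N \<Longrightarrow> h \<in> lin_hom k (scalars M) (scalars N)"
  by (rule lin_hom_restrict_scalars) (auto simp: unit_simps)

lemma aug_span_submodule:
  assumes "left_module A N" shows "submodule (aug_span N) A N"
  unfolding aug_span_def
  by (rule left_module.smult_span_submodule[OF assms aug_ideal_subset]) (simp add: aug_ideal_mult)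

lemma aug_span_hom:
  assumes "left_module A M" "left_module A N" "h \<in> lin_hom A M N" "u \<in> aug_span M"
  shows "h u \<in> aug_span N"
  using smult_span_hom[OF assms(1-3) aug_ideal_subset] assms(4) by (simp add: aug_span_def)

lemma submodule_scalars:
  assumes "left_module A N" "submodule H A N" shows "submodule H k (scalars N)"
  using submoduleD[OF assms(2)]
  by (intro left_module.submoduleI[OF left_module_scalars[OF assms(1)]]) (auto simp: unit_simps)

text \<open>On formal combinations of pairs this is r \<otimes> n \<mapsto> r n, and
  \<open>tensor_one\<close> is n \<mapsto> 1 \<otimes> n in the other direction. The relations of
  the tensor product hold after pairing only modulo \<open>aug_span\<close>, which is why the tensor
  product is the quotient of \<open>N\<close> by it.\<close>

definition pairing :: "('a, 'm, 'z) module_scheme \<Rightarrow> ('k \<times> 'm \<Rightarrow> 'k) \<Rightarrow> 'm" where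
  "pairing N = free_lift k (scalars N) (\<lambda>(r, n). unit r \<odot>\<^bsub>N\<^esub> n)"

definition tensor_one :: "('a, 'm, 'z) module_scheme \<Rightarrow> 'm \<Rightarrow> ('k \<times> 'm \<Rightarrow> 'k) set" where
  "tensor_one N n = tensor_kernel k A (aug_module k \<epsilon>) N
     +>\<^bsub>free_module k (carrier k \<times> carrier N)\<^esub> single k (\<one>\<^bsub>k\<^esub>, n)"

context
  fixes N :: "('a, 'm, 'z) module_scheme"
  assumes N: "left_module A N"
begin

interpretation N: left_module A N by (rule N)
interpretation S: left_module k "scalars N" by (rule left_module_scalars[OF N])
interpretation F: left_module k "free_module k (carrier k \<times> carrier N)"
  by (rule left_module_free[OF k.ring_axioms])

abbreviation (input) "F \<equiv> free_module k (carrier k \<times> carrier N)"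
abbreviation (input) "W \<equiv> tensor_kernel k A (aug_module k \<epsilon>) N"
abbreviation (input) "C \<equiv> tensor k A (aug_module k \<epsilon>) N"
abbreviation (input) "rel \<equiv> tensor_relations k A (aug_module k \<epsilon>) N"

lemma single_pair_closed: "\<lbrakk>r \<in> carrier k; n \<in> carrier N\<rbrakk> \<Longrightarrow> single k (r, n) \<in> carrier F"
  by (rule single_closed[OF k.ring_axioms]) simp

lemma pairing_range: "(\<lambda>(r, n). unit r \<odot>\<^bsub>N\<^esub> n) \<in> carrier k \<times> carrier N \<rightarrow> carrier (scalars N)"
  by (auto simp: unit_simps N.lsmult_closed)

lemma pairing_hom: "pairing N \<in> lin_hom k F (scalars N)"
  unfolding pairing_def by (rule S.free_lift_hom[OF pairing_range])

lemma pairing_single: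
  "\<lbrakk>r \<in> carrier k; n \<in> carrier N\<rbrakk> \<Longrightarrow> pairing N (single k (r, n)) = unit r \<odot>\<^bsub>N\<^esub> n"
  using S.free_lift_single[OF pairing_range, of "(r, n)"] by (simp add: pairing_def)

lemma relation_cases:
  assumes "(x, y) \<in> rel"
  obtains (add_left) m m' n where "m \<in> carrier k" "m' \<in> carrier k" "n \<in> carrier N"
      "x = single k (m \<oplus>\<^bsub>k\<^esub> m', n)" "y = single k (m, n) \<oplus>\<^bsub>F\<^esub> single k (m', n)"
  | (add_right) m n n' where "m \<in> carrier k" "n \<in> carrier N" "n' \<in> carrier N"
      "x = single k (m, n \<oplus>\<^bsub>N\<^esub> n')" "y = single k (m, n) \<oplus>\<^bsub>F\<^esub> single k (m, n')"
  | (balance) a m n where "a \<in> carrier A" "m \<in> carrier k" "n \<in> carrier N"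
      "x = single k (\<epsilon> a \<otimes>\<^bsub>k\<^esub> m, n)" "y = single k (m, a \<odot>\<^bsub>N\<^esub> n)"
  | (scale) r m n where "r \<in> carrier k" "m \<in> carrier k" "n \<in> carrier N"
      "x = single k (r \<otimes>\<^bsub>k\<^esub> m, n)" "y = r \<odot>\<^bsub>F\<^esub> single k (m, n)"
  using assms unfolding tensor_relations_def Let_def aug_module_simps
  by (elim UnE CollectE exE conjE) (simp_all add: aug_unit)

lemma relationI:
  "\<lbrakk>m \<in> carrier k; n \<in> carrier N; n' \<in> carrier N\<rbrakk> \<Longrightarrow>
     (single k (m, n \<oplus>\<^bsub>N\<^esub> n'), single k (m, n) \<oplus>\<^bsub>F\<^esub> single k (m, n')) \<in> rel"
  "\<lbrakk>a \<in> carrier A; m \<in> carrier k; n \<in> carrier N\<rbrakk> \<Longrightarrow>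
     (single k (\<epsilon> a \<otimes>\<^bsub>k\<^esub> m, n), single k (m, a \<odot>\<^bsub>N\<^esub> n)) \<in> rel"
  "\<lbrakk>r \<in> carrier k; m \<in> carrier k; n \<in> carrier N\<rbrakk> \<Longrightarrow>
     (single k (r \<otimes>\<^bsub>k\<^esub> m, n), r \<odot>\<^bsub>F\<^esub> single k (m, n)) \<in> rel"
proof -
  show "(single k (m, n \<oplus>\<^bsub>N\<^esub> n'), single k (m, n) \<oplus>\<^bsub>F\<^esub> single k (m, n')) \<in> rel"
    if "m \<in> carrier k" "n \<in> carrier N" "n' \<in> carrier N"
    using that unfolding tensor_relations_def Let_def aug_module_simps by blast
  show "(single k (\<epsilon> a \<otimes>\<^bsub>k\<^esub> m, n), single k (m, a \<odot>\<^bsub>N\<^esub> n)) \<in> rel"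
    if "a \<in> carrier A" "m \<in> carrier k" "n \<in> carrier N"
    using that unfolding tensor_relations_def Let_def aug_module_simps by blast
  show "(single k (r \<otimes>\<^bsub>k\<^esub> m, n), r \<odot>\<^bsub>F\<^esub> single k (m, n)) \<in> rel"
    if r: "r \<in> carrier k" and m: "m \<in> carrier k" and n: "n \<in> carrier N"
  proof -
    have "(single k (\<epsilon> (r \<odot>\<^bsub>A\<^esub> \<one>\<^bsub>A\<^esub>) \<otimes>\<^bsub>k\<^esub> m, n), r \<odot>\<^bsub>F\<^esub> single k (m, n)) \<in> rel"
      using that unfolding tensor_relations_def Let_def aug_module_simps by blast
    then show ?thesis by (simp only: aug_unit[OF r])
  qed
qed

lemma relation_closed:
  assumes "(x, y) \<in> rel" shows "x \<in> carrier F" "y \<in> carrier F"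
  using assms single_pair_closed N.lsmult_closed aug_simps(1)
  by (cases rule: relation_cases; auto simp del: free_module_simps intro!: F.lsmult_closed F.M.a_closed)+

lemma tensor_kernel_submodule: "submodule W k F"
  unfolding tensor_kernel_def Let_def aug_module_simps
  using F.M.minus_closed[OF relation_closed] by (intro submodule_span_submodule[OF F.left_module_axioms]) blast

lemma relation_in_tensor_kernel: "(x, y) \<in> rel \<Longrightarrow> x \<ominus>\<^bsub>F\<^esub> y \<in> W"
  unfolding tensor_kernel_def Let_def submodule_span_def aug_module_simps by blast

lemma pairing_tensor_kernel: "f \<in> W \<Longrightarrow> pairing N f \<in> aug_span N"
proof -
  let ?H = "{f \<in> carrier F. pairing N f \<in> aug_span N}"
  have "submodule ?H k F"
    by (rule submodule_vimage[OF F.left_module_axioms S.left_module_axioms pairing_hom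
          submodule_scalars[OF N aug_span_submodule[OF N]]])
  moreover have "x \<ominus>\<^bsub>F\<^esub> y \<in> ?H" if xy: "(x, y) \<in> rel" for x y
  proof -
    note Fc = F.M.abelian_group_axioms and Sc = S.M.abelian_group_axioms
    have zero: "pairing N x \<ominus>\<^bsub>N\<^esub> pairing N y \<in> aug_span N" if "pairing N x = pairing N y"
    proof -
      have "pairing N x \<in> carrier N" "pairing N y \<in> carrier N"
        using lin_homD(1)[OF pairing_hom] relation_closed[OF xy] by auto
      then have "pairing N x \<ominus>\<^bsub>N\<^esub> pairing N y = \<zero>\<^bsub>N\<^esub>" using that N.M.minus_eq_zero_iff by blast
      then show ?thesis using submoduleD(2)[OF aug_span_submodule[OF N]] by simp
    qed
    have "pairing N x \<ominus>\<^bsub>N\<^esub> pairing N y \<in> aug_span N"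
      using xy
    proof (cases rule: relation_cases)
      case (add_left m m' n)
      then have "pairing N x = pairing N y"
        by (simp add: lin_homD(2)[OF pairing_hom single_pair_closed single_pair_closed] pairing_single unit_simps N.lsmult_l_distr
            del: free_module_simps)
      then show ?thesis by (rule zero)
    next
      case (add_right m n n')
      then have "pairing N x = pairing N y"
        by (simp add: lin_homD(2)[OF pairing_hom single_pair_closed single_pair_closed] pairing_single unit_simps N.lsmult_r_distr
            del: free_module_simps)
      then show ?thesis by (rule zero)
    next
      case (balance a m n)
      \<comment> \<open>The only relation that the pairing does not turn into an equality. The two
        sides differ by \<open>?b n\<close>, and \<epsilon> sends \<open>?b\<close> to
        \<open>\<epsilon> a m - m \<epsilon> a\<close>, which is zero as \<open>k\<close> is
        commutative.\<close>
      let ?b = "unit (\<epsilon> a \<otimes>\<^bsub>k\<^esub> m) \<ominus>\<^bsub>A\<^esub> unit m \<otimes>\<^bsub>A\<^esub> a"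
      have b: "?b \<in> aug_ideal"
        using balance by (simp add: aug_ideal_def aug_diff aug_simps unit_simps aug_unit' k.m_comm k.minus_eq_zero_iff)
      have "pairing N x \<ominus>\<^bsub>N\<^esub> pairing N y = ?b \<odot>\<^bsub>N\<^esub> n"
        using balance by (simp add: pairing_single N.lsmult_closed aug_simps unit_simps a_minus_def
            N.lsmult_l_distr N.lsmult_l_minus N.lsmult_assoc)
      then show ?thesis
        using N.smult_span_base[OF aug_ideal_subset b] balance by (simp add: aug_span_def)
    next
      case (scale r m n)
      then have "pairing N x = pairing N y"
        by (simp add: lin_homD(3)[OF pairing_hom _ single_pair_closed] pairing_single unit_simps N.lsmult_assoc
            del: free_module_simps)
      then show ?thesis by (rule zero)
    qed
    then show ?thesis
      using relation_closed[OF xy] lin_hom_diff[OF pairing_hom Fc Sc] by simp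
  qed
  ultimately have "W \<subseteq> ?H"
    unfolding tensor_kernel_def Let_def submodule_span_def aug_module_simps by blast
  then show ?thesis if "f \<in> W" using that by blast
qed

lemma tensor_eq_quot: "C = quot_module F W"
  by (simp add: tensor_def)

lemma left_module_tensor: "left_module k C"
  unfolding tensor_eq_quot by (rule left_module_quot[OF F.left_module_axioms tensor_kernel_submodule])

lemma class_hom: "(\<lambda>f. W +>\<^bsub>F\<^esub> f) \<in> lin_hom k F C"
  unfolding tensor_eq_quot by (rule quot_proj_hom[OF F.left_module_axioms tensor_kernel_submodule])

lemma relation_class_eq: "(x, y) \<in> rel \<Longrightarrow> W +>\<^bsub>F\<^esub> x = W +>\<^bsub>F\<^esub> y"
  using quot_eq_iff[OF F.left_module_axioms tensor_kernel_submodule] relation_closed relation_in_tensor_kernel by blast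

lemma tensor_one_hom: "tensor_one N \<in> lin_hom k (scalars N) C"
proof (rule lin_homI)
  show "tensor_one N n \<in> carrier C" if "n \<in> carrier (scalars N)" for n
    using lin_homD(1)[OF class_hom single_pair_closed[of "\<one>\<^bsub>k\<^esub>" n]] that by (simp add: tensor_one_def)
  show "tensor_one N (n \<oplus>\<^bsub>scalars N\<^esub> n') = tensor_one N n \<oplus>\<^bsub>C\<^esub> tensor_one N n'"
    if "n \<in> carrier (scalars N)" "n' \<in> carrier (scalars N)" for n n'
    using relation_class_eq[OF relationI(1)[of "\<one>\<^bsub>k\<^esub>" n n']] lin_homD(2)[OF class_hom single_pair_closed single_pair_closed] that
    by (simp add: tensor_one_def del: free_module_simps)
  show "tensor_one N (r \<odot>\<^bsub>scalars N\<^esub> n) = r \<odot>\<^bsub>C\<^esub> tensor_one N n"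
    if "r \<in> carrier k" "n \<in> carrier (scalars N)" for r n
    using relation_class_eq[OF relationI(2)[of "unit r" "\<one>\<^bsub>k\<^esub>" n]] relation_class_eq[OF relationI(3)[of r "\<one>\<^bsub>k\<^esub>" n]]
      lin_homD(3)[OF class_hom _ single_pair_closed] that
    by (simp add: tensor_one_def aug_unit' unit_simps del: free_module_simps)
qed

text \<open>Balancing over the image of \<open>r\<close> in \<open>A\<close> moves it across the
  tensor sign: r \<otimes> n = 1 \<otimes> r n.\<close>

lemma class_eq: "f \<in> carrier F \<Longrightarrow> W +>\<^bsub>F\<^esub> f = tensor_one N (pairing N f)"
proof -
  have "W +>\<^bsub>F\<^esub> single k s = (tensor_one N \<circ> pairing N) (single k s)" if "s \<in> carrier k \<times> carrier N" for s
  proof -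
    obtain r n where s: "s = (r, n)" "r \<in> carrier k" "n \<in> carrier N" using \<open>s \<in> _\<close> by auto
    then show ?thesis
      using relation_class_eq[OF relationI(2)[of "unit r" "\<one>\<^bsub>k\<^esub>" n]]
      by (simp add: pairing_single tensor_one_def aug_unit' unit_simps del: free_module_simps)
  qed
  then have "W +>\<^bsub>F\<^esub> f = (tensor_one N \<circ> pairing N) f" if "f \<in> carrier F"
    by (rule lin_hom_free_eqI[OF k.ring_axioms left_module_tensor class_hom
          lin_hom_comp[OF pairing_hom tensor_one_hom] _ that])
  then show ?thesis if "f \<in> carrier F" using that by simp
qed

lemma tensor_one_surj: "tensor_one N ` carrier N = carrier C"
proof
  show "tensor_one N ` carrier N \<subseteq> carrier C" using lin_homD(1)[OF tensor_one_hom] by auto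
  show "carrier C \<subseteq> tensor_one N ` carrier N"
    using class_eq lin_homD(1)[OF pairing_hom]
    by (auto simp: tensor_eq_quot quot_carrier[OF F.left_module_axioms tensor_kernel_submodule])
qed

text \<open>The kernel of n \<mapsto> 1 \<otimes> n. One inclusion is the pairing; the other is 1
  \<otimes> a x = \<epsilon>(a) \<otimes> x = 0 for \<open>a\<close> in the augmentation
  ideal.\<close>

lemma tensor_one_zero_iff:
  assumes n: "n \<in> carrier N" shows "tensor_one N n = \<zero>\<^bsub>C\<^esub> \<longleftrightarrow> n \<in> aug_span N"
proof
  assume "tensor_one N n = \<zero>\<^bsub>C\<^esub>"
  then have "single k (\<one>\<^bsub>k\<^esub>, n) \<in> W"
    using quot_eq_zero_iff[OF F.left_module_axioms tensor_kernel_submodule single_pair_closed] n by (simp add: tensor_one_def tensor_eq_quot)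
  then show "n \<in> aug_span N"
    using pairing_tensor_kernel pairing_single[of "\<one>\<^bsub>k\<^esub>" n] n by (fastforce simp: unit_simps N.lsmult_one)
next
  interpret C: left_module k C by (rule left_module_tensor)
  have gen: "tensor_one N (a \<odot>\<^bsub>N\<^esub> x) = \<zero>\<^bsub>C\<^esub>" if a: "a \<in> aug_ideal" and x: "x \<in> carrier N" for a x
  proof -
    have a': "a \<in> carrier A" "\<epsilon> a = \<zero>\<^bsub>k\<^esub>" using a by (auto simp: aug_ideal_def)
    have "tensor_one N (a \<odot>\<^bsub>N\<^esub> x) = W +>\<^bsub>F\<^esub> single k (\<zero>\<^bsub>k\<^esub> \<otimes>\<^bsub>k\<^esub> \<one>\<^bsub>k\<^esub>, x)"
      using relation_class_eq[OF relationI(2)[of a "\<one>\<^bsub>k\<^esub>" x]] a' x by (simp add: tensor_one_def)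
    also have "\<dots> = \<zero>\<^bsub>k\<^esub> \<odot>\<^bsub>C\<^esub> (W +>\<^bsub>F\<^esub> single k (\<one>\<^bsub>k\<^esub>, x))"
      using relation_class_eq[OF relationI(3)[of "\<zero>\<^bsub>k\<^esub>" "\<one>\<^bsub>k\<^esub>" x]] lin_homD(3)[OF class_hom _ single_pair_closed] x
      by (simp del: free_module_simps)
    also have "\<dots> = \<zero>\<^bsub>C\<^esub>"
      using lin_homD(1)[OF class_hom single_pair_closed] x by (intro C.lsmult_l_null) auto
    finally show ?thesis .
  qed
  assume "n \<in> aug_span N"
  then have "n \<in> {x \<in> carrier N. tensor_one N x = \<zero>\<^bsub>C\<^esub>}"
    unfolding aug_span_def
  proof (rule smult_span_least)
    show "\<zero>\<^bsub>N\<^esub> \<in> {x \<in> carrier N. tensor_one N x = \<zero>\<^bsub>C\<^esub>}"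
      using lin_hom_zero[OF tensor_one_hom S.M.abelian_group_axioms C.M.abelian_group_axioms] by simp
    show "x \<oplus>\<^bsub>N\<^esub> y \<in> {x \<in> carrier N. tensor_one N x = \<zero>\<^bsub>C\<^esub>}"
      if "x \<in> {x \<in> carrier N. tensor_one N x = \<zero>\<^bsub>C\<^esub>}" "y \<in> {x \<in> carrier N. tensor_one N x = \<zero>\<^bsub>C\<^esub>}" for x y
      using that lin_homD(2)[OF tensor_one_hom, of x y] by simp
    show "a \<odot>\<^bsub>N\<^esub> x \<in> {x \<in> carrier N. tensor_one N x = \<zero>\<^bsub>C\<^esub>}" if "a \<in> aug_ideal" "x \<in> carrier N" for a x
      using that gen aug_ideal_subset N.lsmult_closed by auto
  qed
  then show "tensor_one N n = \<zero>\<^bsub>C\<^esub>" by simp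
qed

lemma tensor_one_eq_iff:
  assumes "x \<in> carrier N" "y \<in> carrier N"
  shows "tensor_one N x = tensor_one N y \<longleftrightarrow> x \<ominus>\<^bsub>N\<^esub> y \<in> aug_span N"
proof -
  interpret C: left_module k C by (rule left_module_tensor)
  have "tensor_one N x = tensor_one N y \<longleftrightarrow> tensor_one N x \<ominus>\<^bsub>C\<^esub> tensor_one N y = \<zero>\<^bsub>C\<^esub>"
    using C.M.minus_eq_zero_iff lin_homD(1)[OF tensor_one_hom] assms by simp
  also have "\<dots> \<longleftrightarrow> tensor_one N (x \<ominus>\<^bsub>N\<^esub> y) = \<zero>\<^bsub>C\<^esub>"
    using lin_hom_diff[OF tensor_one_hom S.M.abelian_group_axioms C.M.abelian_group_axioms] assms by simp
  also have "\<dots> \<longleftrightarrow> x \<ominus>\<^bsub>N\<^esub> y \<in> aug_span N"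
    by (rule tensor_one_zero_iff) (use assms in auto)
  finally show ?thesis .
qed

lemma tensor_one_members:
  assumes n: "n \<in> carrier N"
  shows "single k (\<one>\<^bsub>k\<^esub>, n) \<in> tensor_one N n"
    and "f \<in> tensor_one N n \<Longrightarrow> f \<in> carrier F \<and> tensor_one N (pairing N f) = tensor_one N n"
proof -
  interpret W: abelian_subgroup W F
    using tensor_kernel_submodule by (intro abelian_subgroupI3 additive_subgroupI)
      (simp_all add: submodule_def F.M.abelian_group_axioms)
  have s: "single k (\<one>\<^bsub>k\<^esub>, n) \<in> carrier F" using single_pair_closed n by simp
  show "single k (\<one>\<^bsub>k\<^esub>, n) \<in> tensor_one N n" unfolding tensor_one_def by (rule W.a_rcos_self[OF s])
  assume f: "f \<in> tensor_one N n"
  then have fc: "f \<in> carrier F"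
    using F.M.a_r_coset_subset_G[OF W.a_subset s] by (auto simp: tensor_one_def)
  moreover have "W +>\<^bsub>F\<^esub> f = tensor_one N n"
    using F.M.a_repr_independence[OF _ s W.a_subgroup] f by (simp add: tensor_one_def)
  ultimately show "f \<in> carrier F \<and> tensor_one N (pairing N f) = tensor_one N n" using class_eq by metis
qed

end

text \<open>\<open>tensor_map\<close> is a union over the representatives of a coset. Any two of
  them pair to elements of \<open>N\<close> that differ by \<open>aug_span N\<close>, which
  \<open>h\<close> carries into \<open>aug_span N'\<close>; so the union is one coset.\<close>

lemma tensor_map_one:
  assumes N: "left_module A N" and N': "left_module A N'" and h: "h \<in> lin_hom A N N'"
    and n: "n \<in> carrier N"
  shows "tensor_map k A (aug_module k \<epsilon>) N' h (tensor_one N n) = tensor_one N' (h n)"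
proof -
  let ?u = "\<lambda>(m, n). (m, h n)"
  let ?F = "free_module k (carrier k \<times> carrier N)" and ?F' = "free_module k (carrier k \<times> carrier N')"
  interpret F': left_module k ?F' by (rule left_module_free[OF k.ring_axioms])
  have u: "?u \<in> carrier k \<times> carrier N \<rightarrow> carrier k \<times> carrier N'" using lin_homD(1)[OF h] by auto
  have us: "(\<lambda>s. single k (?u s)) \<in> carrier k \<times> carrier N \<rightarrow> carrier ?F'"
    by (intro Pi_I single_closed k.ring_axioms) (use lin_homD(1)[OF h] in auto)
  let ?p = "free_lift k ?F' (\<lambda>s. single k (?u s))"
  have p: "?p \<in> lin_hom k ?F ?F'" by (rule F'.free_lift_hom[OF us])
  have ps: "?p (single k s) = single k (?u s)" if "s \<in> carrier k \<times> carrier N" for s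
    using F'.free_lift_single[OF us that] by simp
  have "(pairing N' \<circ> ?p) f = (h \<circ> pairing N) f" if "f \<in> carrier ?F" for f
  proof (rule lin_hom_free_eqI[OF k.ring_axioms left_module_scalars[OF N'] lin_hom_comp[OF p pairing_hom[OF N']]
        lin_hom_comp[OF pairing_hom[OF N] lin_hom_scalars[OF h]] _ that])
    fix s assume "s \<in> carrier k \<times> carrier N"
    then show "(pairing N' \<circ> ?p) (single k s) = (h \<circ> pairing N) (single k s)"
      using ps[of s] lin_homD[OF h] by (auto simp: pairing_single[OF N] pairing_single[OF N'] unit_simps)
  qed
  then have pair: "pairing N' (pushforward k ?u f) = h (pairing N f)" and
    pf: "pushforward k ?u f \<in> carrier ?F'" if "f \<in> carrier ?F" for f
    using that pushforward_eq_free_lift[OF k.ring_axioms u that] lin_homD(1)[OF p that] by simp_all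
  have "tensor_kernel k A (aug_module k \<epsilon>) N' +>\<^bsub>?F'\<^esub> pushforward k ?u f = tensor_one N' (h n)"
    if f: "f \<in> tensor_one N n" for f
  proof -
    have f': "f \<in> carrier ?F" "tensor_one N (pairing N f) = tensor_one N n"
      using tensor_one_members(2)[OF N n f] by auto
    have pc: "pairing N f \<in> carrier N" using lin_homD(1)[OF pairing_hom[OF N] f'(1)] by simp
    have "pairing N f \<ominus>\<^bsub>N\<^esub> n \<in> aug_span N" using f'(2) tensor_one_eq_iff[OF N pc n] by simp
    then have "h (pairing N f) \<ominus>\<^bsub>N'\<^esub> h n \<in> aug_span N'"
      using aug_span_hom[OF N N' h] lin_hom_diff[OF h] N N' pc n by (metis left_module_abelian_group)
    then have "tensor_one N' (h (pairing N f)) = tensor_one N' (h n)"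
      using tensor_one_eq_iff[OF N'] lin_homD(1)[OF h] pc n by simp
    then show ?thesis using class_eq[OF N' pf[OF f'(1)]] pair[OF f'(1)] by simp
  qed
  then show ?thesis
    unfolding tensor_map_def aug_module_simps
    using tensor_one_members(1)[OF N n] by (intro SUP_eq_const) auto
qed

text \<open>Representatives in \<open>P q\<close> of the cycles of \<open>P\<close> modulo the
  augmentation ideal: the boundary has to lie in \<open>aug_span\<close>, not to vanish.\<close>

definition cycles :: "(nat \<Rightarrow> ('a, 'm, 'z) module_scheme) \<Rightarrow> (nat \<Rightarrow> 'm \<Rightarrow> 'm) \<Rightarrow> nat \<Rightarrow> 'm set" where
  "cycles P d q = {x \<in> carrier (P q). case q of 0 \<Rightarrow> True | Suc i \<Rightarrow> d i x \<in> aug_span (P i)}"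

lemma cycles_submodule:
  assumes P: "\<And>i. left_module A (P i)" and d: "\<And>i. d i \<in> lin_hom A (P (Suc i)) (P i)"
  shows "submodule (cycles P d q) k (scalars (P q))"
proof (cases q)
  case 0
  interpret S: left_module k "scalars (P 0)" by (rule left_module_scalars[OF P])
  show ?thesis
    using 0 S.lsmult_closed S.M.zero_closed S.M.a_closed by (auto simp: cycles_def intro!: S.submoduleI)
next
  case (Suc i)
  then show ?thesis
    using submodule_vimage[OF left_module_scalars[OF P] left_module_scalars[OF P] lin_hom_scalars[OF d[of i]]
        submodule_scalars[OF P aug_span_submodule[OF P]]]
    by (simp add: cycles_def)
qed

text \<open>\<open>Tor\<close> consists of cosets of cosets of formal combinations. Here it becomes
  a quotient of a submodule of \<open>P q\<close>, so that every later comparison is between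
  elements of the resolutions themselves.\<close>

lemma Tor_presentation:
  assumes P: "\<And>i. left_module A (P i)" and d: "\<And>i. d i \<in> lin_hom A (P (Suc i)) (P i)"
    and dd: "\<And>i x. x \<in> carrier (P (Suc (Suc i))) \<Longrightarrow> d i (d (Suc i) x) = \<zero>\<^bsub>P i\<^esub>"
  obtains \<rho> where "left_module k (Tor k A (aug_module k \<epsilon>) P d q)"
    and "\<rho> \<in> lin_hom k (scalars (P q)\<lparr>carrier := cycles P d q\<rparr>) (Tor k A (aug_module k \<epsilon>) P d q)"
    and "\<rho> ` cycles P d q = carrier (Tor k A (aug_module k \<epsilon>) P d q)"
    and "\<And>x. x \<in> cycles P d q \<Longrightarrow> \<rho> x = \<zero>\<^bsub>Tor k A (aug_module k \<epsilon>) P d q\<^esub> \<longleftrightarrow>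
      (\<exists>w\<in>carrier (P (Suc q)). x \<ominus>\<^bsub>P q\<^esub> d q w \<in> aug_span (P q))"
proof -
  let ?T = "aug_module k \<epsilon>"
  let ?C = "\<lambda>i. tensor k A ?T (P i)" and ?D = "\<lambda>i. tensor_map k A ?T (P i) (d i)"
  let ?t = "\<lambda>i. tensor_one (P i)"
  let ?Z = "{x \<in> carrier (?C q). case q of 0 \<Rightarrow> True | Suc i \<Rightarrow> ?D i x = \<zero>\<^bsub>?C i\<^esub>}"
  let ?B = "?D q ` carrier (?C (Suc q))"
  let ?M = "(?C q)\<lparr>carrier := ?Z\<rparr>"
  have Tor: "Tor k A ?T P d q = quot_module ?M ?B" by (simp add: Tor_def Let_def)
  have t: "?t i \<in> lin_hom k (scalars (P i)) (?C i)" for i by (rule tensor_one_hom[OF P])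
  have D: "?D i (?t (Suc i) x) = ?t i (d i x)" if "x \<in> carrier (P (Suc i))" for i x
    by (rule tensor_map_one[OF P P d that])
  have Z: "?Z = ?t q ` cycles P d q"
  proof -
    have mem: "?t q x \<in> ?Z \<longleftrightarrow> x \<in> cycles P d q" if "x \<in> carrier (P q)" for x
      using that lin_homD(1)[OF t, of x q] D tensor_one_zero_iff[OF P lin_homD(1)[OF d]]
      by (cases q) (auto simp: cycles_def)
    show ?thesis
    proof (intro equalityI subsetI)
      fix z assume z: "z \<in> ?Z"
      then have "z \<in> ?t q ` carrier (P q)" unfolding tensor_one_surj[OF P] by blast
      then obtain x where x: "x \<in> carrier (P q)" "z = ?t q x" by (elim imageE)
      then show "z \<in> ?t q ` cycles P d q" using mem[OF x(1)] z by (simp only: imageI)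
    next
      fix z assume "z \<in> ?t q ` cycles P d q"
      then obtain x where x: "x \<in> cycles P d q" "z = ?t q x" by (elim imageE)
      then have "x \<in> carrier (P q)" by (simp add: cycles_def)
      then show "z \<in> ?Z" using mem x by (simp only:)
    qed
  qed
  have B: "?B = (?t q \<circ> d q) ` carrier (P (Suc q))"
    unfolding tensor_one_surj[OF P, symmetric] image_image using D by (auto intro!: image_cong)
  have cyc: "submodule (cycles P d q) k (scalars (P q))" by (rule cycles_submodule[of P d, OF P d])
  have Zsub: "submodule ?Z k (?C q)"
    unfolding Z by (rule submodule_image[OF left_module_scalars[OF P] left_module_tensor[OF P] t cyc])
  have M: "left_module k ?M" by (rule left_module_submodule[OF left_module_tensor[OF P] Zsub])
  have td: "?t q \<circ> d q \<in> lin_hom k (scalars (P (Suc q))) (?C q)"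
    by (rule lin_hom_comp[OF lin_hom_scalars[OF d] t])
  have dcyc: "d q w \<in> cycles P d q" if "w \<in> carrier (P (Suc q))" for w
    using that lin_homD(1)[OF d that] dd submoduleD(2)[OF aug_span_submodule[OF P]]
    by (cases q) (auto simp: cycles_def)
  have td': "?t q \<circ> d q \<in> lin_hom k (scalars (P (Suc q))) ?M"
    using lin_homD[OF td] dcyc Z by (intro lin_homI) auto
  interpret SP: left_module k "scalars (P (Suc q))" by (rule left_module_scalars[OF P])
  have "submodule (carrier (scalars (P (Suc q)))) k (scalars (P (Suc q)))"
    by (rule SP.submoduleI) (auto intro: SP.lsmult_closed SP.M.a_closed simp del: restrict_scalars_simps)
  then have Bsub: "submodule ?B k ?M"
    unfolding B using submodule_image[OF SP.left_module_axioms M td'] by simp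
  let ?L = "scalars (P q)\<lparr>carrier := cycles P d q\<rparr>"
  have t': "?t q \<in> lin_hom k ?L ?M"
  proof (rule lin_homI)
    have P': "x \<in> carrier (P q)" if "x \<in> carrier ?L" for x using that by (simp add: cycles_def)
    show "?t q x \<in> carrier ?M" if "x \<in> carrier ?L" for x
      unfolding Z using that by simp
    show "?t q (x \<oplus>\<^bsub>?L\<^esub> y) = ?t q x \<oplus>\<^bsub>?M\<^esub> ?t q y" if "x \<in> carrier ?L" "y \<in> carrier ?L" for x y
      using lin_homD(2)[OF t[of q], of x y] P'[OF that(1)] P'[OF that(2)] by simp
    show "?t q (r \<odot>\<^bsub>?L\<^esub> x) = r \<odot>\<^bsub>?M\<^esub> ?t q x" if "r \<in> carrier k" "x \<in> carrier ?L" for r x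
      using lin_homD(3)[OF t[of q], of r x] that(1) P'[OF that(2)] by simp
  qed
  let ?r = "(\<lambda>z. ?B +>\<^bsub>?M\<^esub> z) \<circ> ?t q"
  show thesis
  proof (rule that[of ?r])
    show "left_module k (Tor k A ?T P d q)" unfolding Tor by (rule left_module_quot[OF M Bsub])
    show "?r \<in> lin_hom k ?L (Tor k A ?T P d q)"
      unfolding Tor by (rule lin_hom_comp[OF t' quot_proj_hom[OF M Bsub]])
    show "?r ` cycles P d q = carrier (Tor k A ?T P d q)"
    proof -
      have "carrier ?M = ?t q ` cycles P d q" using Z by simp
      then show ?thesis unfolding Tor quot_carrier[OF M Bsub] image_comp[symmetric] by (rule arg_cong[OF sym])
    qed
    fix x assume x: "x \<in> cycles P d q"
    then have xP: "x \<in> carrier (P q)" by (simp add: cycles_def)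
    have "?r x = \<zero>\<^bsub>Tor k A ?T P d q\<^esub> \<longleftrightarrow> ?t q x \<in> ?B"
      unfolding Tor comp_apply by (rule quot_eq_zero_iff[OF M Bsub]) (use x Z in auto)
    also have "\<dots> \<longleftrightarrow> (\<exists>w\<in>carrier (P (Suc q)). ?t q x = ?t q (d q w))" unfolding B by auto
    also have "\<dots> \<longleftrightarrow> (\<exists>w\<in>carrier (P (Suc q)). x \<ominus>\<^bsub>P q\<^esub> d q w \<in> aug_span (P q))"
      using tensor_one_eq_iff[OF P xP lin_homD(1)[OF d]] by auto
    finally show "?r x = \<zero>\<^bsub>Tor k A ?T P d q\<^esub> \<longleftrightarrow> \<dots>" .
  qed
qed

end

section \<open>Change of rings for Tor\<close>

lemma quot_lift_hom:
  assumes M: "left_module A M" and N: "left_module A N" and W: "submodule W A M"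
    and h: "h \<in> lin_hom A M N" and hW: "\<And>x. x \<in> W \<Longrightarrow> h x = \<zero>\<^bsub>N\<^esub>"
  obtains h' where "h' \<in> lin_hom A (quot_module M W) N"
    and "\<And>x. x \<in> carrier M \<Longrightarrow> h' (W +>\<^bsub>M\<^esub> x) = h x"
proof -
  interpret M: left_module A M by fact
  interpret N: left_module A N by fact
  define h' where "h' Y = h (SOME x. x \<in> carrier M \<and> W +>\<^bsub>M\<^esub> x = Y)" for Y
  have h': "h' (W +>\<^bsub>M\<^esub> x) = h x" if x: "x \<in> carrier M" for x
  proof -
    let ?y = "SOME y. y \<in> carrier M \<and> W +>\<^bsub>M\<^esub> y = W +>\<^bsub>M\<^esub> x"
    have y: "?y \<in> carrier M \<and> W +>\<^bsub>M\<^esub> ?y = W +>\<^bsub>M\<^esub> x" by (rule someI_ex) (use x in blast)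
    then have "h (?y \<ominus>\<^bsub>M\<^esub> x) = \<zero>\<^bsub>N\<^esub>" using quot_eq_iff[OF M W] x hW by blast
    then show ?thesis
      using y x lin_hom_diff[OF h M.M.abelian_group_axioms N.M.abelian_group_axioms]
        N.M.minus_eq_zero_iff lin_homD(1)[OF h] by (simp add: h'_def)
  qed
  have ex: "\<exists>x\<in>carrier M. Y = W +>\<^bsub>M\<^esub> x" if "Y \<in> carrier (quot_module M W)" for Y
    using that quot_carrier[OF M W] by auto
  note p = quot_proj_hom[OF M W]
  have "h' \<in> lin_hom A (quot_module M W) N"
  proof (rule lin_homI)
    fix Y assume Y: "Y \<in> carrier (quot_module M W)"
    obtain x where x: "x \<in> carrier M" "Y = W +>\<^bsub>M\<^esub> x" using ex[OF Y] by blast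
    then show "h' Y \<in> carrier N" using h' lin_homD(1)[OF h] by simp
    show "h' (a \<odot>\<^bsub>quot_module M W\<^esub> Y) = a \<odot>\<^bsub>N\<^esub> h' Y" if a: "a \<in> carrier A" for a
      using x h' lin_homD(3)[OF p a, symmetric] lin_homD(3)[OF h a] M.lsmult_closed[OF a] by simp
    fix Y' assume Y': "Y' \<in> carrier (quot_module M W)"
    obtain x' where x': "x' \<in> carrier M" "Y' = W +>\<^bsub>M\<^esub> x'" using ex[OF Y'] by blast
    show "h' (Y \<oplus>\<^bsub>quot_module M W\<^esub> Y') = h' Y \<oplus>\<^bsub>N\<^esub> h' Y'"
      using x x' h' lin_homD(2)[OF p, symmetric] lin_homD(2)[OF h] by simp
  qed
  then show thesis using h' that by blast
qed

lemma left_module_aug_module: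
  assumes "resolution A (aug_module k \<epsilon>) P d e" "cring k"
  shows "left_module A (aug_module k \<epsilon>)"
proof -
  interpret cring k by fact
  note P = resolutionD[OF assms(1)]
  interpret P: left_module A "P 0" by (rule P)
  \<comment> \<open>The value of \<open>e\<close> at zero is found by cancellation in
    \<open>k\<close>, because the target is not yet known to be a module.\<close>
  have "e \<zero>\<^bsub>P 0\<^esub> \<oplus>\<^bsub>k\<^esub> e \<zero>\<^bsub>P 0\<^esub> = e \<zero>\<^bsub>P 0\<^esub>"
    using lin_homD(2)[OF P(3), of "\<zero>\<^bsub>P 0\<^esub>" "\<zero>\<^bsub>P 0\<^esub>"] by simp
  moreover have "e \<zero>\<^bsub>P 0\<^esub> \<in> carrier k" using lin_homD(1)[OF P(3), of "\<zero>\<^bsub>P 0\<^esub>"] by simp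
  ultimately have "e \<zero>\<^bsub>P 0\<^esub> = \<zero>\<^bsub>k\<^esub>" using add.l_cancel_one by blast
  then show ?thesis by (intro left_module_image[OF P(1) P(3,4)]) simp
qed

text \<open>A projective \<open>B\<close>-module need not be projective over \<open>A\<close>. But
  modules killed by the kernel of the surjection \<open>\<phi>\<close> are \<open>B\<close>-modules
  through any section of \<open>\<phi>\<close>, and \<open>A\<close>-linear maps between them are
  \<open>B\<close>-linear; so the lifting takes place over \<open>B\<close>.\<close>

lemma restrict_scalars_lifts:
  assumes phi: "\<phi> \<in> ring_hom A B" "\<phi> ` carrier A = carrier B"
    and Q: "projective B Q"
    and M: "left_module A M" and N: "left_module A N" and p: "p \<in> lin_hom A M N"
    and kM: "\<And>a x. \<lbrakk>a \<in> carrier A; \<phi> a = \<zero>\<^bsub>B\<^esub>; x \<in> carrier M\<rbrakk> \<Longrightarrow> a \<odot>\<^bsub>M\<^esub> x = \<zero>\<^bsub>M\<^esub>"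
    and kN: "\<And>a x. \<lbrakk>a \<in> carrier A; \<phi> a = \<zero>\<^bsub>B\<^esub>; x \<in> carrier N\<rbrakk> \<Longrightarrow> a \<odot>\<^bsub>N\<^esub> x = \<zero>\<^bsub>N\<^esub>"
  shows "lifts_through A (restrict_scalars \<phi> Q) M N p"
  unfolding lifts_through_def
proof (intro ballI impI)
  fix h assume h: "h \<in> lin_hom A (restrict_scalars \<phi> Q) N"
    and im: "h ` carrier (restrict_scalars \<phi> Q) \<subseteq> p ` carrier M"
  interpret A: ring A by (rule left_module_ring[OF M])
  have QB: "left_module B Q" using Q by (simp add: projective_def)
  interpret Q: left_module B Q by (rule QB)
  note phi_simps = ring_hom_closed[OF phi(1)] ring_hom_add[OF phi(1)] ring_hom_mult[OF phi(1)] ring_hom_one[OF phi(1)]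
  define \<sigma> where "\<sigma> b = (SOME a. a \<in> carrier A \<and> \<phi> a = b)" for b
  have sigma: "\<sigma> b \<in> carrier A \<and> \<phi> (\<sigma> b) = b" if "b \<in> carrier B" for b
  proof -
    have "b \<in> \<phi> ` carrier A" using that phi(2) by simp
    then have "\<exists>a. a \<in> carrier A \<and> \<phi> a = b" by (elim imageE) auto
    then show ?thesis unfolding \<sigma>_def by (rule someI_ex)
  qed
  have phi_diff: "\<phi> (a \<ominus>\<^bsub>A\<^esub> b) = \<zero>\<^bsub>B\<^esub>" if "a \<in> carrier A" "b \<in> carrier A" "\<phi> a = \<phi> b" for a b
  proof -
    have "\<phi> (a \<ominus>\<^bsub>A\<^esub> b) \<oplus>\<^bsub>B\<^esub> \<phi> b = \<phi> b"
      using that phi_simps(2)[of "a \<ominus>\<^bsub>A\<^esub> b" b] by (simp add: a_minus_def A.a_assoc A.l_neg)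
    then show ?thesis using that phi_simps(1) Q.R.add.r_cancel_one by simp
  qed
  \<comment> \<open>On a module killed by the kernel, the action of \<open>a\<close> depends on
    \<open>\<phi> a\<close> only. The section \<sigma> therefore satisfies all module laws although
    it is no homomorphism.\<close>
  have eq: "a \<odot>\<^bsub>L\<^esub> x = b \<odot>\<^bsub>L\<^esub> x"
    if L: "left_module A L" and k: "\<And>a x. \<lbrakk>a \<in> carrier A; \<phi> a = \<zero>\<^bsub>B\<^esub>; x \<in> carrier L\<rbrakk> \<Longrightarrow> a \<odot>\<^bsub>L\<^esub> x = \<zero>\<^bsub>L\<^esub>"
      and ab: "a \<in> carrier A" "b \<in> carrier A" "\<phi> a = \<phi> b" and x: "x \<in> carrier L"
    for L :: "('a, 'w, 'z) module_scheme" and a b x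
  proof -
    interpret L: left_module A L by fact
    have "a \<odot>\<^bsub>L\<^esub> x \<ominus>\<^bsub>L\<^esub> b \<odot>\<^bsub>L\<^esub> x = (a \<ominus>\<^bsub>A\<^esub> b) \<odot>\<^bsub>L\<^esub> x"
      using ab x by (simp add: a_minus_def L.lsmult_l_distr L.lsmult_l_minus)
    also have "\<dots> = \<zero>\<^bsub>L\<^esub>" using k[OF _ phi_diff x] ab by simp
    finally show ?thesis using L.M.minus_eq_zero_iff L.lsmult_closed ab x by blast
  qed
  have res: "left_module B (restrict_scalars \<sigma> L)"
    if L: "left_module A L" and k: "\<And>a x. \<lbrakk>a \<in> carrier A; \<phi> a = \<zero>\<^bsub>B\<^esub>; x \<in> carrier L\<rbrakk> \<Longrightarrow> a \<odot>\<^bsub>L\<^esub> x = \<zero>\<^bsub>L\<^esub>"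
    for L :: "('a, 'w, 'z) module_scheme"
  proof -
    interpret L: left_module A L by fact
    note e = eq[OF L k]
    show ?thesis
    proof (intro left_module.intro left_module_axioms.intro abelian_groupI)
      show "ring B" by (rule Q.R.ring_axioms)
      show "\<exists>y\<in>carrier (restrict_scalars \<sigma> L). y \<oplus>\<^bsub>restrict_scalars \<sigma> L\<^esub> x = \<zero>\<^bsub>restrict_scalars \<sigma> L\<^esub>"
        if "x \<in> carrier (restrict_scalars \<sigma> L)" for x
        using that by (intro bexI[of _ "\<ominus>\<^bsub>L\<^esub> x"]) (auto simp: L.M.l_neg)
      show "(a \<oplus>\<^bsub>B\<^esub> b) \<odot>\<^bsub>restrict_scalars \<sigma> L\<^esub> x =
          a \<odot>\<^bsub>restrict_scalars \<sigma> L\<^esub> x \<oplus>\<^bsub>restrict_scalars \<sigma> L\<^esub> b \<odot>\<^bsub>restrict_scalars \<sigma> L\<^esub> x"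
        if "a \<in> carrier B" "b \<in> carrier B" "x \<in> carrier (restrict_scalars \<sigma> L)" for a b x
        using that sigma e[of "\<sigma> (a \<oplus>\<^bsub>B\<^esub> b)" "\<sigma> a \<oplus>\<^bsub>A\<^esub> \<sigma> b" x]
        by (simp add: phi_simps L.lsmult_l_distr)
      show "(a \<otimes>\<^bsub>B\<^esub> b) \<odot>\<^bsub>restrict_scalars \<sigma> L\<^esub> x =
          a \<odot>\<^bsub>restrict_scalars \<sigma> L\<^esub> (b \<odot>\<^bsub>restrict_scalars \<sigma> L\<^esub> x)"
        if "a \<in> carrier B" "b \<in> carrier B" "x \<in> carrier (restrict_scalars \<sigma> L)" for a b x
        using that sigma e[of "\<sigma> (a \<otimes>\<^bsub>B\<^esub> b)" "\<sigma> a \<otimes>\<^bsub>A\<^esub> \<sigma> b" x]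
        by (simp add: phi_simps L.lsmult_assoc)
      show "\<one>\<^bsub>B\<^esub> \<odot>\<^bsub>restrict_scalars \<sigma> L\<^esub> x = x" if "x \<in> carrier (restrict_scalars \<sigma> L)" for x
        using that sigma e[of "\<sigma> \<one>\<^bsub>B\<^esub>" "\<one>\<^bsub>A\<^esub>" x] by (simp add: phi_simps L.lsmult_one)
    qed (use sigma in \<open>auto simp: L.M.a_ac L.lsmult_closed L.lsmult_r_distr\<close>)
  qed
  have p': "p \<in> lin_hom B (restrict_scalars \<sigma> M) (restrict_scalars \<sigma> N)"
    using p sigma by (intro lin_hom_restrict_scalars) auto
  have hB: "h \<in> lin_hom B Q (restrict_scalars \<sigma> N)"
  proof (rule lin_homI)
    show "h (b \<odot>\<^bsub>Q\<^esub> x) = b \<odot>\<^bsub>restrict_scalars \<sigma> N\<^esub> h x" if "b \<in> carrier B" "x \<in> carrier Q" for b x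
      using lin_homD(3)[OF h, of "\<sigma> b" x] sigma[of b] that by simp
  qed (use lin_homD[OF h] in auto)
  have "lifts_through B Q (restrict_scalars \<sigma> M) (restrict_scalars \<sigma> N) p"
    by (rule projective_lifts[OF Q res[OF M kM] res[OF N kN] p'])
  moreover have "h ` carrier Q \<subseteq> p ` carrier (restrict_scalars \<sigma> M)" using im by simp
  ultimately obtain h' where h': "h' \<in> lin_hom B Q (restrict_scalars \<sigma> M)" "\<And>x. x \<in> carrier Q \<Longrightarrow> p (h' x) = h x"
    using hB unfolding lifts_through_def by blast
  have "h' \<in> lin_hom A (restrict_scalars \<phi> Q) M"
  proof (rule lin_homI)
    show "h' (a \<odot>\<^bsub>restrict_scalars \<phi> Q\<^esub> x) = a \<odot>\<^bsub>M\<^esub> h' x"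
      if a: "a \<in> carrier A" and x: "x \<in> carrier (restrict_scalars \<phi> Q)" for a x
    proof -
      have "h' (\<phi> a \<odot>\<^bsub>Q\<^esub> x) = \<sigma> (\<phi> a) \<odot>\<^bsub>M\<^esub> h' x"
        using lin_homD(3)[OF h'(1), of "\<phi> a" x] a x phi_simps(1) by simp
      also have "\<dots> = a \<odot>\<^bsub>M\<^esub> h' x"
        by (rule eq[OF M kM]) (use a x phi_simps(1) sigma[of "\<phi> a"] lin_homD(1)[OF h'(1)] in auto)
      finally show ?thesis by simp
    qed
  qed (use lin_homD[OF h'(1)] in auto)
  then show "\<exists>h'\<in>lin_hom A (restrict_scalars \<phi> Q) M. \<forall>x\<in>carrier (restrict_scalars \<phi> Q). p (h' x) = h x"
    using h'(2) by auto
qed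

text \<open>A homotopy \<open>s\<close> gives f - g = d s + s d. On an element whose boundary lies
  in \<open>J P\<close> the last term lies in \<open>J Q\<close>, so \<open>f\<close> and
  \<open>g\<close> differ there by a boundary and an element of \<open>J Q\<close>.\<close>

lemma chain_maps_agree_mod:
  assumes P: "resolution A M P dP eP" and Q: "resolution A N Q dQ eQ"
    and N: "left_module A N"
    and lift: "\<And>i. lifts_through A (P i) (Q (Suc i)) (Q i) (dQ i)"
    and f: "\<And>i. f i \<in> lin_hom A (P i) (Q i)" and g: "\<And>i. g i \<in> lin_hom A (P i) (Q i)"
    and aug: "\<And>x. x \<in> carrier (P 0) \<Longrightarrow> eQ (f 0 x) = eQ (g 0 x)"
    and fd: "\<And>i x. x \<in> carrier (P (Suc i)) \<Longrightarrow> dQ i (f (Suc i) x) = f i (dP i x)"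
    and gd: "\<And>i x. x \<in> carrier (P (Suc i)) \<Longrightarrow> dQ i (g (Suc i) x) = g i (dP i x)"
    and J: "J \<subseteq> carrier A" and x: "x \<in> carrier (P q)"
    and cyc: "case q of 0 \<Rightarrow> True | Suc i \<Rightarrow> dP i x \<in> smult_span (P i) J"
  obtains w u where "w \<in> carrier (Q (Suc q))" "u \<in> smult_span (Q q) J"
    "f q x = dQ q w \<oplus>\<^bsub>Q q\<^esub> u \<oplus>\<^bsub>Q q\<^esub> g q x"
proof -
  note PD = resolutionD[OF P] and QD = resolutionD[OF Q]
  note ab = left_module_abelian_group[OF QD(1)]
  define h where "h i x = f i x \<ominus>\<^bsub>Q i\<^esub> g i x" for i x
  have h: "h i \<in> lin_hom A (P i) (Q i)" for i
    unfolding h_def[abs_def] by (rule lin_hom_sub[OF f g PD(1) QD(1)])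
  have h0: "eQ (h 0 y) = \<zero>\<^bsub>N\<^esub>" if "y \<in> carrier (P 0)" for y
    using lin_hom_diff[OF QD(3) ab left_module_abelian_group[OF N]] aug[OF that]
      lin_homD(1)[OF f that] lin_homD(1)[OF g that] lin_homD(1)[OF QD(3)]
      abelian_group.minus_eq_zero_iff[OF left_module_abelian_group[OF N]]
    by (simp add: h_def)
  have hd: "dQ i (h (Suc i) y) = h i (dP i y)" if "y \<in> carrier (P (Suc i))" for i y
    using lin_hom_diff[OF QD(2) ab ab lin_homD(1)[OF f that] lin_homD(1)[OF g that]] fd[OF that] gd[OF that]
    by (simp add: h_def)
  obtain s where s: "\<And>i. s i \<in> lin_hom A (P i) (Q (Suc i))"
    "\<And>x. x \<in> carrier (P 0) \<Longrightarrow> h 0 x = dQ 0 (s 0 x)"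
    "\<And>i x. x \<in> carrier (P (Suc i)) \<Longrightarrow> h (Suc i) x = dQ (Suc i) (s (Suc i) x) \<oplus>\<^bsub>Q (Suc i)\<^esub> s i (dP i x)"
    using null_homotopy_exists[OF P Q lift h h0 hd] by blast
  interpret Qq: abelian_group "Q q" by (rule ab)
  have sx: "s q x \<in> carrier (Q (Suc q))" by (rule lin_homD(1)[OF s(1) x])
  have "\<exists>u\<in>smult_span (Q q) J. h q x = dQ q (s q x) \<oplus>\<^bsub>Q q\<^esub> u"
  proof (cases q)
    case 0
    then have "h q x = dQ q (s q x) \<oplus>\<^bsub>Q q\<^esub> \<zero>\<^bsub>Q q\<^esub>"
      using s(2) x Qq.r_zero[OF lin_homD(1)[OF QD(2) sx]] by simp
    then show ?thesis using smult_span.zero by blast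
  next
    case (Suc i)
    then show ?thesis
      using s(3)[of x i] x cyc smult_span_hom[OF PD(1) QD(1) s(1) J, of "dP i x" i] by auto
  qed
  then obtain u where u: "u \<in> smult_span (Q q) J" "h q x = dQ q (s q x) \<oplus>\<^bsub>Q q\<^esub> u" by blast
  have "f q x = h q x \<oplus>\<^bsub>Q q\<^esub> g q x"
    using lin_homD(1)[OF f x] lin_homD(1)[OF g x] by (simp add: h_def a_minus_def Qq.a_assoc Qq.l_neg)
  then show thesis using that[OF sx u(1)] u(2) by simp
qed

theorem Tor_change_of_rings:
  fixes A :: "('k, 'a, 'y) module_scheme" and B :: "('k, 'b, 'z) module_scheme"
    and P :: "nat \<Rightarrow> ('a, 'p, 'u) module_scheme" and Q :: "nat \<Rightarrow> ('b, 'q, 'v) module_scheme"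
  assumes A: "augmented_algebra k A \<epsilon>" and B: "augmented_algebra k B \<epsilon>'"
    and phi: "\<phi> \<in> ring_hom A B" "\<phi> ` carrier A = carrier B"
    and phi_aug: "\<And>a. a \<in> carrier A \<Longrightarrow> \<epsilon>' (\<phi> a) = \<epsilon> a"
    and phi_unit: "\<And>r. r \<in> carrier k \<Longrightarrow> \<phi> (r \<odot>\<^bsub>A\<^esub> \<one>\<^bsub>A\<^esub>) = r \<odot>\<^bsub>B\<^esub> \<one>\<^bsub>B\<^esub>"
    and P: "projective_resolution A (aug_module k \<epsilon>) P d e"
    and Q: "projective_resolution B (aug_module k \<epsilon>') Q d' e'"
    and acyclic: "\<And>q y. \<lbrakk>y \<in> smult_span (P q) {a \<in> carrier A. \<phi> a = \<zero>\<^bsub>B\<^esub>};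
        case q of 0 \<Rightarrow> True | Suc i \<Rightarrow> d i y = \<zero>\<^bsub>P i\<^esub>\<rbrakk> \<Longrightarrow>
      \<exists>w\<in>smult_span (P (Suc q)) {a \<in> carrier A. \<phi> a = \<zero>\<^bsub>B\<^esub>}. d q w = y"
  shows "module_isomorphic k (Tor k A (aug_module k \<epsilon>) P d q) (Tor k B (aug_module k \<epsilon>') Q d' q)"
proof -
  interpret A: augmented_algebra k A \<epsilon> by fact
  interpret B: augmented_algebra k B \<epsilon>' by fact
  let ?I = "{a \<in> carrier A. \<phi> a = \<zero>\<^bsub>B\<^esub>}"
  let ?T = "aug_module k \<epsilon>"
  note phi_simps = ring_hom_closed[OF phi(1)] ring_hom_add[OF phi(1)] ring_hom_mult[OF phi(1)] ring_hom_one[OF phi(1)]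
  have resP: "resolution A ?T P d e" and projP: "\<And>i. projective A (P i)"
    using P by (auto simp: projective_resolution_iff)
  have resQ: "resolution B (aug_module k \<epsilon>') Q d' e'" and projQ: "\<And>i. projective B (Q i)"
    using Q by (auto simp: projective_resolution_iff)
  note PD = resolutionD[OF resP] and QD = resolutionD[OF resQ]
  note abP = left_module_abelian_group[OF PD(1)]
  have T: "left_module A ?T" by (rule left_module_aug_module[OF resP A.k.is_cring])
  note abT = left_module_abelian_group[OF T]
  \<comment> \<open>Along \<open>\<phi>\<close> the modules \<open>Q i\<close> form a resolution of
    the same trivial module over \<open>A\<close>: exactness does not depend on the ring, and the
    two augmentations are compatible with \<open>\<phi>\<close>.\<close>
  let ?Q = "\<lambda>i. restrict_scalars \<phi> (Q i)"
  have QA: "left_module A (?Q i)" for i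
    by (rule left_module_restrict_scalars[OF QD(1) A.A.ring_axioms phi(1)])
  have resQA: "resolution A ?T ?Q d' e'"
    unfolding resolution_def
  proof (intro conjI allI)
    show "left_module A (?Q i)" for i by (rule QA)
    show "d' i \<in> lin_hom A (?Q (Suc i)) (?Q i)" for i
      using QD(2)[of i] phi_simps(1) by (intro lin_hom_restrict_scalars) auto
    show "e' \<in> lin_hom A (?Q 0) ?T"
      using lin_homD[OF QD(3)] phi_simps(1) phi_aug by (intro lin_homI) auto
  qed (use resQ in \<open>auto simp: resolution_def\<close>)
  note QAD = resolutionD[OF resQA]
  have eps_I: "\<epsilon> a = \<zero>\<^bsub>k\<^esub>" if "a \<in> ?I" for a
  proof -
    have "\<epsilon>' \<zero>\<^bsub>B\<^esub> \<oplus>\<^bsub>k\<^esub> \<epsilon>' \<zero>\<^bsub>B\<^esub> = \<epsilon>' \<zero>\<^bsub>B\<^esub>"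
      using B.aug_simps(2)[of "\<zero>\<^bsub>B\<^esub>" "\<zero>\<^bsub>B\<^esub>"] by simp
    then have "\<epsilon>' \<zero>\<^bsub>B\<^esub> = \<zero>\<^bsub>k\<^esub>" using B.aug_simps(1)[of "\<zero>\<^bsub>B\<^esub>"] A.k.add.l_cancel_one by simp
    then show ?thesis using phi_aug that by force
  qed
  have I_sub: "?I \<subseteq> carrier A" by auto
  have I_ideal: "b \<otimes>\<^bsub>A\<^esub> a \<in> ?I" if "a \<in> ?I" "b \<in> carrier A" for a b
    using that phi_simps by simp
  define W where "W i = smult_span (P i) ?I" for i
  have W: "submodule (W i) A (P i)" for i
    unfolding W_def by (rule left_module.smult_span_submodule[OF PD(1) I_sub I_ideal])
  define Y where "Y i = quot_module (P i) (W i)" for i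
  have Y: "left_module A (Y i)" for i unfolding Y_def by (rule left_module_quot[OF PD(1) W])
  note abY = left_module_abelian_group[OF Y]
  define \<pi> where "\<pi> i x = W i +>\<^bsub>P i\<^esub> x" for i x
  have pi: "\<pi> i \<in> lin_hom A (P i) (Y i)" for i
    unfolding Y_def \<pi>_def[abs_def] by (rule quot_proj_hom[OF PD(1) W])
  have pi_onto: "\<exists>x\<in>carrier (P i). y = \<pi> i x" if "y \<in> carrier (Y i)" for i y
    using that quot_carrier[OF PD(1) W] by (auto simp: Y_def \<pi>_def)
  have pi_eq: "\<pi> i x = \<pi> i y \<longleftrightarrow> x \<ominus>\<^bsub>P i\<^esub> y \<in> W i" if "x \<in> carrier (P i)" "y \<in> carrier (P i)" for i x y
    unfolding \<pi>_def by (rule quot_eq_iff[OF PD(1) W that])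
  have pi_zero: "\<pi> i x = \<zero>\<^bsub>Y i\<^esub> \<longleftrightarrow> x \<in> W i" if "x \<in> carrier (P i)" for i x
    unfolding \<pi>_def Y_def by (rule quot_eq_zero_iff[OF PD(1) W that])
  have dW: "d i x \<in> W i" if "x \<in> W (Suc i)" for i x
    using smult_span_hom[OF PD(1) PD(1) PD(2) I_sub] that by (simp add: W_def)
  have WP: "x \<in> carrier (P i)" if "x \<in> W i" for i x using submoduleD(1)[OF W] that by auto
  have eW: "e x = \<zero>\<^bsub>k\<^esub>" if "x \<in> W 0" for x
  proof -
    have "x \<in> {x \<in> carrier (P 0). e x = \<zero>\<^bsub>k\<^esub>}"
      using that unfolding W_def
    proof (rule smult_span_least)
      interpret P0: left_module A "P 0" by (rule PD)
      show "\<zero>\<^bsub>P 0\<^esub> \<in> {x \<in> carrier (P 0). e x = \<zero>\<^bsub>k\<^esub>}" using lin_hom_zero[OF PD(3) abP abT] by simp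
      show "x \<oplus>\<^bsub>P 0\<^esub> y \<in> {x \<in> carrier (P 0). e x = \<zero>\<^bsub>k\<^esub>}"
        if "x \<in> {x \<in> carrier (P 0). e x = \<zero>\<^bsub>k\<^esub>}" "y \<in> {x \<in> carrier (P 0). e x = \<zero>\<^bsub>k\<^esub>}" for x y
        using that lin_homD(2)[OF PD(3)] by simp
      show "a \<odot>\<^bsub>P 0\<^esub> x \<in> {x \<in> carrier (P 0). e x = \<zero>\<^bsub>k\<^esub>}" if "a \<in> ?I" "x \<in> carrier (P 0)" for a x
        using that eps_I[OF that(1)] lin_homD(1)[OF PD(3) that(2)] lin_homD(3)[OF PD(3), of a x]
        by (simp add: P0.lsmult_closed)
    qed
    then show ?thesis by simp
  qed
  have "\<exists>h. h \<in> lin_hom A (Y (Suc i)) (Y i) \<and> (\<forall>x\<in>carrier (P (Suc i)). h (\<pi> (Suc i) x) = \<pi> i (d i x))" for i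
  proof -
    have "(\<pi> i \<circ> d i) x = \<zero>\<^bsub>Y i\<^esub>" if "x \<in> W (Suc i)" for x
      using pi_zero[OF WP[OF dW[OF that]]] dW[OF that] by simp
    then show ?thesis
      using quot_lift_hom[OF PD(1) Y W lin_hom_comp[OF PD(2) pi]] unfolding Y_def \<pi>_def comp_apply by metis
  qed
  then obtain dY where dY: "\<And>i. dY i \<in> lin_hom A (Y (Suc i)) (Y i)"
    "\<And>i x. x \<in> carrier (P (Suc i)) \<Longrightarrow> dY i (\<pi> (Suc i) x) = \<pi> i (d i x)" by metis
  obtain eY where eY: "eY \<in> lin_hom A (Y 0) ?T" "\<And>x. x \<in> carrier (P 0) \<Longrightarrow> eY (\<pi> 0 x) = e x"
    using quot_lift_hom[OF PD(1) T W PD(3)] eW unfolding Y_def \<pi>_def aug_module_simps by metis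
  have resY: "resolution A ?T Y dY eY"
    unfolding resolution_def
  proof (intro conjI allI)
    show "left_module A (Y i)" for i by (rule Y)
    show "dY i \<in> lin_hom A (Y (Suc i)) (Y i)" for i by (rule dY)
    show "eY \<in> lin_hom A (Y 0) ?T" by (rule eY)
    show "eY ` carrier (Y 0) = carrier ?T"
    proof
      show "eY ` carrier (Y 0) \<subseteq> carrier ?T" using lin_homD(1)[OF eY(1)] by blast
      show "carrier ?T \<subseteq> eY ` carrier (Y 0)"
      proof
        fix t assume "t \<in> carrier ?T"
        then obtain x where x: "x \<in> carrier (P 0)" "t = e x" using PD(4) by blast
        then show "t \<in> eY ` carrier (Y 0)" using eY(2)[OF x(1)] lin_homD(1)[OF pi x(1)] by force
      qed
    qed
    show "dY 0 ` carrier (Y (Suc 0)) = {y \<in> carrier (Y 0). eY y = \<zero>\<^bsub>?T\<^esub>}"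
    proof (intro equalityI subsetI)
      fix y assume "y \<in> dY 0 ` carrier (Y (Suc 0))"
      then obtain x where x: "x \<in> carrier (P (Suc 0))" "y = dY 0 (\<pi> (Suc 0) x)" using pi_onto by blast
      then have "y = \<pi> 0 (d 0 x)" using dY(2) by simp
      then show "y \<in> {y \<in> carrier (Y 0). eY y = \<zero>\<^bsub>?T\<^esub>}"
        using eY(2) lin_homD(1)[OF PD(2) x(1)] PD(5) x(1) lin_homD(1)[OF pi] by simp
    next
      fix y assume y: "y \<in> {y \<in> carrier (Y 0). eY y = \<zero>\<^bsub>?T\<^esub>}"
      then obtain x where x: "x \<in> carrier (P 0)" "y = \<pi> 0 x" using pi_onto by blast
      then have "e x = \<zero>\<^bsub>?T\<^esub>" using eY(2) y by simp
      then obtain w where w: "w \<in> carrier (P (Suc 0))" "x = d 0 w" using PD(7) x(1) by blast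
      then show "y \<in> dY 0 ` carrier (Y (Suc 0))"
        using dY(2)[OF w(1)] x(2) lin_homD(1)[OF pi w(1)] by (metis imageI)
    qed
    fix i
    show "dY (Suc i) ` carrier (Y (Suc (Suc i))) = {y \<in> carrier (Y (Suc i)). dY i y = \<zero>\<^bsub>Y i\<^esub>}"
    proof (intro equalityI subsetI)
      fix y assume "y \<in> dY (Suc i) ` carrier (Y (Suc (Suc i)))"
      then obtain x where x: "x \<in> carrier (P (Suc (Suc i)))" "y = dY (Suc i) (\<pi> (Suc (Suc i)) x)"
        using pi_onto by blast
      then have y: "y = \<pi> (Suc i) (d (Suc i) x)" using dY(2) by simp
      have dx: "d (Suc i) x \<in> carrier (P (Suc i))" by (rule lin_homD(1)[OF PD(2) x(1)])
      have "dY i y = \<pi> i \<zero>\<^bsub>P i\<^esub>" unfolding y dY(2)[OF dx] PD(6)[OF x(1)] ..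
      then show "y \<in> {y \<in> carrier (Y (Suc i)). dY i y = \<zero>\<^bsub>Y i\<^esub>}"
        using y lin_homD(1)[OF pi dx] lin_hom_zero[OF pi abP abY] by simp
    next
      fix y assume y: "y \<in> {y \<in> carrier (Y (Suc i)). dY i y = \<zero>\<^bsub>Y i\<^esub>}"
      then obtain x where x: "x \<in> carrier (P (Suc i))" "y = \<pi> (Suc i) x" using pi_onto by blast
      have dx: "d i x \<in> carrier (P i)" by (rule lin_homD(1)[OF PD(2) x(1)])
      \<comment> \<open>The boundary of a lift \<open>x\<close> of a cycle of \<open>Y\<close> is a
        cycle of \<open>W\<close>, hence by acyclicity the boundary of some \<open>w\<close> in
        \<open>W\<close>. Then \<open>x - w\<close> is a genuine cycle of \<open>P\<close> with the
        same image in \<open>Y\<close>. For i = 0 this uses that all of \<open>W 0\<close> consists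
        of boundaries.\<close>
      have "d i x \<in> W i" using y x dY(2)[OF x(1)] pi_zero[OF dx] by simp
      moreover have "case i of 0 \<Rightarrow> True | Suc j \<Rightarrow> d j (d i x) = \<zero>\<^bsub>P j\<^esub>"
        using PD(6) x(1) by (cases i) auto
      ultimately obtain w where w: "w \<in> W (Suc i)" "d i w = d i x"
        using acyclic[of "d i x" i] unfolding W_def by blast
      interpret Pi: abelian_group "P (Suc i)" by (rule abP)
      have xw: "x \<ominus>\<^bsub>P (Suc i)\<^esub> w \<in> carrier (P (Suc i))" using x(1) WP[OF w(1)] by simp
      have "d i (x \<ominus>\<^bsub>P (Suc i)\<^esub> w) = \<zero>\<^bsub>P i\<^esub>"
        using lin_hom_diff[OF PD(2) abP abP x(1) WP[OF w(1)]] w(2) dx abelian_group.minus_eq_zero_iff[OF abP] by simp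
      then obtain z where z: "z \<in> carrier (P (Suc (Suc i)))" "x \<ominus>\<^bsub>P (Suc i)\<^esub> w = d (Suc i) z"
        using PD(8)[OF xw] by blast
      have "x \<ominus>\<^bsub>P (Suc i)\<^esub> (x \<ominus>\<^bsub>P (Suc i)\<^esub> w) = w"
        using x(1) WP[OF w(1)] by (simp add: a_minus_def Pi.minus_add Pi.a_assoc[symmetric] Pi.r_neg)
      then have "\<pi> (Suc i) x = \<pi> (Suc i) (d (Suc i) z)"
        using pi_eq[OF x(1) xw] w(1) z(2) by simp
      then show "y \<in> dY (Suc i) ` carrier (Y (Suc (Suc i)))"
        using dY(2)[OF z(1)] x(2) lin_homD(1)[OF pi z(1)] by (metis imageI)
    qed
  qed
  note YD = resolutionD[OF resY]
  have kQ: "a \<odot>\<^bsub>?Q i\<^esub> x = \<zero>\<^bsub>?Q i\<^esub>" if "a \<in> carrier A" "\<phi> a = \<zero>\<^bsub>B\<^esub>" "x \<in> carrier (?Q i)" for a x i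
    using that left_module.lsmult_l_null[OF QD(1)] by simp
  have kY: "a \<odot>\<^bsub>Y i\<^esub> y = \<zero>\<^bsub>Y i\<^esub>" if a: "a \<in> carrier A" "\<phi> a = \<zero>\<^bsub>B\<^esub>" "y \<in> carrier (Y i)" for a y i
  proof -
    obtain x where x: "x \<in> carrier (P i)" "y = \<pi> i x" using pi_onto a(3) by blast
    have ax: "a \<odot>\<^bsub>P i\<^esub> x \<in> W i"
      unfolding W_def using left_module.smult_span_base[OF PD(1) I_sub] a x by simp
    have "a \<odot>\<^bsub>Y i\<^esub> \<pi> i x = \<pi> i (a \<odot>\<^bsub>P i\<^esub> x)" using lin_homD(3)[OF pi a(1) x(1)] by simp
    then show ?thesis using pi_zero[OF WP[OF ax]] ax x(2) by simp
  qed
  have kT: "a \<odot>\<^bsub>?T\<^esub> t = \<zero>\<^bsub>?T\<^esub>" if "a \<in> carrier A" "\<phi> a = \<zero>\<^bsub>B\<^esub>" "t \<in> carrier ?T" for a t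
    using that eps_I[of a] by simp
  obtain f where f: "\<And>i. f i \<in> lin_hom A (P i) (?Q i)"
    "\<And>x. x \<in> carrier (P 0) \<Longrightarrow> e' (f 0 x) = e x"
    "\<And>i x. x \<in> carrier (P (Suc i)) \<Longrightarrow> d' i (f (Suc i) x) = f i (d i x)"
    by (rule chain_map_exists[OF resP resQA projective_lifts[OF projP QA T QAD(3)]
          projective_lifts[OF projP QA QA QAD(2)]]) (rule that)
  \<comment> \<open>The kernel of \<open>\<phi>\<close> annihilates \<open>Y\<close>,
    \<open>Q\<close> and the trivial module, so maps out of the restricted \<open>Q i\<close> lift
    here even if these are not projective over \<open>A\<close>.\<close>
  have lift_QT: "lifts_through A (?Q i) (Y 0) ?T eY" for i
    by (rule restrict_scalars_lifts[OF phi projQ Y T YD(3)]) (rule kY kT; assumption)+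
  have lift_QY: "lifts_through A (?Q i) (Y (Suc j)) (Y j) (dY j)" for i j
    by (rule restrict_scalars_lifts[OF phi projQ Y Y YD(2)]) (rule kY; assumption)+
  have lift_QQ: "lifts_through A (?Q i) (?Q (Suc j)) (?Q j) (d' j)" for i j
    by (rule restrict_scalars_lifts[OF phi projQ QA QA QAD(2)]) (rule kQ; assumption)+
  obtain g where g: "\<And>i. g i \<in> lin_hom A (?Q i) (Y i)"
    "\<And>x. x \<in> carrier (?Q 0) \<Longrightarrow> eY (g 0 x) = e' x"
    "\<And>i x. x \<in> carrier (?Q (Suc i)) \<Longrightarrow> dY i (g (Suc i) x) = g i (d' i x)"
    by (rule chain_map_exists[OF resQA resY lift_QT lift_QY]) (rule that)
  have fW: "f i x = \<zero>\<^bsub>?Q i\<^esub>" if "x \<in> W i" for i x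
  proof -
    interpret Qi: left_module A "?Q i" by (rule QA)
    have "f i x \<in> smult_span (?Q i) ?I" using smult_span_hom[OF PD(1) QA f(1) I_sub] that by (simp add: W_def)
    then have "f i x \<in> {\<zero>\<^bsub>?Q i\<^esub>}"
      by (rule smult_span_least) (use kQ Qi.M.r_zero[OF Qi.M.zero_closed] in auto)
    then show ?thesis by simp
  qed
  \<comment> \<open>As \<open>f\<close> kills \<open>W\<close>, it descends to a map
    \<open>f'\<close> on \<open>Y\<close>, which can be composed with \<open>g\<close> to an
    endomorphism of \<open>Q\<close>.\<close>
  have "\<exists>h. h \<in> lin_hom A (Y i) (?Q i) \<and> (\<forall>x\<in>carrier (P i). h (\<pi> i x) = f i x)" for i
    using quot_lift_hom[OF PD(1) QA W f(1) fW] unfolding Y_def \<pi>_def by metis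
  then obtain f' where f': "\<And>i. f' i \<in> lin_hom A (Y i) (?Q i)"
    "\<And>i x. x \<in> carrier (P i) \<Longrightarrow> f' i (\<pi> i x) = f i x" by metis
  let ?K = "A.aug_ideal"
  have K: "?K \<subseteq> carrier A" by (rule A.aug_ideal_subset)
  \<comment> \<open>\<open>\<phi>\<close> maps the augmentation ideal of \<open>A\<close> onto that
    of \<open>B\<close>, so both rings single out the same elements of \<open>Q i\<close>.\<close>
  have spanQ: "smult_span (?Q i) ?K = B.aug_span (Q i)" for i
  proof (intro equalityI subsetI)
    show "u \<in> B.aug_span (Q i)" if "u \<in> smult_span (?Q i) ?K" for u
      using that
    proof induction
      case zero then show ?case by (simp add: B.aug_span_def smult_span.zero)
    next
      case (add a x u)
      have "\<phi> a \<in> B.aug_ideal" using add.hyps(1) phi_simps(1) phi_aug by (auto simp: A.aug_ideal_def B.aug_ideal_def)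
      then show ?case using add by (simp add: B.aug_span_def smult_span.add)
    qed
    show "u \<in> smult_span (?Q i) ?K" if "u \<in> B.aug_span (Q i)" for u
      using that unfolding B.aug_span_def
    proof induction
      case zero then show ?case using smult_span.zero[of "?Q i" ?K] by simp
    next
      case (add b x u)
      have "b \<in> \<phi> ` carrier A" using add.hyps(1) phi(2) by (simp add: B.aug_ideal_def)
      then obtain a where a: "a \<in> carrier A" "b = \<phi> a" by blast
      then have "a \<in> ?K" using add.hyps(1) phi_aug by (auto simp: A.aug_ideal_def B.aug_ideal_def)
      then show ?case using smult_span.add[of a ?K x "?Q i" u] add a by simp
    qed
  qed
  \<comment> \<open>The kernel \<open>W\<close> of the projection lies in \<open>aug_span\<close>,
    because \<open>?I\<close> is contained in the augmentation ideal. Membership can therefore be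
    tested in \<open>Y\<close>.\<close>
  have span_pi: "x \<in> A.aug_span (P i)" if x: "x \<in> carrier (P i)" and px: "\<pi> i x \<in> smult_span (Y i) ?K" for i x
  proof -
    interpret Pi: left_module A "P i" by (rule PD)
    note Ki = submoduleD[OF A.aug_span_submodule[OF PD(1)[of i]]]
    have KP: "u \<in> carrier (P i)" if "u \<in> A.aug_span (P i)" for u using Ki(1) that by auto
    have "\<pi> i x \<in> \<pi> i ` A.aug_span (P i)"
      using px
    proof (rule smult_span_least)
      show "\<zero>\<^bsub>Y i\<^esub> \<in> \<pi> i ` A.aug_span (P i)"
        using lin_hom_zero[OF pi abP abY] Ki(2) by (metis imageI)
      show "y \<oplus>\<^bsub>Y i\<^esub> z \<in> \<pi> i ` A.aug_span (P i)"
        if yz: "y \<in> \<pi> i ` A.aug_span (P i)" "z \<in> \<pi> i ` A.aug_span (P i)" for y z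
      proof -
        obtain u v where "u \<in> A.aug_span (P i)" "v \<in> A.aug_span (P i)" "y = \<pi> i u" "z = \<pi> i v" using yz by blast
        then show ?thesis using lin_homD(2)[OF pi KP KP, of u v] Ki(3)[of u v] by (metis imageI)
      qed
      show "a \<odot>\<^bsub>Y i\<^esub> y \<in> \<pi> i ` A.aug_span (P i)" if a: "a \<in> ?K" and y: "y \<in> carrier (Y i)" for a y
      proof -
        obtain u where u: "u \<in> carrier (P i)" "y = \<pi> i u" using pi_onto[OF y] by blast
        have "a \<odot>\<^bsub>P i\<^esub> u \<in> A.aug_span (P i)"
          unfolding A.aug_span_def using Pi.smult_span_base[OF K a u(1)] .
        moreover have "a \<in> carrier A" using a K by auto
        ultimately show ?thesis using lin_homD(3)[OF pi _ u(1), of a] u(2) by (metis imageI)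
      qed
    qed
    then obtain u where u: "u \<in> A.aug_span (P i)" "\<pi> i x = \<pi> i u" by blast
    have "x \<ominus>\<^bsub>P i\<^esub> u \<in> W i" using u pi_eq[OF x KP[OF u(1)]] by simp
    moreover have "?I \<subseteq> ?K" using eps_I by (auto simp: A.aug_ideal_def)
    ultimately have "x \<ominus>\<^bsub>P i\<^esub> u \<in> A.aug_span (P i)"
      using smult_span_mono[of ?I ?K "P i"] by (auto simp: W_def A.aug_span_def)
    then have "x \<ominus>\<^bsub>P i\<^esub> u \<oplus>\<^bsub>P i\<^esub> u \<in> A.aug_span (P i)" using Ki(3) u(1) by blast
    then show ?thesis using x KP[OF u(1)] by (simp add: a_minus_def Pi.M.a_assoc Pi.M.l_neg)
  qed
  have cyc_f: "f q x \<in> B.cycles Q d' q" if x: "x \<in> A.cycles P d q" for x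
  proof (cases q)
    case 0
    then show ?thesis using x lin_homD(1)[OF f(1)] by (auto simp: A.cycles_def B.cycles_def)
  next
    case (Suc i)
    then have xP: "x \<in> carrier (P (Suc i))" and dx: "d i x \<in> smult_span (P i) ?K"
      using x by (auto simp: A.cycles_def A.aug_span_def)
    have "f i (d i x) \<in> B.aug_span (Q i)"
      using smult_span_hom[OF PD(1) QA f(1) K dx] by (simp add: spanQ)
    then show ?thesis using Suc f(3)[OF xP] lin_homD(1)[OF f(1) xP] by (simp add: B.cycles_def)
  qed
  obtain \<rho> where rho: "left_module k (Tor k A ?T P d q)"
    "\<rho> \<in> lin_hom k (A.scalars (P q)\<lparr>carrier := A.cycles P d q\<rparr>) (Tor k A ?T P d q)"
    "\<rho> ` A.cycles P d q = carrier (Tor k A ?T P d q)"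
    "\<And>x. x \<in> A.cycles P d q \<Longrightarrow> \<rho> x = \<zero>\<^bsub>Tor k A ?T P d q\<^esub> \<longleftrightarrow>
      (\<exists>w\<in>carrier (P (Suc q)). x \<ominus>\<^bsub>P q\<^esub> d q w \<in> A.aug_span (P q))"
    by (rule A.Tor_presentation[of P d q, OF PD(1,2)]) (rule PD(6), assumption, rule that)
  let ?TB = "Tor k B (aug_module k \<epsilon>') Q d' q"
  obtain \<rho>' where rho': "left_module k ?TB"
    "\<rho>' \<in> lin_hom k (B.scalars (Q q)\<lparr>carrier := B.cycles Q d' q\<rparr>) ?TB"
    "\<rho>' ` B.cycles Q d' q = carrier ?TB"
    "\<And>x. x \<in> B.cycles Q d' q \<Longrightarrow> \<rho>' x = \<zero>\<^bsub>?TB\<^esub> \<longleftrightarrow>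
      (\<exists>w\<in>carrier (Q (Suc q)). x \<ominus>\<^bsub>Q q\<^esub> d' q w \<in> B.aug_span (Q q))"
    by (rule B.Tor_presentation[of Q d' q, OF QD(1,2)]) (rule QD(6), assumption, rule that)
  let ?L = "A.scalars (P q)\<lparr>carrier := A.cycles P d q\<rparr>"
  have L: "left_module k ?L"
    by (rule left_module_submodule[OF A.left_module_scalars[OF PD(1)] A.cycles_submodule[of P d, OF PD(1,2)]])
  have fhom: "f q \<in> lin_hom k ?L (B.scalars (Q q)\<lparr>carrier := B.cycles Q d' q\<rparr>)"
  proof (rule lin_homI)
    have cP: "x \<in> carrier (P q)" if "x \<in> A.cycles P d q" for x using that by (simp add: A.cycles_def)
    show "f q x \<in> carrier (B.scalars (Q q)\<lparr>carrier := B.cycles Q d' q\<rparr>)" if "x \<in> carrier ?L" for x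
      using that cyc_f by simp
    show "f q (x \<oplus>\<^bsub>?L\<^esub> y) = f q x \<oplus>\<^bsub>B.scalars (Q q)\<lparr>carrier := B.cycles Q d' q\<rparr>\<^esub> f q y"
      if "x \<in> carrier ?L" "y \<in> carrier ?L" for x y
      using that lin_homD(2)[OF f(1) cP cP] by simp
    show "f q (r \<odot>\<^bsub>?L\<^esub> x) = r \<odot>\<^bsub>B.scalars (Q q)\<lparr>carrier := B.cycles Q d' q\<rparr>\<^esub> f q x"
      if "r \<in> carrier k" "x \<in> carrier ?L" for r x
      using that lin_homD(3)[OF f(1) _ cP, of "A.unit r" x] A.unit_simps(1)[of r] phi_unit
      by (simp add: A.unit_def B.unit_def)
  qed
  \<comment> \<open>Tor over \<open>A\<close> is presented by \<open>\<rho>\<close>, Tor over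
    \<open>B\<close> by \<open>\<rho>'\<close> after \<open>f q\<close>, both on the cycles of
    \<open>P\<close>. It remains to see that the kernels agree and that the second map is
    onto.\<close>
  show ?thesis
  proof (rule iso_of_same_kernel[OF L rho(1) rho'(1) rho(2) _ lin_hom_comp[OF fhom rho'(2)]])
    show "\<rho> ` carrier ?L = carrier (Tor k A ?T P d q)" using rho(3) by simp
    show "\<rho> x = \<zero>\<^bsub>Tor k A ?T P d q\<^esub> \<longleftrightarrow> (\<rho>' \<circ> f q) x = \<zero>\<^bsub>?TB\<^esub>" if x: "x \<in> carrier ?L" for x
    proof -
      have xc: "x \<in> A.cycles P d q" and xP: "x \<in> carrier (P q)" using x by (auto simp: A.cycles_def)
      interpret Yq: left_module A "Y q" by (rule Y)
      interpret Qq: left_module A "?Q q" by (rule QA)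
      have fx: "f q x \<in> carrier (?Q q)" by (rule lin_homD(1)[OF f(1) xP])
      have "(\<exists>w\<in>carrier (P (Suc q)). x \<ominus>\<^bsub>P q\<^esub> d q w \<in> A.aug_span (P q)) \<longleftrightarrow>
          (\<exists>w\<in>carrier (Q (Suc q)). f q x \<ominus>\<^bsub>Q q\<^esub> d' q w \<in> B.aug_span (Q q))"
      proof (intro iffI; elim bexE)
        fix w assume w: "w \<in> carrier (P (Suc q))" and "x \<ominus>\<^bsub>P q\<^esub> d q w \<in> A.aug_span (P q)"
        then have "f q (x \<ominus>\<^bsub>P q\<^esub> d q w) \<in> B.aug_span (Q q)"
          using smult_span_hom[OF PD(1) QA f(1) K] by (simp add: A.aug_span_def spanQ)
        moreover have "f q (x \<ominus>\<^bsub>P q\<^esub> d q w) = f q x \<ominus>\<^bsub>Q q\<^esub> d' q (f (Suc q) w)"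
          using lin_hom_diff[OF f(1) abP Qq.M.abelian_group_axioms xP lin_homD(1)[OF PD(2) w]] f(3)[OF w] by simp
        moreover have "f (Suc q) w \<in> carrier (Q (Suc q))" using lin_homD(1)[OF f(1) w] by simp
        ultimately show "\<exists>w\<in>carrier (Q (Suc q)). f q x \<ominus>\<^bsub>Q q\<^esub> d' q w \<in> B.aug_span (Q q)" by auto
      next
        fix w assume w': "w \<in> carrier (Q (Suc q))" and fw: "f q x \<ominus>\<^bsub>Q q\<^esub> d' q w \<in> B.aug_span (Q q)"
        have w: "w \<in> carrier (?Q (Suc q))" using w' by simp
        define u where "u = f q x \<ominus>\<^bsub>Q q\<^esub> d' q w"
        have u: "u \<in> smult_span (?Q q) ?K" using fw by (simp add: u_def spanQ)
        have uQ: "u \<in> carrier (?Q q)" by (rule Qq.smult_span_closed[OF K u])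
        have dw: "d' q w \<in> carrier (?Q q)" by (rule lin_homD(1)[OF QAD(2) w])
        have fx_eq: "f q x = u \<oplus>\<^bsub>?Q q\<^esub> d' q w"
        proof -
          interpret QB: left_module B "Q q" by (rule QD)
          show ?thesis using fx dw by (simp add: u_def a_minus_def QB.M.a_assoc QB.M.l_neg)
        qed
        \<comment> \<open>The projection \<open>\<pi>\<close> and the composite of \<open>f\<close>
          and \<open>g\<close> are two chain maps from \<open>P\<close> to \<open>Y\<close> over the
          identity of the trivial module. At \<open>x\<close> they agree up to a boundary and an
          element of the augmentation span, while \<open>g\<close> carries the given relation for
          \<open>f q x\<close> into \<open>Y\<close>.\<close>
        obtain v k' where v: "v \<in> carrier (Y (Suc q))" and k': "k' \<in> smult_span (Y q) ?K"
          and eq: "\<pi> q x = dY q v \<oplus>\<^bsub>Y q\<^esub> k' \<oplus>\<^bsub>Y q\<^esub> (g q \<circ> f q) x"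
        proof (rule chain_maps_agree_mod[OF resP resY T projective_lifts[OF projP Y Y YD(2)] pi
              lin_hom_comp[OF f(1) g(1)] _ _ _ K xP])
          show "eY (\<pi> 0 y) = eY ((g 0 \<circ> f 0) y)" if "y \<in> carrier (P 0)" for y
            using that eY(2) f(2) g(2) lin_homD(1)[OF f(1) that] by simp
          show "dY i (\<pi> (Suc i) y) = \<pi> i (d i y)" if "y \<in> carrier (P (Suc i))" for i y by (rule dY(2)[OF that])
          show "dY i ((g (Suc i) \<circ> f (Suc i)) y) = (g i \<circ> f i) (d i y)" if "y \<in> carrier (P (Suc i))" for i y
            using g(3)[OF lin_homD(1)[OF f(1) that]] f(3)[OF that] by simp
          show "case q of 0 \<Rightarrow> True | Suc i \<Rightarrow> d i x \<in> smult_span (P i) ?K"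
            using xc by (cases q) (auto simp: A.cycles_def A.aug_span_def)
        qed (rule that)
        have gw: "g (Suc q) w \<in> carrier (Y (Suc q))" by (rule lin_homD(1)[OF g(1) w])
        have gu: "g q u \<in> smult_span (Y q) ?K" by (rule smult_span_hom[OF QA Y g(1) K u])
        have gfx: "(g q \<circ> f q) x = g q u \<oplus>\<^bsub>Y q\<^esub> dY q (g (Suc q) w)"
          using lin_homD(2)[OF g(1) uQ dw] g(3)[OF w] by (simp add: fx_eq)
        interpret Ys: left_module A "Y (Suc q)" by (rule Y)
        have "v \<oplus>\<^bsub>Y (Suc q)\<^esub> g (Suc q) w \<in> carrier (Y (Suc q))" using v gw by simp
        then obtain z where z: "z \<in> carrier (P (Suc q))" "v \<oplus>\<^bsub>Y (Suc q)\<^esub> g (Suc q) w = \<pi> (Suc q) z"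
          using pi_onto by blast
        have dv: "dY q v \<in> carrier (Y q)" "dY q (g (Suc q) w) \<in> carrier (Y q)"
          using lin_homD(1)[OF dY(1)] v gw by auto
        have k'c: "k' \<in> carrier (Y q)" "g q u \<in> carrier (Y q)"
          using Yq.smult_span_closed[OF K] k' gu by auto
        have "\<pi> q (d q z) = dY q v \<oplus>\<^bsub>Y q\<^esub> dY q (g (Suc q) w)"
          using dY(2)[OF z(1)] lin_homD(2)[OF dY(1) v gw] z(2) by simp
        then have "\<pi> q x = k' \<oplus>\<^bsub>Y q\<^esub> g q u \<oplus>\<^bsub>Y q\<^esub> \<pi> q (d q z)"
          unfolding eq gfx using dv k'c by (simp add: Yq.M.a_ac)
        moreover have dz: "d q z \<in> carrier (P q)" by (rule lin_homD(1)[OF PD(2) z(1)])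
        ultimately have "\<pi> q (x \<ominus>\<^bsub>P q\<^esub> d q z) = k' \<oplus>\<^bsub>Y q\<^esub> g q u"
          using lin_hom_diff[OF pi abP abY xP dz] k'c lin_homD(1)[OF pi dz]
          by (simp add: a_minus_def Yq.M.a_assoc Yq.M.r_neg)
        then have "\<pi> q (x \<ominus>\<^bsub>P q\<^esub> d q z) \<in> smult_span (Y q) ?K"
          using Yq.smult_span_add[OF K k' gu] by simp
        then have "x \<ominus>\<^bsub>P q\<^esub> d q z \<in> A.aug_span (P q)"
          using abelian_group.minus_closed[OF abP xP dz] by (intro span_pi)
        then show "\<exists>w\<in>carrier (P (Suc q)). x \<ominus>\<^bsub>P q\<^esub> d q w \<in> A.aug_span (P q)" using z(1) by blast
      qed
      then show ?thesis using rho(4)[OF xc] rho'(4)[OF cyc_f[OF xc]] by simp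
    qed
    show "(\<rho>' \<circ> f q) ` carrier ?L = carrier ?TB"
    proof
      show "(\<rho>' \<circ> f q) ` carrier ?L \<subseteq> carrier ?TB"
        using lin_homD(1)[OF lin_hom_comp[OF fhom rho'(2)]] by blast
      show "carrier ?TB \<subseteq> (\<rho>' \<circ> f q) ` carrier ?L"
      proof
        fix t assume "t \<in> carrier ?TB"
        then obtain z where zc: "z \<in> B.cycles Q d' q" and t: "t = \<rho>' z" using rho'(3) by blast
        then have z: "z \<in> carrier (?Q q)" by (simp add: B.cycles_def)
        \<comment> \<open>A lift of \<open>g q z\<close> is the preimage that is wanted:
          \<open>f q x\<close> is then \<open>f'\<close> of \<open>g q z\<close>, and
          \<open>f'\<close> after \<open>g\<close> is homotopic to the identity of
          \<open>Q\<close>.\<close>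
        obtain x where x: "x \<in> carrier (P q)" "g q z = \<pi> q x" using pi_onto[OF lin_homD(1)[OF g(1) z]] by blast
        have zcyc: "case q of 0 \<Rightarrow> True | Suc i \<Rightarrow> d' i z \<in> smult_span (?Q i) ?K"
          using zc by (cases q) (auto simp: B.cycles_def spanQ)
        have xc: "x \<in> A.cycles P d q"
        proof (cases q)
          case 0 then show ?thesis using x(1) by (simp add: A.cycles_def)
        next
          case (Suc i)
          have xi: "x \<in> carrier (P (Suc i))" "z \<in> carrier (?Q (Suc i))" using x z Suc by auto
          have "\<pi> i (d i x) = g i (d' i z)"
            using dY(2)[OF xi(1)] g(3)[OF xi(2)] x(2) Suc by simp
          moreover have "g i (d' i z) \<in> smult_span (Y i) ?K"
            using smult_span_hom[OF QA Y g(1) K, of "d' i z" i] zcyc Suc by simp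
          ultimately have "d i x \<in> A.aug_span (P i)" using span_pi[OF lin_homD(1)[OF PD(2) xi(1)]] by simp
          then show ?thesis using Suc x(1) by (simp add: A.cycles_def)
        qed
        obtain w u where w: "w \<in> carrier (?Q (Suc q))" and u: "u \<in> smult_span (?Q q) ?K"
          and eq: "(f' q \<circ> g q) z = d' q w \<oplus>\<^bsub>?Q q\<^esub> u \<oplus>\<^bsub>?Q q\<^esub> id z"
        proof (rule chain_maps_agree_mod[OF resQA resQA T lift_QQ
              lin_hom_comp[OF g(1) f'(1)] _ _ _ _ K z zcyc])
          show "id \<in> lin_hom A (?Q i) (?Q i)" for i by (rule lin_homI) auto
          show "e' ((f' 0 \<circ> g 0) y) = e' (id y)" if y: "y \<in> carrier (?Q 0)" for y
          proof -
            obtain x where x: "x \<in> carrier (P 0)" "g 0 y = \<pi> 0 x" using pi_onto[OF lin_homD(1)[OF g(1) y]] by blast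
            then show ?thesis using f'(2)[OF x(1)] f(2)[OF x(1)] g(2)[OF y] eY(2)[OF x(1)] by simp
          qed
          show "d' i ((f' (Suc i) \<circ> g (Suc i)) y) = (f' i \<circ> g i) (d' i y)" if y: "y \<in> carrier (?Q (Suc i))" for i y
          proof -
            obtain x where x: "x \<in> carrier (P (Suc i))" "g (Suc i) y = \<pi> (Suc i) x"
              using pi_onto[OF lin_homD(1)[OF g(1) y]] by blast
            have "g i (d' i y) = \<pi> i (d i x)" using g(3)[OF y] dY(2)[OF x(1)] x(2) by simp
            then show ?thesis using x f'(2)[OF x(1)] f'(2)[OF lin_homD(1)[OF PD(2) x(1)]] f(3)[OF x(1)] by simp
          qed
        qed (auto intro: that)
        have fx: "f q x = d' q w \<oplus>\<^bsub>Q q\<^esub> u \<oplus>\<^bsub>Q q\<^esub> z" using eq x f'(2)[OF x(1)] by simp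
        let ?LB = "B.scalars (Q q)\<lparr>carrier := B.cycles Q d' q\<rparr>"
        note Cyc = submoduleD[OF B.cycles_submodule[of Q d', OF QD(1,2)]]
        have uB: "u \<in> B.aug_span (Q q)" using u by (simp add: spanQ)
        interpret Qq: left_module B "Q q" by (rule QD)
        have uc: "u \<in> carrier (Q q)" using submoduleD(1)[OF B.aug_span_submodule[OF QD(1)]] uB by auto
        have wQ: "w \<in> carrier (Q (Suc q))" using w by simp
        have dwc: "d' q w \<in> carrier (Q q)" by (rule lin_homD(1)[OF QD(2) wQ])
        have dw: "d' q w \<in> B.cycles Q d' q"
          using wQ dwc QD(6) submoduleD(2)[OF B.aug_span_submodule[OF QD(1)]]
          by (cases q) (auto simp: B.cycles_def)
        have ucyc: "u \<in> B.cycles Q d' q"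
          using uc uB B.aug_span_hom[OF QD(1) QD(1) QD(2)] by (cases q) (auto simp: B.cycles_def)
        have y: "d' q w \<oplus>\<^bsub>Q q\<^esub> u \<in> B.cycles Q d' q" using Cyc(3)[of "d' q w" q u] dw ucyc by simp
        have "d' q w \<oplus>\<^bsub>Q q\<^esub> u \<ominus>\<^bsub>Q q\<^esub> d' q w = u"
          using dwc uc by (simp add: a_minus_def Qq.M.a_comm[of "d' q w" u] Qq.M.a_assoc Qq.M.r_neg)
        then have "\<rho>' (d' q w \<oplus>\<^bsub>Q q\<^esub> u) = \<zero>\<^bsub>?TB\<^esub>" using rho'(4)[OF y] uB wQ by metis
        moreover have "\<rho>' (f q x) = \<rho>' (d' q w \<oplus>\<^bsub>Q q\<^esub> u) \<oplus>\<^bsub>?TB\<^esub> \<rho>' z"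
          using lin_homD(2)[OF rho'(2), of "d' q w \<oplus>\<^bsub>Q q\<^esub> u" z] y zc by (simp add: fx)
        ultimately have "\<rho>' (f q x) = \<rho>' z"
          using lin_homD(1)[OF rho'(2), of z] zc left_module_abelian_group[OF rho'(1)]
          by (simp add: abelian_groupE(5))
        then show "t \<in> (\<rho>' \<circ> f q) ` carrier ?L" using t xc by force
      qed
    qed
  qed
qed

section \<open>Exactness of spans of right ideals\<close>

lemma finsum_smult_span:
  assumes "left_module A M" "J \<subseteq> carrier A" "finite I" "\<And>i. i \<in> I \<Longrightarrow> x i \<in> smult_span M J"
  shows "(\<Oplus>\<^bsub>M\<^esub>i\<in>I. x i) \<in> smult_span M J"
  using assms(3,4)
proof (induction I rule: finite_induct)
  interpret left_module A M by fact
  {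
    case empty then show ?case by (simp add: smult_span.zero)
  next
    case (insert i I)
    have "x \<in> I \<rightarrow> carrier M" "x i \<in> carrier M"
      using insert.prems smult_span_closed[OF assms(2)] by auto
    then show ?case using insert by (simp add: M.finsum_insert smult_span_add[OF assms(2)])
  }
qed

text \<open>With its converse \<open>smult_span_freeD\<close>: for a right ideal, the span in a free
  module consists of the functions with values in the ideal. This coordinatewise test is what
  projective modules inherit.\<close>

lemma smult_span_freeI:
  assumes "ring A" "J \<subseteq> carrier A" and f: "f \<in> carrier (free_module A S)" "\<And>s. f s \<in> J"
  shows "f \<in> smult_span (free_module A S) J"
proof -
  interpret F: left_module A "free_module A S" by (rule left_module_free[OF assms(1)])
  have y: "single A \<in> S \<rightarrow> carrier (free_module A S)" using single_closed[OF assms(1)] by auto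
  have "free_lift A (free_module A S) (single A) f = id f"
    by (rule lin_hom_free_eqI[OF assms(1) F.left_module_axioms F.free_lift_hom[OF y] _ _ f(1)])
      (simp_all add: F.free_lift_single[OF y] lin_hom_def)
  moreover have "free_lift A (free_module A S) (single A) f \<in> smult_span (free_module A S) J"
    unfolding free_lift_def
    by (rule finsum_smult_span[OF F.left_module_axioms assms(2)])
      (use f y in \<open>auto simp: free_module_carrier intro!: F.smult_span_base[OF assms(2)] simp del: free_module_simps\<close>)
  ultimately show ?thesis by simp
qed

definition right_ideal :: "('a, 'x) ring_scheme \<Rightarrow> 'a set \<Rightarrow> bool" where
  "right_ideal A U \<longleftrightarrow> U \<subseteq> carrier A \<and> \<zero>\<^bsub>A\<^esub> \<in> U \<and> (\<forall>a\<in>U. \<forall>b\<in>U. a \<oplus>\<^bsub>A\<^esub> b \<in> U) \<and>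
     (\<forall>a\<in>U. \<forall>b\<in>carrier A. a \<otimes>\<^bsub>A\<^esub> b \<in> U)"

lemma smult_span_freeD:
  assumes "right_ideal A U" "f \<in> smult_span (free_module A S) U"
  shows "f s \<in> U"
  using assms(2)
proof induction
  case zero then show ?case using assms(1) by (simp add: right_ideal_def)
next
  case (add a x u)
  then show ?case using assms(1) by (simp add: right_ideal_def free_module_carrier)
qed

text \<open>In a free module, span membership is tested coordinate by coordinate, so an inclusion
  between parts of \<open>E A\<close> passes to every coordinate. \<open>P\<close> is a summand, and
  the maps \<open>i\<close> and \<open>r\<close> respect spans.\<close>

lemma projective_smult_span_transfer:
  assumes P: "projective A P" and U: "right_ideal A U" and V: "right_ideal A V"
    and E: "E \<in> carrier A" and UV: "\<And>a. \<lbrakk>a \<in> carrier A; E \<otimes>\<^bsub>A\<^esub> a \<in> U\<rbrakk> \<Longrightarrow> E \<otimes>\<^bsub>A\<^esub> a \<in> V"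
    and x: "x \<in> carrier P" "E \<odot>\<^bsub>P\<^esub> x \<in> smult_span P U"
  shows "E \<odot>\<^bsub>P\<^esub> x \<in> smult_span P V"
proof -
  have PM: "left_module A P" using P by (simp add: projective_def)
  interpret P: left_module A P by (rule PM)
  note R = P.R.ring_axioms
  obtain S i r where i: "i \<in> lin_hom A P (free_module A (S::'c set))"
    and r: "r \<in> lin_hom A (free_module A S) P" and ri: "\<forall>x\<in>carrier P. r (i x) = x"
    using P unfolding projective_def by blast
  note F = left_module_free[OF R, of S]
  have sub: "U \<subseteq> carrier A" "V \<subseteq> carrier A" using U V by (auto simp: right_ideal_def)
  have ix: "i x \<in> carrier (free_module A S)" by (rule lin_homD(1)[OF i x(1)])
  have iE: "i (E \<odot>\<^bsub>P\<^esub> x) = (\<lambda>s. E \<otimes>\<^bsub>A\<^esub> i x s)" using lin_homD(3)[OF i E x(1)] by simp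
  have "i (E \<odot>\<^bsub>P\<^esub> x) \<in> smult_span (free_module A S) U"
    by (rule smult_span_hom[OF PM F i sub(1) x(2)])
  then have "E \<otimes>\<^bsub>A\<^esub> i x s \<in> V" for s
    using smult_span_freeD[OF U, of "i (E \<odot>\<^bsub>P\<^esub> x)" S s] UV ix by (simp add: iE free_module_carrier)
  then have "i (E \<odot>\<^bsub>P\<^esub> x) s \<in> V" for s by (simp add: iE)
  then have "i (E \<odot>\<^bsub>P\<^esub> x) \<in> smult_span (free_module A S) V"
    by (intro smult_span_freeI[OF R sub(2)] lin_homD(1)[OF i] P.lsmult_closed E x)
  then have "r (i (E \<odot>\<^bsub>P\<^esub> x)) \<in> smult_span P V" by (rule smult_span_hom[OF F PM r sub(2)])
  then show ?thesis using ri P.lsmult_closed[OF E x(1)] by simp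
qed

text \<open>In degree 0 every element counts as a cycle. This is exactness of the augmented complex
  \<open>J P\<close>, whose augmentation vanishes when \<open>J\<close> kills the resolved
  module.\<close>

definition span_exact ::
  "(nat \<Rightarrow> ('a, 'p, 'u) module_scheme) \<Rightarrow> (nat \<Rightarrow> 'p \<Rightarrow> 'p) \<Rightarrow> 'a set \<Rightarrow> bool" where
  "span_exact P d J \<longleftrightarrow> (\<forall>q. \<forall>y\<in>smult_span (P q) J.
     (case q of 0 \<Rightarrow> True | Suc i \<Rightarrow> d i y = \<zero>\<^bsub>P i\<^esub>) \<longrightarrow> (\<exists>w\<in>smult_span (P (Suc q)) J. d q w = y))"

lemma span_exactD:
  assumes "span_exact P d J" "y \<in> smult_span (P q) J" "case q of 0 \<Rightarrow> True | Suc i \<Rightarrow> d i y = \<zero>\<^bsub>P i\<^esub>"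
  obtains w where "w \<in> smult_span (P (Suc q)) J" "d q w = y"
  using assms unfolding span_exact_def by blast

lemma span_exact_zero:
  assumes "resolution A M P d e" shows "span_exact P d {\<zero>\<^bsub>A\<^esub>}"
proof -
  note PD = resolutionD[OF assms]
  have "y = \<zero>\<^bsub>P q\<^esub>" if y: "y \<in> smult_span (P q) {\<zero>\<^bsub>A\<^esub>}" for q y
  proof -
    interpret left_module A "P q" by (rule PD)
    have "y \<in> {\<zero>\<^bsub>P q\<^esub>}" using y by (rule smult_span_least) (use lsmult_l_null in auto)
    then show ?thesis by simp
  qed
  then show ?thesis
    using smult_span.zero lin_hom_zero[OF PD(2) left_module_abelian_group[OF PD(1)] left_module_abelian_group[OF PD(1)]]
    unfolding span_exact_def by metis
qed

text \<open>The right ideals \<open>U + E A\<close> over \<open>U\<close> have quotient \<open>E A / (E A \<inter> U)\<close>, which is a summand of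
  \<open>A / V\<close>; so exactness for \<open>U\<close> and \<open>V\<close> gives exactness for \<open>U + E A\<close>.\<close>

lemma span_exact_step:
  assumes res: "resolution A M P d e" and proj: "\<And>i. projective A (P i)" and M: "left_module A M"
    and U: "right_ideal A U" "span_exact P d U" and V: "right_ideal A V" "span_exact P d V"
    and E: "E \<in> carrier A" "E \<otimes>\<^bsub>A\<^esub> E = E" and EM: "\<And>x. x \<in> carrier M \<Longrightarrow> E \<odot>\<^bsub>M\<^esub> x = \<zero>\<^bsub>M\<^esub>"
    and VU: "V \<subseteq> U" and EV: "\<And>a. a \<in> V \<Longrightarrow> E \<otimes>\<^bsub>A\<^esub> a \<in> V"
    and UV: "\<And>a. \<lbrakk>a \<in> carrier A; E \<otimes>\<^bsub>A\<^esub> a \<in> U\<rbrakk> \<Longrightarrow> E \<otimes>\<^bsub>A\<^esub> a \<in> V"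
    and W: "W = {u \<oplus>\<^bsub>A\<^esub> E \<otimes>\<^bsub>A\<^esub> a | u a. u \<in> U \<and> a \<in> carrier A}"
  shows "span_exact P d W"
  unfolding span_exact_def
proof (intro allI ballI impI)
  fix q y assume y: "y \<in> smult_span (P q) W"
    and cyc: "case q of 0 \<Rightarrow> True | Suc i \<Rightarrow> d i y = \<zero>\<^bsub>P i\<^esub>"
  note PD = resolutionD[OF res]
  note ab = left_module_abelian_group[OF PD(1)]
  interpret P: left_module A "P q" by (rule PD)
  interpret P': left_module A "P (Suc q)" by (rule PD)
  have sub: "U \<subseteq> carrier A" "V \<subseteq> carrier A" using U V by (auto simp: right_ideal_def)
  have Wsub: "W \<subseteq> carrier A" using sub E(1) by (auto simp: W)
  have UW: "U \<subseteq> W"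
  proof
    fix u assume "u \<in> U"
    then have "u = u \<oplus>\<^bsub>A\<^esub> E \<otimes>\<^bsub>A\<^esub> \<zero>\<^bsub>A\<^esub>" using E(1) sub by auto
    then show "u \<in> W" unfolding W using \<open>u \<in> U\<close> by blast
  qed
  have "E \<in> W"
  proof -
    have "E = \<zero>\<^bsub>A\<^esub> \<oplus>\<^bsub>A\<^esub> E \<otimes>\<^bsub>A\<^esub> \<one>\<^bsub>A\<^esub>" using E(1) by simp
    moreover have "\<zero>\<^bsub>A\<^esub> \<in> U" using U(1) by (simp add: right_ideal_def)
    ultimately show ?thesis unfolding W by blast
  qed
  \<comment> \<open>Elements of the span of \<open>W\<close> split as \<open>y0 + E x\<close> with
    \<open>y0\<close> in the span of \<open>U\<close>, because in \<open>E a x\<close> the factor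
    \<open>a\<close> is absorbed by \<open>x\<close>.\<close>
  have "y \<in> {y0 \<oplus>\<^bsub>P q\<^esub> E \<odot>\<^bsub>P q\<^esub> x | y0 x. y0 \<in> smult_span (P q) U \<and> x \<in> carrier (P q)}"
    using y
  proof (rule smult_span_least)
    have "\<zero>\<^bsub>P q\<^esub> = \<zero>\<^bsub>P q\<^esub> \<oplus>\<^bsub>P q\<^esub> E \<odot>\<^bsub>P q\<^esub> \<zero>\<^bsub>P q\<^esub>" using E(1) by (simp add: P.lsmult_r_null)
    then show "\<zero>\<^bsub>P q\<^esub> \<in> {y0 \<oplus>\<^bsub>P q\<^esub> E \<odot>\<^bsub>P q\<^esub> x | y0 x. y0 \<in> smult_span (P q) U \<and> x \<in> carrier (P q)}"
      using smult_span.zero[of "P q" U] P.M.zero_closed by blast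
  next
    fix a b assume "a \<in> {y0 \<oplus>\<^bsub>P q\<^esub> E \<odot>\<^bsub>P q\<^esub> x | y0 x. y0 \<in> smult_span (P q) U \<and> x \<in> carrier (P q)}"
      "b \<in> {y0 \<oplus>\<^bsub>P q\<^esub> E \<odot>\<^bsub>P q\<^esub> x | y0 x. y0 \<in> smult_span (P q) U \<and> x \<in> carrier (P q)}"
    then obtain y0 x y1 z where *: "y0 \<in> smult_span (P q) U" "x \<in> carrier (P q)"
      "y1 \<in> smult_span (P q) U" "z \<in> carrier (P q)"
      and ab: "a = y0 \<oplus>\<^bsub>P q\<^esub> E \<odot>\<^bsub>P q\<^esub> x" "b = y1 \<oplus>\<^bsub>P q\<^esub> E \<odot>\<^bsub>P q\<^esub> z" by blast
    have "a \<oplus>\<^bsub>P q\<^esub> b = (y0 \<oplus>\<^bsub>P q\<^esub> y1) \<oplus>\<^bsub>P q\<^esub> E \<odot>\<^bsub>P q\<^esub> (x \<oplus>\<^bsub>P q\<^esub> z)"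
      using * E(1) P.smult_span_closed[OF sub(1)] by (simp add: ab P.lsmult_r_distr P.lsmult_closed P.M.a_ac)
    moreover have "y0 \<oplus>\<^bsub>P q\<^esub> y1 \<in> smult_span (P q) U" using * P.smult_span_add[OF sub(1)] by blast
    moreover have "x \<oplus>\<^bsub>P q\<^esub> z \<in> carrier (P q)" using * by simp
    ultimately show "a \<oplus>\<^bsub>P q\<^esub> b \<in> {y0 \<oplus>\<^bsub>P q\<^esub> E \<odot>\<^bsub>P q\<^esub> x | y0 x. y0 \<in> smult_span (P q) U \<and> x \<in> carrier (P q)}"
      by blast
  next
    fix w x assume w: "w \<in> W" and x: "x \<in> carrier (P q)"
    obtain u a where ua: "u \<in> U" "a \<in> carrier A" "w = u \<oplus>\<^bsub>A\<^esub> E \<otimes>\<^bsub>A\<^esub> a" using w unfolding W by blast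
    have "w \<odot>\<^bsub>P q\<^esub> x = u \<odot>\<^bsub>P q\<^esub> x \<oplus>\<^bsub>P q\<^esub> E \<odot>\<^bsub>P q\<^esub> (a \<odot>\<^bsub>P q\<^esub> x)"
      using ua sub(1) E(1) x by (simp add: P.lsmult_l_distr P.lsmult_assoc subsetD)
    moreover have "u \<odot>\<^bsub>P q\<^esub> x \<in> smult_span (P q) U" by (rule P.smult_span_base[OF sub(1) ua(1) x])
    moreover have "a \<odot>\<^bsub>P q\<^esub> x \<in> carrier (P q)" using ua(2) x by (rule P.lsmult_closed)
    ultimately show "w \<odot>\<^bsub>P q\<^esub> x \<in> {y0 \<oplus>\<^bsub>P q\<^esub> E \<odot>\<^bsub>P q\<^esub> x | y0 x. y0 \<in> smult_span (P q) U \<and> x \<in> carrier (P q)}"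
      by blast
  qed
  then obtain y0 x where y0: "y0 \<in> smult_span (P q) U" and x: "x \<in> carrier (P q)"
    and y_eq: "y = y0 \<oplus>\<^bsub>P q\<^esub> E \<odot>\<^bsub>P q\<^esub> x" by blast
  have y0c: "y0 \<in> carrier (P q)" by (rule P.smult_span_closed[OF sub(1) y0])
  have Ex: "E \<odot>\<^bsub>P q\<^esub> x \<in> carrier (P q)" using E(1) x by (rule P.lsmult_closed)
  \<comment> \<open>As the boundary of \<open>y0 + E x\<close> vanishes, \<open>E d x\<close> is
    minus \<open>d y0\<close>; it lies in the span of \<open>U\<close>, hence in that of
    \<open>V\<close>. Exactness for \<open>V\<close> gives \<open>w\<close> with the same boundary
    as \<open>E x\<close>. In degree 0 there is nothing to match and \<open>w\<close> is
    zero.\<close>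
  have "\<exists>w\<in>smult_span (P q) V. case q of 0 \<Rightarrow> w = \<zero>\<^bsub>P q\<^esub> | Suc i \<Rightarrow> d i w = E \<odot>\<^bsub>P i\<^esub> d i x"
  proof (cases q)
    case 0
    then show ?thesis using smult_span.zero[of "P q" V] by auto
  next
    case (Suc i)
    interpret Pi: left_module A "P i" by (rule PD)
    have dhom: "d i \<in> lin_hom A (P q) (P i)" using PD(2)[of i] Suc by simp
    have dx: "d i x \<in> carrier (P i)" by (rule lin_homD(1)[OF dhom x])
    have dy0: "d i y0 \<in> smult_span (P i) U" by (rule smult_span_hom[OF PD(1) PD(1) dhom sub(1) y0])
    have dy0c: "d i y0 \<in> carrier (P i)" by (rule lin_homD(1)[OF dhom y0c])
    have "d i y0 \<oplus>\<^bsub>P i\<^esub> E \<odot>\<^bsub>P i\<^esub> d i x = \<zero>\<^bsub>P i\<^esub>"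
      using cyc lin_homD(2)[OF dhom y0c Ex] lin_homD(3)[OF dhom E(1) x] by (simp add: Suc y_eq)
    then have "E \<odot>\<^bsub>P i\<^esub> d i x = \<ominus>\<^bsub>P i\<^esub> d i y0"
      using Pi.M.minus_equality[of "E \<odot>\<^bsub>P i\<^esub> d i x" "d i y0"] dy0c Pi.lsmult_closed[OF E(1) dx]
      by (simp add: Pi.M.a_comm)
    then have EdU: "E \<odot>\<^bsub>P i\<^esub> d i x \<in> smult_span (P i) U" using Pi.smult_span_minus[OF sub(1) dy0] by simp
    have EdV: "E \<odot>\<^bsub>P i\<^esub> d i x \<in> smult_span (P i) V"
      by (rule projective_smult_span_transfer[OF proj U(1) V(1) E(1) _ dx EdU]) (rule UV)
    have "case i of 0 \<Rightarrow> True | Suc j \<Rightarrow> d j (E \<odot>\<^bsub>P i\<^esub> d i x) = \<zero>\<^bsub>P j\<^esub>"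
    proof (cases i)
      case (Suc j)
      have "d j (E \<odot>\<^bsub>P i\<^esub> d i x) = E \<odot>\<^bsub>P j\<^esub> d j (d i x)"
        using lin_homD(3)[OF PD(2)[of j] E(1)] dx Suc by simp
      also have "d j (d i x) = \<zero>\<^bsub>P j\<^esub>" using PD(6)[of x j] x Suc \<open>q = Suc i\<close> by simp
      finally show ?thesis using left_module.lsmult_r_null[OF PD(1) E(1)] Suc by simp
    qed simp
    then obtain w where "w \<in> smult_span (P (Suc i)) V" "d i w = E \<odot>\<^bsub>P i\<^esub> d i x"
      by (rule span_exactD[OF V(2) EdV])
    then show ?thesis using Suc by auto
  qed
  then obtain w where w: "w \<in> smult_span (P q) V"
    and dw: "case q of 0 \<Rightarrow> w = \<zero>\<^bsub>P q\<^esub> | Suc i \<Rightarrow> d i w = E \<odot>\<^bsub>P i\<^esub> d i x" by blast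
  have wc: "w \<in> carrier (P q)" by (rule P.smult_span_closed[OF sub(2) w])
  have Ew: "E \<odot>\<^bsub>P q\<^esub> w \<in> carrier (P q)" using E(1) wc by (rule P.lsmult_closed)
  \<comment> \<open>This choice makes \<open>E v\<close> a cycle, since
    \<open>E d v = E d x - E E d x = 0\<close>. So \<open>E v\<close> is the boundary of some
    \<open>z\<close>, and also of \<open>E z\<close>, as \<open>E\<close> is idempotent.\<close>
  define v where "v = x \<ominus>\<^bsub>P q\<^esub> w"
  have v: "v \<in> carrier (P q)" using x wc by (simp add: v_def)
  have Ev: "E \<odot>\<^bsub>P q\<^esub> v \<in> carrier (P q)" using E(1) v by (rule P.lsmult_closed)
  have EE: "E \<odot>\<^bsub>P i\<^esub> (E \<odot>\<^bsub>P i\<^esub> u) = E \<odot>\<^bsub>P i\<^esub> u" if "u \<in> carrier (P i)" for i u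
    using left_module.lsmult_assoc[OF PD(1) E(1) E(1) that] E(2) by simp
  have "E \<odot>\<^bsub>P q\<^esub> v \<in> d q ` carrier (P (Suc q))"
  proof (cases q)
    case 0
    then have "e (E \<odot>\<^bsub>P q\<^esub> v) = \<zero>\<^bsub>M\<^esub>"
      using lin_homD(3)[OF PD(3) E(1), of v] v EM[OF lin_homD(1)[OF PD(3), of v]] by simp
    then show ?thesis using PD(7)[of "E \<odot>\<^bsub>P q\<^esub> v"] Ev 0 by simp
  next
    case (Suc i)
    have dhom: "d i \<in> lin_hom A (P q) (P i)" using PD(2)[of i] Suc by simp
    interpret Pi: left_module A "P i" by (rule PD)
    have dx: "d i x \<in> carrier (P i)" by (rule lin_homD(1)[OF dhom x])
    have "d i (E \<odot>\<^bsub>P q\<^esub> v) = E \<odot>\<^bsub>P i\<^esub> (d i x \<ominus>\<^bsub>P i\<^esub> E \<odot>\<^bsub>P i\<^esub> d i x)"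
      using lin_homD(3)[OF dhom E(1) v] lin_hom_diff[OF dhom ab ab x wc] dw Suc by (simp add: v_def)
    also have "\<dots> = \<zero>\<^bsub>P i\<^esub>"
      using EE[OF dx] Pi.M.minus_eq_zero_iff E(1) dx by (simp add: Pi.lsmult_diff Pi.lsmult_closed)
    finally show ?thesis using PD(8)[of "E \<odot>\<^bsub>P q\<^esub> v" i] Ev Suc by simp
  qed
  then obtain z where z: "z \<in> carrier (P (Suc q))" "E \<odot>\<^bsub>P q\<^esub> v = d q z" by blast
  have Ez: "E \<odot>\<^bsub>P (Suc q)\<^esub> z \<in> carrier (P (Suc q))" using E(1) z(1) by (rule P'.lsmult_closed)
  have dEz: "d q (E \<odot>\<^bsub>P (Suc q)\<^esub> z) = E \<odot>\<^bsub>P q\<^esub> v"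
    using lin_homD(3)[OF PD(2) E(1) z(1)] z(2) EE[OF v] by simp
  \<comment> \<open>Now \<open>y = y1 + d (E z)\<close>. The correction \<open>E w\<close> belongs
    to the part over \<open>U\<close>, because \<open>V\<close> is stable under \<open>E\<close> and
    contained in \<open>U\<close>; so \<open>y1\<close> is a cycle in the span of
    \<open>U\<close>.\<close>
  define y1 where "y1 = y0 \<oplus>\<^bsub>P q\<^esub> E \<odot>\<^bsub>P q\<^esub> w"
  have y1c: "y1 \<in> carrier (P q)" using y0c Ew by (simp add: y1_def)
  have "E \<odot>\<^bsub>P q\<^esub> w \<in> smult_span (P q) V" by (rule P.smult_span_smult[OF sub(2) E(1) EV w])
  then have y1: "y1 \<in> smult_span (P q) U"
    unfolding y1_def by (intro P.smult_span_add[OF sub(1) y0] subsetD[OF smult_span_mono[OF VU]])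
  have "E \<odot>\<^bsub>P q\<^esub> v = E \<odot>\<^bsub>P q\<^esub> x \<oplus>\<^bsub>P q\<^esub> \<ominus>\<^bsub>P q\<^esub> (E \<odot>\<^bsub>P q\<^esub> w)"
    using P.lsmult_diff[OF E(1) x wc] by (simp only: v_def a_minus_def)
  then have "E \<odot>\<^bsub>P q\<^esub> x = E \<odot>\<^bsub>P q\<^esub> w \<oplus>\<^bsub>P q\<^esub> E \<odot>\<^bsub>P q\<^esub> v"
    using P.M.a_lcomm[OF Ew Ex P.M.a_inv_closed[OF Ew]] P.M.r_neg[OF Ew] P.M.r_zero[OF Ex] by (simp only:)
  then have y_eq': "y = y1 \<oplus>\<^bsub>P q\<^esub> d q (E \<odot>\<^bsub>P (Suc q)\<^esub> z)"
    using y0c Ew Ev by (simp add: y_eq y1_def dEz P.M.a_assoc)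
  have "case q of 0 \<Rightarrow> True | Suc i \<Rightarrow> d i y1 = \<zero>\<^bsub>P i\<^esub>"
  proof (cases q)
    case (Suc i)
    have dhom: "d i \<in> lin_hom A (P q) (P i)" using PD(2)[of i] Suc by simp
    interpret Pi: left_module A "P i" by (rule PD)
    have "d i (d q (E \<odot>\<^bsub>P (Suc q)\<^esub> z)) = \<zero>\<^bsub>P i\<^esub>"
      using PD(6)[of "E \<odot>\<^bsub>P (Suc q)\<^esub> z" i] Ez Suc by simp
    then have "d i y = d i y1"
      using lin_homD(2)[OF dhom y1c Ev] lin_homD(1)[OF dhom y1c] by (simp add: y_eq' dEz)
    then show ?thesis using cyc Suc by simp
  qed simp
  then obtain w' where w': "w' \<in> smult_span (P (Suc q)) U" "d q w' = y1"
    by (rule span_exactD[OF U(2) y1])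
  have w'c: "w' \<in> carrier (P (Suc q))" by (rule P'.smult_span_closed[OF sub(1) w'(1)])
  have "w' \<oplus>\<^bsub>P (Suc q)\<^esub> E \<odot>\<^bsub>P (Suc q)\<^esub> z \<in> smult_span (P (Suc q)) W"
    by (intro P'.smult_span_add[OF Wsub] subsetD[OF smult_span_mono[OF UW]] w'(1)
        P'.smult_span_base[OF Wsub \<open>E \<in> W\<close> z(1)])
  moreover have "d q (w' \<oplus>\<^bsub>P (Suc q)\<^esub> E \<odot>\<^bsub>P (Suc q)\<^esub> z) = y"
    using lin_homD(2)[OF PD(2) w'c Ez] w'(2) y_eq' by simp
  ultimately show "\<exists>w\<in>smult_span (P (Suc q)) W. d q w = y" by blast
qed

text \<open>An element of a span involves finitely many scalars, so in a directed family it lies in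
  the span of a single member.\<close>

lemma span_exact_directed_union:
  assumes "\<And>J. J \<in> \<J> \<Longrightarrow> span_exact P d J" and "\<J> \<noteq> {}"
    and dir: "\<And>J K. \<lbrakk>J \<in> \<J>; K \<in> \<J>\<rbrakk> \<Longrightarrow> \<exists>L\<in>\<J>. J \<union> K \<subseteq> L"
  shows "span_exact P d (\<Union>\<J>)"
  unfolding span_exact_def
proof (intro allI ballI impI)
  fix q y assume y: "y \<in> smult_span (P q) (\<Union>\<J>)"
    and cyc: "case q of 0 \<Rightarrow> True | Suc i \<Rightarrow> d i y = \<zero>\<^bsub>P i\<^esub>"
  from y have "\<exists>J\<in>\<J>. y \<in> smult_span (P q) J"
  proof (induction)
    case zero then show ?case using assms(2) smult_span.zero by blast
  next
    case (add a x u)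
    then obtain J K where J: "a \<in> J" "J \<in> \<J>" and K: "K \<in> \<J>" "u \<in> smult_span (P q) K" by blast
    obtain L where L: "L \<in> \<J>" "J \<union> K \<subseteq> L" using dir[OF J(2) K(1)] by blast
    then have "a \<odot>\<^bsub>P q\<^esub> x \<oplus>\<^bsub>P q\<^esub> u \<in> smult_span (P q) L"
      using J(1) K(2) add.hyps(2) smult_span_mono[of K L "P q"] by (intro smult_span.add) auto
    then show ?case using L(1) by blast
  qed
  then obtain J where J: "J \<in> \<J>" "y \<in> smult_span (P q) J" by blast
  obtain w where w: "w \<in> smult_span (P (Suc q)) J" "d q w = y"
    by (rule span_exactD[OF assms(1)[OF J(1)] J(2) cyc])
  have "w \<in> smult_span (P (Suc q)) (\<Union>\<J>)"
    by (rule subsetD[OF smult_span_mono[OF Union_upper[OF J(1)]] w(1)])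
  then show "\<exists>w\<in>smult_span (P (Suc q)) (\<Union>\<J>). d q w = y" using w(2) by (rule bexI[rotated])
qed

section \<open>Algebras with a multiplicative basis\<close>

lemma trivial_module_eq_aug_module:
  "trivial_module k T = aug_module k (\<lambda>f. \<Oplus>\<^bsub>k\<^esub>b\<in>{b \<in> T. f b \<noteq> \<zero>\<^bsub>k\<^esub>}. f b)"
  by (simp add: trivial_module_def aug_module_def)

text \<open>That the algebra is a ring is an assumption here; it will be supplied by the modules of
  a resolution, whose definition includes it. No associativity of structure constants is
  computed.\<close>

locale basis_ring = k?: cring k for k :: "('k, 'x) ring_scheme" +
  fixes B :: "'b set" and p :: "'b \<Rightarrow> 'b \<Rightarrow> 'b" and c :: "'b \<Rightarrow> 'b \<Rightarrow> 'k" and u :: 'b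
  assumes ring: "ring (basis_algebra k B p c u)"
    and p_closed: "\<lbrakk>x \<in> B; y \<in> B\<rbrakk> \<Longrightarrow> p x y \<in> B"
    and c_closed: "\<lbrakk>x \<in> B; y \<in> B\<rbrakk> \<Longrightarrow> c x y \<in> carrier k"
    and u_closed: "u \<in> B"
begin

abbreviation "A \<equiv> basis_algebra k B p c u"

lemma basis_algebra_simps [simp]:
  "\<zero>\<^bsub>A\<^esub> = (\<lambda>b. \<zero>\<^bsub>k\<^esub>)"
  "f \<oplus>\<^bsub>A\<^esub> g = (\<lambda>b. f b \<oplus>\<^bsub>k\<^esub> g b)"
  "r \<odot>\<^bsub>A\<^esub> f = (\<lambda>b. r \<otimes>\<^bsub>k\<^esub> f b)"
  "\<one>\<^bsub>A\<^esub> = single k u"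
  by (simp_all add: basis_algebra_def free_module_def)

lemma basis_carrier:
  "f \<in> carrier A \<longleftrightarrow> (\<forall>b. f b \<in> carrier k) \<and> (\<forall>b. b \<notin> B \<longrightarrow> f b = \<zero>\<^bsub>k\<^esub>) \<and> finite {b. f b \<noteq> \<zero>\<^bsub>k\<^esub>}"
  by (simp add: basis_algebra_def free_module_def)

lemma basis_carrierD:
  assumes "f \<in> carrier A"
  shows "f b \<in> carrier k" "f b \<noteq> \<zero>\<^bsub>k\<^esub> \<Longrightarrow> b \<in> B" "finite {b. f b \<noteq> \<zero>\<^bsub>k\<^esub>}"
  using assms by (auto simp: basis_carrier)

lemma basis_single_closed: "b \<in> B \<Longrightarrow> single k b \<in> carrier A"
  using single_closed[OF k.ring_axioms, of b B] by (simp add: basis_carrier free_module_carrier)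

lemma basis_smult_closed:
  assumes "r \<in> carrier k" "f \<in> carrier A" shows "r \<odot>\<^bsub>A\<^esub> f \<in> carrier A"
proof -
  have "{b. r \<otimes>\<^bsub>k\<^esub> f b \<noteq> \<zero>\<^bsub>k\<^esub>} \<subseteq> {b. f b \<noteq> \<zero>\<^bsub>k\<^esub>}" using assms(1) by auto
  then show ?thesis using assms finite_subset by (auto simp: basis_carrier)
qed

lemma basis_mult:
  assumes f: "f \<in> carrier A" and g: "g \<in> carrier A"
    and F: "finite F" "{b. f b \<noteq> \<zero>\<^bsub>k\<^esub>} \<subseteq> F" "F \<subseteq> B" and H: "finite H" "{b. g b \<noteq> \<zero>\<^bsub>k\<^esub>} \<subseteq> H" "H \<subseteq> B"
  shows "(f \<otimes>\<^bsub>A\<^esub> g) z =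
    (\<Oplus>\<^bsub>k\<^esub>w\<in>{w \<in> F \<times> H. p (fst w) (snd w) = z}. f (fst w) \<otimes>\<^bsub>k\<^esub> g (snd w) \<otimes>\<^bsub>k\<^esub> c (fst w) (snd w))"
proof -
  have "(f \<otimes>\<^bsub>A\<^esub> g) z = (\<Oplus>\<^bsub>k\<^esub>w\<in>{(x, y). f x \<noteq> \<zero>\<^bsub>k\<^esub> \<and> g y \<noteq> \<zero>\<^bsub>k\<^esub> \<and> p x y = z}.
      f (fst w) \<otimes>\<^bsub>k\<^esub> g (snd w) \<otimes>\<^bsub>k\<^esub> c (fst w) (snd w))"
    by (simp add: basis_algebra_def)
  also have "\<dots> = (\<Oplus>\<^bsub>k\<^esub>w\<in>{w \<in> F \<times> H. p (fst w) (snd w) = z}.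
      f (fst w) \<otimes>\<^bsub>k\<^esub> g (snd w) \<otimes>\<^bsub>k\<^esub> c (fst w) (snd w))"
  proof (rule k.add.finprod_mono_neutral_cong_left)
    show "finite {w \<in> F \<times> H. p (fst w) (snd w) = z}" using F H by simp
    show "{(x, y). f x \<noteq> \<zero>\<^bsub>k\<^esub> \<and> g y \<noteq> \<zero>\<^bsub>k\<^esub> \<and> p x y = z} \<subseteq> {w \<in> F \<times> H. p (fst w) (snd w) = z}"
      using F(2) H(2) by auto
    show "f (fst w) \<otimes>\<^bsub>k\<^esub> g (snd w) \<otimes>\<^bsub>k\<^esub> c (fst w) (snd w) = \<zero>\<^bsub>k\<^esub>"
      if "w \<in> {w \<in> F \<times> H. p (fst w) (snd w) = z} - {(x, y). f x \<noteq> \<zero>\<^bsub>k\<^esub> \<and> g y \<noteq> \<zero>\<^bsub>k\<^esub> \<and> p x y = z}" for w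
    proof -
      have "fst w \<in> B" "snd w \<in> B" "f (fst w) = \<zero>\<^bsub>k\<^esub> \<or> g (snd w) = \<zero>\<^bsub>k\<^esub>" using that F(3) H(3) by auto
      then show ?thesis using basis_carrierD(1)[OF f] basis_carrierD(1)[OF g] c_closed by auto
    qed
    show "(\<lambda>w. f (fst w) \<otimes>\<^bsub>k\<^esub> g (snd w) \<otimes>\<^bsub>k\<^esub> c (fst w) (snd w)) \<in> {w \<in> F \<times> H. p (fst w) (snd w) = z} \<rightarrow> carrier k"
      using basis_carrierD(1)[OF f] basis_carrierD(1)[OF g]
      by (intro Pi_I k.m_closed c_closed) (use F(3) H(3) in auto)
  qed auto
  finally show ?thesis .
qed

lemma basis_mult_supp:
  assumes f: "f \<in> carrier A" and g: "g \<in> carrier A" and z: "(f \<otimes>\<^bsub>A\<^esub> g) z \<noteq> \<zero>\<^bsub>k\<^esub>"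
  obtains x y where "f x \<noteq> \<zero>\<^bsub>k\<^esub>" "g y \<noteq> \<zero>\<^bsub>k\<^esub>" "p x y = z"
proof -
  have "{w \<in> {b. f b \<noteq> \<zero>\<^bsub>k\<^esub>} \<times> {b. g b \<noteq> \<zero>\<^bsub>k\<^esub>}. p (fst w) (snd w) = z} \<noteq> {}"
  proof
    assume empty: "{w \<in> {b. f b \<noteq> \<zero>\<^bsub>k\<^esub>} \<times> {b. g b \<noteq> \<zero>\<^bsub>k\<^esub>}. p (fst w) (snd w) = z} = {}"
    have "{b. f b \<noteq> \<zero>\<^bsub>k\<^esub>} \<subseteq> B" "{b. g b \<noteq> \<zero>\<^bsub>k\<^esub>} \<subseteq> B"
      using basis_carrierD(2)[OF f] basis_carrierD(2)[OF g] by auto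
    note eq = basis_mult[OF f g basis_carrierD(3)[OF f] subset_refl this(1) basis_carrierD(3)[OF g] subset_refl this(2), of z]
    have "(f \<otimes>\<^bsub>A\<^esub> g) z = \<zero>\<^bsub>k\<^esub>" unfolding eq empty by simp
    then show False using z by simp
  qed
  then show thesis using that by auto
qed

lemma basis_smult_mult:
  assumes r: "r \<in> carrier k" and f: "f \<in> carrier A" and g: "g \<in> carrier A"
  shows "(r \<odot>\<^bsub>A\<^esub> f) \<otimes>\<^bsub>A\<^esub> g = r \<odot>\<^bsub>A\<^esub> (f \<otimes>\<^bsub>A\<^esub> g)"
proof
  fix z
  let ?F = "{b. f b \<noteq> \<zero>\<^bsub>k\<^esub>}" and ?H = "{b. g b \<noteq> \<zero>\<^bsub>k\<^esub>}"
  have F: "finite ?F" "?F \<subseteq> B" "finite ?H" "?H \<subseteq> B"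
    using basis_carrierD[OF f] basis_carrierD[OF g] by auto
  have rf: "{b. (r \<odot>\<^bsub>A\<^esub> f) b \<noteq> \<zero>\<^bsub>k\<^esub>} \<subseteq> ?F" using r by auto
  have BB: "fst w \<in> B" "snd w \<in> B" if "w \<in> ?F \<times> ?H" for w using that F by auto
  have "((r \<odot>\<^bsub>A\<^esub> f) \<otimes>\<^bsub>A\<^esub> g) z = (\<Oplus>\<^bsub>k\<^esub>w\<in>{w \<in> ?F \<times> ?H. p (fst w) (snd w) = z}.
      r \<otimes>\<^bsub>k\<^esub> (f (fst w) \<otimes>\<^bsub>k\<^esub> g (snd w) \<otimes>\<^bsub>k\<^esub> c (fst w) (snd w)))"
    unfolding basis_mult[OF basis_smult_closed[OF r f] g F(1) rf F(2) F(3) subset_refl F(4)]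
    using r basis_carrierD(1)[OF f] basis_carrierD(1)[OF g] c_closed[OF BB]
    by (intro k.finsum_cong') (auto simp: m_assoc)
  also have "\<dots> = r \<otimes>\<^bsub>k\<^esub> (f \<otimes>\<^bsub>A\<^esub> g) z"
    unfolding basis_mult[OF f g F(1) subset_refl F(2) F(3) subset_refl F(4)]
    using r F basis_carrierD(1)[OF f] basis_carrierD(1)[OF g] c_closed[OF BB]
    by (intro k.finsum_rdistr[symmetric]) auto
  finally show "((r \<odot>\<^bsub>A\<^esub> f) \<otimes>\<^bsub>A\<^esub> g) z = (r \<odot>\<^bsub>A\<^esub> (f \<otimes>\<^bsub>A\<^esub> g)) z" by simp
qed

lemma basis_unit_hom: "(\<lambda>r. r \<odot>\<^bsub>A\<^esub> \<one>\<^bsub>A\<^esub>) \<in> ring_hom k A"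
proof (rule ring_hom_memI)
  interpret A: ring A by (rule ring)
  have one: "\<one>\<^bsub>A\<^esub> \<in> carrier A" by (rule A.one_closed)
  show "r \<odot>\<^bsub>A\<^esub> \<one>\<^bsub>A\<^esub> \<in> carrier A" if "r \<in> carrier k" for r using that one by (rule basis_smult_closed)
  show "(r \<otimes>\<^bsub>k\<^esub> s) \<odot>\<^bsub>A\<^esub> \<one>\<^bsub>A\<^esub> = (r \<odot>\<^bsub>A\<^esub> \<one>\<^bsub>A\<^esub>) \<otimes>\<^bsub>A\<^esub> (s \<odot>\<^bsub>A\<^esub> \<one>\<^bsub>A\<^esub>)" if "r \<in> carrier k" "s \<in> carrier k" for r s
  proof -
    have "(r \<odot>\<^bsub>A\<^esub> \<one>\<^bsub>A\<^esub>) \<otimes>\<^bsub>A\<^esub> (s \<odot>\<^bsub>A\<^esub> \<one>\<^bsub>A\<^esub>) = r \<odot>\<^bsub>A\<^esub> (\<one>\<^bsub>A\<^esub> \<otimes>\<^bsub>A\<^esub> (s \<odot>\<^bsub>A\<^esub> \<one>\<^bsub>A\<^esub>))"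
      by (rule basis_smult_mult[OF that(1) one basis_smult_closed[OF that(2) one]])
    also have "\<one>\<^bsub>A\<^esub> \<otimes>\<^bsub>A\<^esub> (s \<odot>\<^bsub>A\<^esub> \<one>\<^bsub>A\<^esub>) = s \<odot>\<^bsub>A\<^esub> \<one>\<^bsub>A\<^esub>"
      by (rule A.l_one[OF basis_smult_closed[OF that(2) one]])
    finally show ?thesis using that basis_carrierD(1)[OF one] by (auto simp: m_assoc)
  qed
  show "(r \<oplus>\<^bsub>k\<^esub> s) \<odot>\<^bsub>A\<^esub> \<one>\<^bsub>A\<^esub> = r \<odot>\<^bsub>A\<^esub> \<one>\<^bsub>A\<^esub> \<oplus>\<^bsub>A\<^esub> s \<odot>\<^bsub>A\<^esub> \<one>\<^bsub>A\<^esub>" if "r \<in> carrier k" "s \<in> carrier k" for r s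
    using that basis_carrierD(1)[OF one] by (auto simp: l_distr)
  show "\<one>\<^bsub>k\<^esub> \<odot>\<^bsub>A\<^esub> \<one>\<^bsub>A\<^esub> = \<one>\<^bsub>A\<^esub>" using basis_carrierD(1)[OF one] by auto
qed

definition aug :: "'b set \<Rightarrow> ('b \<Rightarrow> 'k) \<Rightarrow> 'k" where
  "aug T f = (\<Oplus>\<^bsub>k\<^esub>b\<in>{b \<in> T. f b \<noteq> \<zero>\<^bsub>k\<^esub>}. f b)"

lemma aug_single:
  assumes "r \<in> carrier k"
  shows "aug T (r \<odot>\<^bsub>A\<^esub> single k b) = (if b \<in> T then r else \<zero>\<^bsub>k\<^esub>)"
proof -
  have eq: "{b' \<in> T. (r \<odot>\<^bsub>A\<^esub> single k b) b' \<noteq> \<zero>\<^bsub>k\<^esub>} = (if b \<in> T \<and> r \<noteq> \<zero>\<^bsub>k\<^esub> then {b} else {})"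
    using assms by (auto simp: single_def)
  show ?thesis unfolding aug_def eq using assms by (auto simp: single_def)
qed

text \<open>Additivity, multiplicativity and the value at one are the module laws of the trivial
  module, applied to the element one of \<open>k\<close>.\<close>

lemma augmented_algebra_aug:
  assumes T: "u \<in> T" and M: "left_module A (aug_module k (aug T))"
  shows "augmented_algebra k A (aug T)"
proof (intro augmented_algebra.intro augmented_algebra_axioms.intro)
  interpret M: left_module A "aug_module k (aug T)" by (rule M)
  show "cring k" by (rule k.is_cring)
  show "ring A" by (rule ring)
  show "(\<lambda>r. r \<odot>\<^bsub>A\<^esub> \<one>\<^bsub>A\<^esub>) \<in> ring_hom k A" by (rule basis_unit_hom)
  show "aug T (r \<odot>\<^bsub>A\<^esub> \<one>\<^bsub>A\<^esub>) = r" if "r \<in> carrier k" for r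
    using aug_single[OF that, of T u] T by simp
  have closed: "aug T a \<in> carrier k" if "a \<in> carrier A" for a
    unfolding aug_def using basis_carrierD(1)[OF that] by (intro k.finsum_closed) auto
  show "aug T \<in> ring_hom A k"
  proof (rule ring_hom_memI)
    fix a b assume a: "a \<in> carrier A" and b: "b \<in> carrier A"
    show "aug T (a \<oplus>\<^bsub>A\<^esub> b) = aug T a \<oplus>\<^bsub>k\<^esub> aug T b"
      using M.lsmult_l_distr[OF a b, of "\<one>\<^bsub>k\<^esub>"] closed[OF a] closed[OF b] closed[OF M.R.a_closed[OF a b]] by simp
    show "aug T (a \<otimes>\<^bsub>A\<^esub> b) = aug T a \<otimes>\<^bsub>k\<^esub> aug T b"
      using M.lsmult_assoc[OF a b, of "\<one>\<^bsub>k\<^esub>"] closed[OF a] closed[OF b] closed[OF M.R.m_closed[OF a b]] by simp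
  next
    show "aug T \<one>\<^bsub>A\<^esub> = \<one>\<^bsub>k\<^esub>" using M.lsmult_one[of "\<one>\<^bsub>k\<^esub>"] closed[OF M.R.one_closed] by simp
  qed (rule closed)
qed

section \<open>Right ideals spanned by sets of basis elements\<close>

definition supp_in :: "'b set \<Rightarrow> ('b \<Rightarrow> 'k) set" where
  "supp_in D = {f \<in> carrier A. \<forall>b. f b \<noteq> \<zero>\<^bsub>k\<^esub> \<longrightarrow> b \<in> D}"

lemma supp_inI: "\<lbrakk>f \<in> carrier A; \<And>b. f b \<noteq> \<zero>\<^bsub>k\<^esub> \<Longrightarrow> b \<in> D\<rbrakk> \<Longrightarrow> f \<in> supp_in D"
  by (simp add: supp_in_def)

lemma supp_inD: "f \<in> supp_in D \<Longrightarrow> f \<in> carrier A" "\<lbrakk>f \<in> supp_in D; f b \<noteq> \<zero>\<^bsub>k\<^esub>\<rbrakk> \<Longrightarrow> b \<in> D"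
  by (simp_all add: supp_in_def)

lemma supp_in_right_ideal:
  assumes "\<And>x y. \<lbrakk>x \<in> D; x \<in> B; y \<in> B\<rbrakk> \<Longrightarrow> p x y \<in> D"
  shows "right_ideal A (supp_in D)"
  unfolding right_ideal_def
proof (intro conjI ballI)
  interpret A: ring A by (rule ring)
  show "supp_in D \<subseteq> carrier A" by (auto simp: supp_in_def)
  show "\<zero>\<^bsub>A\<^esub> \<in> supp_in D" using A.zero_closed by (simp add: supp_in_def)
  fix f assume f: "f \<in> supp_in D"
  show "f \<oplus>\<^bsub>A\<^esub> g \<in> supp_in D" if g: "g \<in> supp_in D" for g
  proof (rule supp_inI)
    show "f \<oplus>\<^bsub>A\<^esub> g \<in> carrier A" using supp_inD(1)[OF f] supp_inD(1)[OF g] by (rule A.a_closed)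
    show "b \<in> D" if "(f \<oplus>\<^bsub>A\<^esub> g) b \<noteq> \<zero>\<^bsub>k\<^esub>" for b
      using that supp_inD(2)[OF f, of b] supp_inD(2)[OF g, of b] basis_carrierD(1)[OF supp_inD(1)[OF g], of b]
      by (cases "f b = \<zero>\<^bsub>k\<^esub>") auto
  qed
  show "f \<otimes>\<^bsub>A\<^esub> g \<in> supp_in D" if g: "g \<in> carrier A" for g
  proof (rule supp_inI)
    show "f \<otimes>\<^bsub>A\<^esub> g \<in> carrier A" using supp_inD(1)[OF f] g by (rule A.m_closed)
    show "b \<in> D" if "(f \<otimes>\<^bsub>A\<^esub> g) b \<noteq> \<zero>\<^bsub>k\<^esub>" for b
      using basis_mult_supp[OF supp_inD(1)[OF f] g that] supp_inD(2)[OF f]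
        basis_carrierD(2)[OF supp_inD(1)[OF f]] basis_carrierD(2)[OF g] assms by metis
  qed
qed

text \<open>The scalar \<open>r\<close> cancels the factor \<open>c e y\<close>, so
  \<open>r e\<close> is a left identity on the span of \<open>D\<close>. If \<open>e\<close> lies in
  \<open>D\<close>, then \<open>r e\<close> is idempotent.\<close>

lemma supp_in_fixed:
  assumes r: "r \<in> carrier k" and e: "e \<in> B"
    and fixed: "\<And>y. \<lbrakk>y \<in> D; y \<in> B\<rbrakk> \<Longrightarrow> p e y = y \<and> r \<otimes>\<^bsub>k\<^esub> c e y = \<one>\<^bsub>k\<^esub>" and f: "f \<in> supp_in D"
  shows "(r \<odot>\<^bsub>A\<^esub> single k e) \<otimes>\<^bsub>A\<^esub> f = f"
proof
  fix z
  let ?E = "r \<odot>\<^bsub>A\<^esub> single k e" and ?H = "{b. f b \<noteq> \<zero>\<^bsub>k\<^esub>}"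
  note fA = supp_inD(1)[OF f]
  have E: "?E \<in> carrier A" by (rule basis_smult_closed[OF r basis_single_closed[OF e]])
  have H: "finite ?H" "?H \<subseteq> B" using basis_carrierD[OF fA] by auto
  have HD: "p e y = y \<and> r \<otimes>\<^bsub>k\<^esub> c e y = \<one>\<^bsub>k\<^esub>" if "y \<in> ?H" for y
    using fixed[of y] supp_inD(2)[OF f, of y] H that by auto
  have supp: "{b. ?E b \<noteq> \<zero>\<^bsub>k\<^esub>} \<subseteq> {e}" using r by (auto simp: single_def)
  have idx: "{w \<in> {e} \<times> ?H. p (fst w) (snd w) = z} = (if f z \<noteq> \<zero>\<^bsub>k\<^esub> then {(e, z)} else {})"
    using HD by (auto split: if_splits)
  have "(?E \<otimes>\<^bsub>A\<^esub> f) z = (\<Oplus>\<^bsub>k\<^esub>w\<in>{w \<in> {e} \<times> ?H. p (fst w) (snd w) = z}.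
      ?E (fst w) \<otimes>\<^bsub>k\<^esub> f (snd w) \<otimes>\<^bsub>k\<^esub> c (fst w) (snd w))"
    by (rule basis_mult[OF E fA _ supp _ H(1) subset_refl H(2)]) (use e in auto)
  also have "\<dots> = f z"
  proof (cases "f z = \<zero>\<^bsub>k\<^esub>")
    case True
    then show ?thesis unfolding idx by simp
  next
    case False
    have fz: "f z \<in> carrier k" and cz: "c e z \<in> carrier k"
      using basis_carrierD(1)[OF fA] c_closed[OF e] H False by auto
    have "r \<otimes>\<^bsub>k\<^esub> f z \<otimes>\<^bsub>k\<^esub> c e z = f z \<otimes>\<^bsub>k\<^esub> (r \<otimes>\<^bsub>k\<^esub> c e z)" using r fz cz by (simp add: m_ac)
    also have "\<dots> = f z" using HD[of z] False fz by simp
    finally show ?thesis unfolding idx using False r fz cz by (simp add: single_def)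
  qed
  finally show "(?E \<otimes>\<^bsub>A\<^esub> f) z = f z" .
qed

lemma supp_in_mult_single:
  assumes r: "r \<in> carrier k" and e: "e \<in> B"
    and f: "f \<in> supp_in D" and D': "\<And>y. \<lbrakk>y \<in> D; y \<in> B\<rbrakk> \<Longrightarrow> p e y \<in> D'"
  shows "(r \<odot>\<^bsub>A\<^esub> single k e) \<otimes>\<^bsub>A\<^esub> f \<in> supp_in D'"
proof (rule supp_inI)
  interpret A: ring A by (rule ring)
  note fA = supp_inD(1)[OF f]
  have E: "r \<odot>\<^bsub>A\<^esub> single k e \<in> carrier A" by (rule basis_smult_closed[OF r basis_single_closed[OF e]])
  show "(r \<odot>\<^bsub>A\<^esub> single k e) \<otimes>\<^bsub>A\<^esub> f \<in> carrier A" by (rule A.m_closed[OF E fA])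
  fix b assume "((r \<odot>\<^bsub>A\<^esub> single k e) \<otimes>\<^bsub>A\<^esub> f) b \<noteq> \<zero>\<^bsub>k\<^esub>"
  then obtain x y where xy: "(r \<odot>\<^bsub>A\<^esub> single k e) x \<noteq> \<zero>\<^bsub>k\<^esub>" "f y \<noteq> \<zero>\<^bsub>k\<^esub>" "p x y = b"
    by (rule basis_mult_supp[OF E fA])
  then have "x = e" using r by (simp add: single_def split: if_splits)
  then show "b \<in> D'" using xy D' supp_inD(2)[OF f] basis_carrierD(2)[OF fA] by blast
qed

text \<open>The basis elements in \<open>D j g\<close> are those with a cup labelled \<open>g\<close> at the \<open>j\<close>-th place, and
  \<open>e j g\<close> is, up to the scalar \<open>r j g\<close>, an idempotent generating the right ideal they span. Cups
  at adjacent places exclude each other, so adding the \<open>j\<close>-th place to the places before it only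
  meets the places before \<open>j - 1\<close>.\<close>

lemma cups_span_exact:
  fixes D :: "nat \<Rightarrow> 'l \<Rightarrow> 'b set" and e :: "nat \<Rightarrow> 'l \<Rightarrow> 'b" and r :: "nat \<Rightarrow> 'l \<Rightarrow> 'k" and G :: "'l set"
  assumes res: "resolution A (aug_module k (aug T)) P d \<epsilon>" and proj: "\<And>i. projective A (P i)"
    and e: "\<And>j g. \<lbrakk>j < m; g \<in> G\<rbrakk> \<Longrightarrow> e j g \<in> D j g" and r: "\<And>j g. \<lbrakk>j < m; g \<in> G\<rbrakk> \<Longrightarrow> r j g \<in> carrier k"
    and D: "\<And>j g. \<lbrakk>j < m; g \<in> G\<rbrakk> \<Longrightarrow> D j g \<subseteq> B - T"
    and D_ideal: "\<And>j g x y. \<lbrakk>j < m; g \<in> G; x \<in> D j g; y \<in> B\<rbrakk> \<Longrightarrow> p x y \<in> D j g"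
    and fixed: "\<And>j g y. \<lbrakk>j < m; g \<in> G; y \<in> D j g\<rbrakk> \<Longrightarrow> p (e j g) y = y \<and> r j g \<otimes>\<^bsub>k\<^esub> c (e j g) y = \<one>\<^bsub>k\<^esub>"
    and disj: "\<And>j g h. \<lbrakk>j < m; g \<in> G; h \<in> G; g \<noteq> h\<rbrakk> \<Longrightarrow> D j g \<inter> D j h = {}"
    and adj: "\<And>j g h. \<lbrakk>Suc j < m; g \<in> G; h \<in> G\<rbrakk> \<Longrightarrow> D (Suc j) g \<inter> D j h = {}"
    and far: "\<And>i j g h y. \<lbrakk>Suc i < j; j < m; g \<in> G; h \<in> G; y \<in> D i h\<rbrakk> \<Longrightarrow> p (e j g) y \<in> D i h"
  shows "span_exact P d (supp_in (\<Union>j<m. \<Union>g\<in>G. D j g))"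
proof -
  interpret A: ring A by (rule ring)
  have M: "left_module A (aug_module k (aug T))" by (rule left_module_aug_module[OF res k.is_cring])
  \<comment> \<open>\<open>I j\<close> collects the cups at places before \<open>j\<close>;
    \<open>Y j S\<close> adds those at \<open>j\<close> with labels in \<open>S\<close>. The labels
    of one place are added one at a time.\<close>
  define I where "I j = (\<Union>i<j. \<Union>g\<in>G. D i g)" for j
  define Y where "Y j S = I j \<union> (\<Union>g\<in>S. D j g)" for j S
  have I_p: "p x y \<in> I j" if j: "j \<le> m" and x: "x \<in> I j" and y: "y \<in> B" for j x y
  proof -
    obtain i g where i: "i < j" "g \<in> G" "x \<in> D i g" using x by (auto simp: I_def)
    then have "p x y \<in> D i g" using D_ideal[of i g x y] j y by simp
    then show ?thesis using i by (auto simp: I_def)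
  qed
  have I_ideal: "right_ideal A (supp_in (I j))" if "j \<le> m" for j
    using I_p[OF that] by (intro supp_in_right_ideal)
  have Y_ideal: "right_ideal A (supp_in (Y j S))" if "j < m" "S \<subseteq> G" for j S
  proof (rule supp_in_right_ideal)
    fix x y assume x: "x \<in> Y j S" and y: "y \<in> B"
    show "p x y \<in> Y j S"
    proof (cases "x \<in> I j")
      case True
      then show ?thesis using I_p[of j x y] y that(1) by (simp add: Y_def)
    next
      case False
      then obtain g where "g \<in> S" "x \<in> D j g" using x by (auto simp: Y_def)
      moreover from this have "p x y \<in> D j g" using D_ideal[OF that(1), of g x y] that(2) y by blast
      ultimately show ?thesis by (auto simp: Y_def)
    qed
  qed
  have supp_mono: "supp_in C \<subseteq> supp_in C'" if "C \<subseteq> C'" for C C' using that by (auto simp: supp_in_def)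
  \<comment> \<open>The right ideals \<open>U\<close> and \<open>V\<close> of
    \<open>span_exact_step\<close> are the spans of \<open>Y j S\<close> and
    \<open>I (j - 1)\<close>. For j = 0 the truncated difference gives \<open>I 0\<close>, which is
    empty, as it should be: no place precedes.\<close>
  have step: "span_exact P d (supp_in (Y j (insert g S)))"
    if j: "j < m" and S: "S \<subseteq> G" and g: "g \<in> G" "g \<notin> S"
      and exY: "span_exact P d (supp_in (Y j S))" and exI: "span_exact P d (supp_in (I (j - 1)))" for j g S
  proof -
    let ?E = "r j g \<odot>\<^bsub>A\<^esub> single k (e j g)"
    have eB: "e j g \<in> B" and eT: "e j g \<notin> T" using e[OF j g(1)] D[OF j g(1)] by auto
    have rk: "r j g \<in> carrier k" by (rule r[OF j g(1)])
    have E: "?E \<in> carrier A" by (rule basis_smult_closed[OF rk basis_single_closed[OF eB]])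
    have fixE: "?E \<otimes>\<^bsub>A\<^esub> f = f" if "f \<in> supp_in (D j g)" for f
      by (rule supp_in_fixed[OF rk eB fixed[OF j g(1)] that])
    have ED: "?E \<otimes>\<^bsub>A\<^esub> f \<in> supp_in (D j g)" if "f \<in> carrier A" for f
    proof (rule supp_in_mult_single[OF rk eB])
      show "f \<in> supp_in B" using that basis_carrierD(2)[OF that] by (intro supp_inI)
      show "p (e j g) y \<in> D j g" if "y \<in> B" for y by (rule D_ideal[OF j g(1) e[OF j g(1)] that])
    qed
    have DY: "D j g \<inter> Y j S \<subseteq> I (j - 1)"
    proof
      fix x assume x: "x \<in> D j g \<inter> Y j S"
      have "x \<notin> D j h" if "h \<in> S" for h
        using disj[OF j g(1), of h] x S g(2) that by blast
      then obtain i h where ih: "i < j" "h \<in> G" "x \<in> D i h" using x by (auto simp: Y_def I_def)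
      have "Suc i \<noteq> j"
      proof
        assume "Suc i = j"
        then show False using adj[of i g h] j g(1) ih x by blast
      qed
      then have "i < j - 1" using ih(1) by linarith
      then show "x \<in> I (j - 1)" using ih by (auto simp: I_def)
    qed
    show ?thesis
    proof (rule span_exact_step[OF res proj M Y_ideal[OF j S] exY I_ideal exI E])
      show "j - 1 \<le> m" using j by simp
      show "?E \<otimes>\<^bsub>A\<^esub> ?E = ?E"
        by (rule fixE, rule supp_inI[OF E]) (use e[OF j g(1)] rk in \<open>auto simp: single_def split: if_splits\<close>)
      show "?E \<odot>\<^bsub>aug_module k (aug T)\<^esub> x = \<zero>\<^bsub>aug_module k (aug T)\<^esub>" if "x \<in> carrier (aug_module k (aug T))" for x
        using aug_single[OF rk, of T "e j g"] eT that by simp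
      show "supp_in (I (j - 1)) \<subseteq> supp_in (Y j S)" by (rule supp_mono) (auto simp: I_def Y_def)
      show "?E \<otimes>\<^bsub>A\<^esub> f \<in> supp_in (I (j - 1))" if "f \<in> supp_in (I (j - 1))" for f
      proof (rule supp_in_mult_single[OF rk eB that])
        fix y assume "y \<in> I (j - 1)"
        then obtain i h where "i < j - 1" and ih': "h \<in> G" "y \<in> D i h" by (auto simp: I_def)
        then have ih: "Suc i < j" "h \<in> G" "y \<in> D i h" by simp_all
        then show "p (e j g) y \<in> I (j - 1)" using far[OF ih(1) j g(1) ih(2,3)] by (auto simp: I_def)
      qed
      show "?E \<otimes>\<^bsub>A\<^esub> f \<in> supp_in (I (j - 1))" if "f \<in> carrier A" "?E \<otimes>\<^bsub>A\<^esub> f \<in> supp_in (Y j S)" for f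
        using supp_inD[OF ED[OF that(1)]] supp_inD(2)[OF that(2)] DY by (intro supp_inI) blast+
      show "supp_in (Y j (insert g S)) = {f \<oplus>\<^bsub>A\<^esub> ?E \<otimes>\<^bsub>A\<^esub> a | f a. f \<in> supp_in (Y j S) \<and> a \<in> carrier A}"
      proof (intro equalityI subsetI)
        fix f assume f: "f \<in> supp_in (Y j (insert g S))"
        note fA = supp_inD(1)[OF f]
        \<comment> \<open>The part of \<open>f\<close> outside \<open>Y j S\<close> is supported in
          \<open>D j g\<close>; so \<open>?E\<close> fixes it, and it is a multiple of
          \<open>?E\<close>.\<close>
        define f0 where "f0 b = (if b \<in> Y j S then f b else \<zero>\<^bsub>k\<^esub>)" for b
        define f1 where "f1 b = (if b \<in> Y j S then \<zero>\<^bsub>k\<^esub> else f b)" for b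
        have fin: "finite {b. f0 b \<noteq> \<zero>\<^bsub>k\<^esub>}" "finite {b. f1 b \<noteq> \<zero>\<^bsub>k\<^esub>}"
          by (rule finite_subset[OF _ basis_carrierD(3)[OF fA]]; auto simp: f0_def f1_def)+
        have f01: "f0 \<in> carrier A" "f1 \<in> carrier A"
          using fA fin by (auto simp: basis_carrier f0_def f1_def)
        have "f0 \<in> supp_in (Y j S)" using f01(1) by (rule supp_inI) (auto simp: f0_def split: if_splits)
        moreover have f1: "f1 \<in> supp_in (D j g)"
          using f01(2) supp_inD(2)[OF f] by (intro supp_inI) (auto simp: f1_def Y_def split: if_splits)
        moreover have "f = f0 \<oplus>\<^bsub>A\<^esub> ?E \<otimes>\<^bsub>A\<^esub> f1"
          unfolding fixE[OF f1] using basis_carrierD(1)[OF fA] by (auto simp: f0_def f1_def)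
        ultimately show "f \<in> {f \<oplus>\<^bsub>A\<^esub> ?E \<otimes>\<^bsub>A\<^esub> a | f a. f \<in> supp_in (Y j S) \<and> a \<in> carrier A}"
          using f01(2) by blast
      next
        fix f assume "f \<in> {f \<oplus>\<^bsub>A\<^esub> ?E \<otimes>\<^bsub>A\<^esub> a | f a. f \<in> supp_in (Y j S) \<and> a \<in> carrier A}"
        then obtain f0 a where f0: "f0 \<in> supp_in (Y j S)" and a: "a \<in> carrier A"
          and f: "f = f0 \<oplus>\<^bsub>A\<^esub> ?E \<otimes>\<^bsub>A\<^esub> a" by blast
        have "f0 \<in> supp_in (Y j (insert g S))" "?E \<otimes>\<^bsub>A\<^esub> a \<in> supp_in (Y j (insert g S))"
          using f0 ED[OF a] supp_mono[of "Y j S" "Y j (insert g S)"] supp_mono[of "D j g" "Y j (insert g S)"]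
          by (auto simp: Y_def simp del: basis_algebra_simps)
        then show "f \<in> supp_in (Y j (insert g S))"
          using Y_ideal[OF j, of "insert g S"] S g(1) unfolding f right_ideal_def by blast
      qed
    qed
  qed
  \<comment> \<open>The induction is strong because adding the place \<open>i\<close> needs
    exactness for \<open>I i\<close> and for \<open>I (i - 1)\<close>.\<close>
  have "span_exact P d (supp_in (I j))" if "j \<le> m" for j
    using that
  proof (induction j rule: less_induct)
    case (less j)
    show ?case
    proof (cases j)
      case 0
      have "supp_in (I 0) = {\<zero>\<^bsub>A\<^esub>}" using A.zero_closed by (auto simp: I_def supp_in_def)
      then show ?thesis using span_exact_zero[OF res] 0 by simp
    next
      case (Suc i)
      have i: "i < m" using less.prems Suc by simp
      have fin: "span_exact P d (supp_in (Y i S))" if "finite S" "S \<subseteq> G" for S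
        using that
      proof (induction S rule: finite_induct)
        case empty
        then show ?case using less.IH[of i] Suc i by (simp add: Y_def)
      next
        case (insert g S)
        then show ?case using step[OF i, of S g] less.IH[of "i - 1"] Suc i by auto
      qed
      \<comment> \<open>\<open>G\<close> may be infinite. Finite sets of labels are reached by
        single steps, and the whole place is their directed union, since every element has finite
        support.\<close>
      let ?J = "(\<lambda>S. supp_in (Y i S)) ` {S. finite S \<and> S \<subseteq> G}"
      have "supp_in (I (Suc i)) = \<Union>?J"
      proof (intro equalityI subsetI)
        fix f assume f: "f \<in> supp_in (I (Suc i))"
        have "\<exists>g\<in>G. b \<in> Y i {g}" if "f b \<noteq> \<zero>\<^bsub>k\<^esub>" for b
        proof -
          have "b \<in> I (Suc i)" by (rule supp_inD(2)[OF f that])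
          then obtain i' g where "i' < Suc i" "g \<in> G" "b \<in> D i' g" by (auto simp: I_def)
          then show ?thesis by (cases "i' = i") (force simp: Y_def I_def)+
        qed
        then obtain g where g: "\<And>b. f b \<noteq> \<zero>\<^bsub>k\<^esub> \<Longrightarrow> g b \<in> G \<and> b \<in> Y i {g b}" by metis
        have "f \<in> supp_in (Y i (g ` {b. f b \<noteq> \<zero>\<^bsub>k\<^esub>}))"
          using g by (intro supp_inI supp_inD(1)[OF f]) (auto simp: Y_def)
        then show "f \<in> \<Union>?J" using g basis_carrierD(3)[OF supp_inD(1)[OF f]] by blast
      next
        fix f assume "f \<in> \<Union>?J"
        then obtain S where S: "S \<subseteq> G" "f \<in> supp_in (Y i S)" by blast
        have "Y i S \<subseteq> I (Suc i)" using S(1) by (auto simp: Y_def I_def less_Suc_eq)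
        then show "f \<in> supp_in (I (Suc i))" using S(2) supp_mono by blast
      qed
      moreover have "span_exact P d (\<Union>?J)"
      proof (rule span_exact_directed_union)
        show "span_exact P d J" if "J \<in> ?J" for J using that fin by blast
        show "?J \<noteq> {}" by blast
        fix J K assume "J \<in> ?J" "K \<in> ?J"
        then obtain S S' where S: "finite S" "S \<subseteq> G" "finite S'" "S' \<subseteq> G"
          "J = supp_in (Y i S)" "K = supp_in (Y i S')" by blast
        have "J \<union> K \<subseteq> supp_in (Y i (S \<union> S'))"
          unfolding S(5,6) by (intro Un_least supp_mono) (auto simp: Y_def)
        then show "\<exists>L\<in>?J. J \<union> K \<subseteq> L" using S by (intro bexI[of _ "supp_in (Y i (S \<union> S'))"]) auto
      qed
      ultimately show ?thesis using Suc by simp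
    qed
  qed
  then show ?thesis by (simp add: I_def)
qed

end

text \<open>Forgetting the coefficients outside the image of \<open>L\<close> is multiplicative
  because of \<open>prime\<close>: a product reaches the image only if both factors lie in it, so
  the other basis elements span an ideal. For diagrams this is the projection onto the group
  algebra.\<close>

lemma restriction_ring_hom:
  assumes A: "basis_ring k B p c u" and B': "basis_ring k B' p' (\<lambda>x y. \<one>\<^bsub>k\<^esub>) u'"
    and L: "L \<in> B' \<rightarrow> B" "inj_on L B'"
    and prime: "\<And>x y. \<lbrakk>x \<in> B; y \<in> B; p x y \<in> L ` B'\<rbrakk> \<Longrightarrow> x \<in> L ` B' \<and> y \<in> L ` B'"
    and mult: "\<And>a b. \<lbrakk>a \<in> B'; b \<in> B'\<rbrakk> \<Longrightarrow> p (L a) (L b) = L (p' a b) \<and> c (L a) (L b) = \<one>\<^bsub>k\<^esub>"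
    and one: "L u' = u"
  defines "\<phi> \<equiv> \<lambda>f a. if a \<in> B' then f (L a) else \<zero>\<^bsub>k\<^esub>"
  shows "\<phi> \<in> ring_hom (basis_algebra k B p c u) (basis_algebra k B' p' (\<lambda>x y. \<one>\<^bsub>k\<^esub>) u')"
    and "\<phi> ` carrier (basis_algebra k B p c u) = carrier (basis_algebra k B' p' (\<lambda>x y. \<one>\<^bsub>k\<^esub>) u')"
    and "f \<in> carrier (basis_algebra k B p c u) \<Longrightarrow> basis_ring.aug k B' (\<phi> f) = basis_ring.aug k (L ` B') f"
    and "r \<in> carrier k \<Longrightarrow> \<phi> (r \<odot>\<^bsub>basis_algebra k B p c u\<^esub> \<one>\<^bsub>basis_algebra k B p c u\<^esub>) =
      r \<odot>\<^bsub>basis_algebra k B' p' (\<lambda>x y. \<one>\<^bsub>k\<^esub>) u'\<^esub> \<one>\<^bsub>basis_algebra k B' p' (\<lambda>x y. \<one>\<^bsub>k\<^esub>) u'\<^esub>"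
proof -
  interpret A: basis_ring k B p c u by fact
  interpret B': basis_ring k B' p' "\<lambda>x y. \<one>\<^bsub>k\<^esub>" u' by fact
  have LB: "L a \<in> B" if "a \<in> B'" for a using L(1) that by auto
  have Leq: "L a = L b \<longleftrightarrow> a = b" if "a \<in> B'" "b \<in> B'" for a b using L(2) that by (auto simp: inj_on_def)
  have fin: "finite {a \<in> B'. f (L a) \<noteq> \<zero>\<^bsub>k\<^esub>}" if "f \<in> carrier A.A" for f
  proof (rule finite_imageD)
    show "finite (L ` {a \<in> B'. f (L a) \<noteq> \<zero>\<^bsub>k\<^esub>})"
      by (rule finite_subset[OF _ A.basis_carrierD(3)[OF that]]) auto
    show "inj_on L {a \<in> B'. f (L a) \<noteq> \<zero>\<^bsub>k\<^esub>}" using L(2) by (rule inj_on_subset) auto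
  qed
  have supp: "{a. \<phi> f a \<noteq> \<zero>\<^bsub>k\<^esub>} = {a \<in> B'. f (L a) \<noteq> \<zero>\<^bsub>k\<^esub>}" for f by (auto simp: \<phi>_def)
  have closed: "\<phi> f \<in> carrier B'.A" if "f \<in> carrier A.A" for f
    unfolding B'.basis_carrier supp using fin[OF that] A.basis_carrierD(1)[OF that] by (auto simp: \<phi>_def)
  show "\<phi> \<in> ring_hom A.A B'.A"
  proof (rule ring_hom_memI)
    show "\<phi> f \<in> carrier B'.A" if "f \<in> carrier A.A" for f using that by (rule closed)
    show "\<phi> (f \<oplus>\<^bsub>A.A\<^esub> g) = \<phi> f \<oplus>\<^bsub>B'.A\<^esub> \<phi> g" for f g by (auto simp: \<phi>_def)
    show "\<phi> \<one>\<^bsub>A.A\<^esub> = \<one>\<^bsub>B'.A\<^esub>"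
      using B'.u_closed Leq[OF _ B'.u_closed] by (auto simp: \<phi>_def single_def one)
    fix f g assume f: "f \<in> carrier A.A" and g: "g \<in> carrier A.A"
    let ?F = "{x. f x \<noteq> \<zero>\<^bsub>k\<^esub>}" and ?G = "{x. g x \<noteq> \<zero>\<^bsub>k\<^esub>}"
    let ?F' = "{a \<in> B'. f (L a) \<noteq> \<zero>\<^bsub>k\<^esub>}" and ?G' = "{a \<in> B'. g (L a) \<noteq> \<zero>\<^bsub>k\<^esub>}"
    have F: "?F \<subseteq> B" "?G \<subseteq> B" using A.basis_carrierD(2)[OF f] A.basis_carrierD(2)[OF g] by auto
    show "\<phi> (f \<otimes>\<^bsub>A.A\<^esub> g) = \<phi> f \<otimes>\<^bsub>B'.A\<^esub> \<phi> g"
    proof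
      fix a
      show "\<phi> (f \<otimes>\<^bsub>A.A\<^esub> g) a = (\<phi> f \<otimes>\<^bsub>B'.A\<^esub> \<phi> g) a"
      proof (cases "a \<in> B'")
        case False
        have "(\<phi> f \<otimes>\<^bsub>B'.A\<^esub> \<phi> g) a = \<zero>\<^bsub>k\<^esub>"
          using B'.basis_carrierD(2)[OF ring.ring_simprules(5)[OF B'.ring closed[OF f] closed[OF g]], of a] False
          by blast
        then show ?thesis using False by (simp only: \<phi>_def if_False)
      next
        case a: True
        let ?m = "\<lambda>w. (L (fst w), L (snd w))"
        let ?W = "{w \<in> ?F' \<times> ?G'. p' (fst w) (snd w) = a}"
        \<comment> \<open>By \<open>prime\<close>, the pairs that contribute to the coefficient at
          \<open>L a\<close> are the images of those that contribute at \<open>a\<close>; so the two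
          sums match term by term.\<close>
        have img: "?m ` ?W = {w \<in> ?F \<times> ?G. p (fst w) (snd w) = L a}"
        proof (intro equalityI subsetI)
          fix w assume "w \<in> ?m ` ?W"
          then show "w \<in> {w \<in> ?F \<times> ?G. p (fst w) (snd w) = L a}" using mult by auto
        next
          fix w assume w: "w \<in> {w \<in> ?F \<times> ?G. p (fst w) (snd w) = L a}"
          then have "fst w \<in> L ` B' \<and> snd w \<in> L ` B'" using prime[of "fst w" "snd w"] subsetD[OF F(1), of "fst w"] subsetD[OF F(2), of "snd w"] a by auto
          then obtain b b' where b: "b \<in> B'" "b' \<in> B'" "fst w = L b" "snd w = L b'" by blast
          then have "L (p' b b') = L a" using w mult[OF b(1,2)] by simp
          then have "p' b b' = a" using Leq[OF B'.p_closed[OF b(1,2)] a] by simp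
          then have "(b, b') \<in> ?W" using w b by auto
          moreover have "w = ?m (b, b')" using b by (simp add: prod_eq_iff)
          ultimately show "w \<in> ?m ` ?W" by blast
        qed
        have inj: "inj_on ?m ?W" using Leq by (auto simp: inj_on_def)
        have "(f \<otimes>\<^bsub>A.A\<^esub> g) (L a) = (\<Oplus>\<^bsub>k\<^esub>w\<in>?m ` ?W. f (fst w) \<otimes>\<^bsub>k\<^esub> g (snd w) \<otimes>\<^bsub>k\<^esub> c (fst w) (snd w))"
          unfolding img
          by (rule A.basis_mult[OF f g A.basis_carrierD(3)[OF f] subset_refl F(1) A.basis_carrierD(3)[OF g] subset_refl F(2)])
        also have "\<dots> = (\<Oplus>\<^bsub>k\<^esub>w\<in>?W. f (L (fst w)) \<otimes>\<^bsub>k\<^esub> g (L (snd w)) \<otimes>\<^bsub>k\<^esub> c (L (fst w)) (L (snd w)))"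
          by (subst A.k.finsum_reindex[OF _ inj])
            (use A.basis_carrierD(1)[OF f] A.basis_carrierD(1)[OF g] A.c_closed LB in auto)
        also have "\<dots> = (\<Oplus>\<^bsub>k\<^esub>w\<in>?W. \<phi> f (fst w) \<otimes>\<^bsub>k\<^esub> \<phi> g (snd w) \<otimes>\<^bsub>k\<^esub> \<one>\<^bsub>k\<^esub>)"
          using A.basis_carrierD(1)[OF f] A.basis_carrierD(1)[OF g] mult
          by (intro A.k.finsum_cong') (auto simp: \<phi>_def)
        also have "\<dots> = (\<phi> f \<otimes>\<^bsub>B'.A\<^esub> \<phi> g) a"
          by (rule B'.basis_mult[OF closed[OF f] closed[OF g], symmetric]) (use fin[OF f] fin[OF g] in \<open>auto simp: supp\<close>)
        finally show ?thesis using a by (simp add: \<phi>_def)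
      qed
    qed
  qed
  show "\<phi> ` carrier A.A = carrier B'.A"
  proof
    show "\<phi> ` carrier A.A \<subseteq> carrier B'.A" using closed by auto
    show "carrier B'.A \<subseteq> \<phi> ` carrier A.A"
    proof
      fix h assume h: "h \<in> carrier B'.A"
      define f where "f b = (if b \<in> L ` B' then h (inv_into B' L b) else \<zero>\<^bsub>k\<^esub>)" for b
      have fL: "f (L a) = h a" if "a \<in> B'" for a using that L(2) by (simp add: f_def)
      have "{b. f b \<noteq> \<zero>\<^bsub>k\<^esub>} \<subseteq> L ` {a. h a \<noteq> \<zero>\<^bsub>k\<^esub>}" using fL by (auto simp: f_def split: if_splits)
      then have "finite {b. f b \<noteq> \<zero>\<^bsub>k\<^esub>}" using B'.basis_carrierD(3)[OF h] by (meson finite_imageI finite_subset)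
      then have "f \<in> carrier A.A"
        using B'.basis_carrierD(1)[OF h] LB unfolding A.basis_carrier by (auto simp: f_def)
      moreover have "\<phi> f a = h a" for a
      proof (cases "a \<in> B'")
        case False
        then have "h a = \<zero>\<^bsub>k\<^esub>" using B'.basis_carrierD(2)[OF h, of a] by blast
        then show ?thesis using False by (simp add: \<phi>_def)
      qed (simp add: \<phi>_def fL)
      ultimately show "h \<in> \<phi> ` carrier A.A" by (intro image_eqI[of _ _ f]) auto
    qed
  qed
  show "B'.aug B' (\<phi> f) = A.aug (L ` B') f" if f: "f \<in> carrier A.A"
  proof -
    have img: "L ` {a \<in> B'. \<phi> f a \<noteq> \<zero>\<^bsub>k\<^esub>} = {b \<in> L ` B'. f b \<noteq> \<zero>\<^bsub>k\<^esub>}" by (auto simp: \<phi>_def)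
    have inj: "inj_on L {a \<in> B'. \<phi> f a \<noteq> \<zero>\<^bsub>k\<^esub>}" using L(2) by (rule inj_on_subset) auto
    have "A.aug (L ` B') f = (\<Oplus>\<^bsub>k\<^esub>a\<in>{a \<in> B'. \<phi> f a \<noteq> \<zero>\<^bsub>k\<^esub>}. f (L a))"
      unfolding A.aug_def img[symmetric]
      by (rule A.k.finsum_reindex[OF _ inj]) (use A.basis_carrierD(1)[OF f] in auto)
    also have "\<dots> = B'.aug B' (\<phi> f)"
      unfolding B'.aug_def using A.basis_carrierD(1)[OF f] by (intro A.k.finsum_cong') (auto simp: \<phi>_def)
    finally show ?thesis ..
  qed
  show "\<phi> (r \<odot>\<^bsub>A.A\<^esub> \<one>\<^bsub>A.A\<^esub>) = r \<odot>\<^bsub>B'.A\<^esub> \<one>\<^bsub>B'.A\<^esub>" if "r \<in> carrier k"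
    using that B'.u_closed Leq[OF _ B'.u_closed] by (auto simp: \<phi>_def single_def one)
qed

section \<open>Planar diagrams\<close>

lemma closed_segment_component:
  fixes a b z :: "real ^ 'n"
  assumes "z \<in> closed_segment a b" "l \<le> a $ i" "l \<le> b $ i" "a $ i \<le> m" "b $ i \<le> m"
  shows "l \<le> z $ i \<and> z $ i \<le> m"
proof -
  obtain u where u: "0 \<le> u" "u \<le> 1" "z = (1 - u) *\<^sub>R a + u *\<^sub>R b" using assms(1) by (auto simp: in_segment)
  have z: "z $ i = (1 - u) * a $ i + u * b $ i" using u(3) by simp
  have "(1 - u) * l + u * l \<le> z $ i" unfolding z using u assms by (intro add_mono mult_left_mono) auto
  moreover have "z $ i \<le> (1 - u) * m + u * m" unfolding z using u assms by (intro add_mono mult_left_mono) auto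
  ultimately show ?thesis by (simp add: algebra_simps)
qed

lemma point_component [simp]: "point v $ 1 = real (fst v)" "point v $ 2 = real (snd v)"
  by (simp_all add: point_def)

lemma vec2_eq_iff: "(x :: real ^ 2) = y \<longleftrightarrow> x $ 1 = y $ 1 \<and> x $ 2 = y $ 2"
  by (auto simp: vec_eq_iff forall_2)

lemma point_eq_iff [simp]: "point v = point w \<longleftrightarrow> v = w"
  by (auto simp: vec2_eq_iff prod_eq_iff)

text \<open>The cyclic order around the strip: up the left column, then down the right one.\<close>

definition position :: "nat \<Rightarrow> node \<Rightarrow> nat" where
  "position n v = (if fst v = 0 then snd v else 2 * n - 1 - snd v)"

text \<open>Every node of the right column is joined to the line through the left column by a path
  around the strip, above height \<open>M\<close>. This reduces crossings of arcs between any four nodes to the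
  case of four nodes on one side of a rectangle.\<close>

definition detour_height :: "nat \<Rightarrow> real \<Rightarrow> node \<Rightarrow> real" where
  "detour_height n M v = (if fst v = 0 then real (snd v) else M + real n - real (snd v))"

definition detour :: "nat \<Rightarrow> real \<Rightarrow> node \<Rightarrow> real \<Rightarrow> real ^ 2" where
  "detour n M v = (if fst v = 0 then linepath (point v) (point v)
     else linepath (point v) (vector [1 + real n - real (snd v), real (snd v)]) +++
       linepath (vector [1 + real n - real (snd v), real (snd v)])
         (vector [1 + real n - real (snd v), M + real n - real (snd v)]) +++
       linepath (vector [1 + real n - real (snd v), M + real n - real (snd v)])
         (vector [0, M + real n - real (snd v)]))"

definition detour_region :: "nat \<Rightarrow> real \<Rightarrow> node \<Rightarrow> (real ^ 2) set" where
  "detour_region n M v = (if fst v = 0 then {point v}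
     else {z. z $ 2 = real (snd v) \<and> 1 \<le> z $ 1 \<and> z $ 1 \<le> 1 + real n - real (snd v) \<or>
       z $ 1 = 1 + real n - real (snd v) \<and> real (snd v) \<le> z $ 2 \<and> z $ 2 \<le> M + real n - real (snd v) \<or>
       z $ 2 = M + real n - real (snd v) \<and> 0 \<le> z $ 1 \<and> z $ 1 \<le> 1 + real n - real (snd v)})"

lemma detour_path:
  assumes "fst v \<in> {0, 1}"
  shows "path (detour n M v)" "pathstart (detour n M v) = point v"
    "pathfinish (detour n M v) = vector [0, detour_height n M v]"
  using assms by (auto simp: detour_def detour_height_def vec2_eq_iff)

lemma detour_image:
  assumes v: "v \<in> {0, 1} \<times> {..<n}" and M: "real n \<le> M"
  shows "path_image (detour n M v) \<subseteq> detour_region n M v"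
proof (cases "fst v = 0")
  case True
  then show ?thesis by (simp add: detour_def detour_region_def)
next
  case False
  let ?j = "real (snd v)" let ?a = "1 + real n - ?j" and ?b = "M + real n - ?j"
  let ?P = "point v" and ?Q = "vector [?a, ?j] :: real ^ 2" and ?R = "vector [?a, ?b] :: real ^ 2"
    and ?S = "vector [0, ?b] :: real ^ 2"
  have v1: "fst v = 1" "?j < real n" using v False by (auto simp: mem_Times_iff)
  have "path_image (detour n M v) = closed_segment ?P ?Q \<union> (closed_segment ?Q ?R \<union> closed_segment ?R ?S)"
    using False by (simp add: detour_def path_image_join)
  moreover have "z \<in> detour_region n M v" if "z \<in> closed_segment ?P ?Q" for z
    using closed_segment_component[OF that, of 1 1 ?a] closed_segment_component[OF that, of ?j 2 ?j] v1 False
    by (simp add: detour_region_def)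
  moreover have "z \<in> detour_region n M v" if "z \<in> closed_segment ?Q ?R" for z
    using closed_segment_component[OF that, of ?a 1 ?a] closed_segment_component[OF that, of ?j 2 ?b] v1 False M
    by (simp add: detour_region_def)
  moreover have "z \<in> detour_region n M v" if "z \<in> closed_segment ?R ?S" for z
    using closed_segment_component[OF that, of 0 1 ?a] closed_segment_component[OF that, of ?b 2 ?b] v1 False M
    by (simp add: detour_region_def)
  ultimately show ?thesis by blast
qed

text \<open>Among nodes of the right column, the higher one turns back earlier and lower, so the
  detours are nested. They reach the line of the left column only above height \<open>M\<close>,
  where no left node lies.\<close>

lemma detour_region_disjoint:
  assumes "v \<in> {0, 1} \<times> {..<n}" "w \<in> {0, 1} \<times> {..<n}" "v \<noteq> w" "real n \<le> M"
  shows "detour_region n M v \<inter> detour_region n M w = {}"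
proof -
  have lt: "detour_region n M v \<inter> detour_region n M w = {}"
    if "fst v = 1" "fst w = 1" "snd v < snd w" "snd w < n" for v w
  proof -
    have "real (snd v) < real (snd w)" "real (snd w) < real n" using that by auto
    then show ?thesis using that assms(4) by (auto simp: detour_region_def)
  qed
  have zero: "detour_region n M v \<inter> detour_region n M w = {}" if "fst v = 0" "fst w = 1" "snd v < n" "snd w < n" for v w
  proof -
    have "real (snd v) < real n" "real (snd w) < real n" using that by auto
    then show ?thesis using that assms(4) by (auto simp: detour_region_def)
  qed
  have "v = w" if "fst v = fst w" "snd v = snd w" using that by (simp add: prod_eq_iff)
  then show ?thesis
    using assms lt[of v w] lt[of w v] zero[of v w] zero[of w v]
    by (auto simp: mem_Times_iff detour_region_def elim!: linorder_neqE_nat[of "snd v" "snd w"])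
qed

text \<open>This is \<open>fashoda_interlace\<close> after exchanging the coordinates: all four ends
  lie on one side of a box that contains both paths.\<close>

lemma no_interlace:
  fixes f g :: "real \<Rightarrow> real ^ 2"
  assumes "path f" "path g"
    and "\<And>z. z \<in> path_image f \<union> path_image g \<Longrightarrow> 0 \<le> z $ 1"
    and "pathstart f $ 1 = 0" "pathfinish f $ 1 = 0" "pathstart g $ 1 = 0" "pathfinish g $ 1 = 0"
    and "pathstart f $ 2 < pathstart g $ 2" "pathstart g $ 2 < pathfinish f $ 2"
      "pathfinish f $ 2 < pathfinish g $ 2"
  shows "path_image f \<inter> path_image g \<noteq> {}"
proof -
  define s :: "real ^ 2 \<Rightarrow> real ^ 2" where "s z = vector [z $ 2, z $ 1]" for z
  have s: "s z $ 1 = z $ 2" "s z $ 2 = z $ 1" for z by (simp_all add: s_def)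
  have "linear s" by (rule linearI) (simp_all add: vec2_eq_iff s)
  then have cont: "continuous_on S s" for S by (rule linear_continuous_on_compose[OF continuous_on_id, simplified])
  have inj: "s z = s w \<longleftrightarrow> z = w" for z w by (auto simp: vec2_eq_iff s)
  have "bounded (path_image f \<union> path_image g)"
    using assms(1,2) by (simp add: bounded_path_image)
  then obtain K where K: "\<And>z. z \<in> path_image f \<union> path_image g \<Longrightarrow> norm z \<le> K" by (auto simp: bounded_iff)
  have comp: "\<bar>z $ i\<bar> \<le> K" if "z \<in> path_image f \<union> path_image g" for z i
    using component_le_norm_cart[of z i] K[OF that] by linarith
  let ?a = "vector [-K, 0] :: real ^ 2" and ?b = "vector [K, K] :: real ^ 2"
  have box: "s z \<in> cbox ?a ?b" if "z \<in> path_image f \<union> path_image g" for z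
    using comp[OF that, of 1] comp[OF that, of 2] assms(3)[OF that]
    by (auto simp: mem_box_cart forall_2 s)
  have ends: "pathstart (s \<circ> h) = s (pathstart h)" "pathfinish (s \<circ> h) = s (pathfinish h)"
    "path_image (s \<circ> h) = s ` path_image h" for h
    by (simp_all add: pathstart_def pathfinish_def path_image_compose)
  obtain z where "z \<in> path_image (s \<circ> f)" "z \<in> path_image (s \<circ> g)"
  proof (rule fashoda_interlace[of "s \<circ> f" "s \<circ> g" ?a ?b])
    show "path (s \<circ> f)" "path (s \<circ> g)" using assms(1,2) by (auto intro: path_continuous_image cont)
    show "path_image (s \<circ> f) \<subseteq> cbox ?a ?b" "path_image (s \<circ> g) \<subseteq> cbox ?a ?b"
      using box by (auto simp: ends)
  qed (use assms in \<open>auto simp: ends s\<close>)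
  then show ?thesis using inj by (auto simp: ends)
qed

text \<open>Prolonged by the detours of their ends, the two arcs become paths in the half plane with
  interlaced ends on its boundary, so they meet. But the arcs, and the detours of four distinct
  nodes, are disjoint from each other across the two paths.\<close>

lemma planar_noncrossing:
  fixes E :: "'g diagram"
  assumes planar: "planar E" and ab: "({a, b}, g) \<in> E" and cd: "({c, d}, h) \<in> E"
    and nodes: "{a, b, c, d} \<subseteq> {0, 1} \<times> {..<n}"
    and order: "position n a < position n c" "position n c < position n b" "position n b < position n d"
  shows False
proof -
  obtain \<gamma> :: "node set \<times> 'g \<Rightarrow> real \<Rightarrow> real ^ 2" where
    "(\<forall>x\<in>E. arc (\<gamma> x) \<and> {pathstart (\<gamma> x), pathfinish (\<gamma> x)} = point ` fst x \<and>
        path_image (\<gamma> x) - point ` fst x \<subseteq> {z. 0 < z $ 1 \<and> z $ 1 < 1}) \<and>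
     (\<forall>x\<in>E. \<forall>y\<in>E. x \<noteq> y \<longrightarrow> path_image (\<gamma> x) \<inter> path_image (\<gamma> y) = {})"
    using planar unfolding planar_def by (elim exE)
  then have gamma: "\<And>x. x \<in> E \<Longrightarrow> arc (\<gamma> x) \<and> {pathstart (\<gamma> x), pathfinish (\<gamma> x)} = point ` fst x \<and>
        path_image (\<gamma> x) - point ` fst x \<subseteq> {z. 0 < z $ 1 \<and> z $ 1 < 1}"
    and disj: "\<And>x y. \<lbrakk>x \<in> E; y \<in> E; x \<noteq> y\<rbrakk> \<Longrightarrow> path_image (\<gamma> x) \<inter> path_image (\<gamma> y) = {}"
    by simp_all
  have oriented: "\<exists>f. path f \<and> pathstart f = point u \<and> pathfinish f = point v \<and> path_image f = path_image (\<gamma> x)"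
    if "x \<in> E" "fst x = {u, v}" for x u v
  proof -
    have "path (\<gamma> x)" using gamma[OF that(1)] arc_imp_path by blast
    moreover have "{pathstart (\<gamma> x), pathfinish (\<gamma> x)} = {point u, point v}" using gamma[OF that(1)] that(2) by simp
    ultimately have "path (\<gamma> x)" "(pathstart (\<gamma> x) = point u \<and> pathfinish (\<gamma> x) = point v) \<or>
        (pathstart (\<gamma> x) = point v \<and> pathfinish (\<gamma> x) = point u)"
      by (auto simp: doubleton_eq_iff)
    then show ?thesis
      using exI[of _ "\<gamma> x"] exI[of _ "reversepath (\<gamma> x)"] by (elim disjE) simp_all
  qed
  obtain f where f: "path f" "pathstart f = point a" "pathfinish f = point b" "path_image f = path_image (\<gamma> ({a, b}, g))"
    using oriented[OF ab, of a b] by auto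
  obtain f' where f': "path f'" "pathstart f' = point c" "pathfinish f' = point d" "path_image f' = path_image (\<gamma> ({c, d}, h))"
    using oriented[OF cd, of c d] by auto
  have ne: "a \<noteq> c" "a \<noteq> d" "b \<noteq> c" "b \<noteq> d" using order by auto
  have "bounded (path_image f \<union> path_image f')" using f(1) f'(1) by (simp add: bounded_path_image)
  then obtain K where K: "\<And>z. z \<in> path_image f \<union> path_image f' \<Longrightarrow> norm z \<le> K" by (auto simp: bounded_iff)
  \<comment> \<open>At least as high as every point of both arcs and above all nodes, so that the
    top legs of the detours pass over everything.\<close>
  define M where "M = max K (real n)"
  have M: "real n \<le> M" by (simp add: M_def)
  have low: "z $ 2 \<le> M" if "z \<in> path_image f \<union> path_image f'" for z
    using component_le_norm_cart[of z 2] K[OF that] by (simp add: M_def)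
  have strip: "z \<in> {point a, point b} \<or> 0 < z $ 1 \<and> z $ 1 < 1" if "z \<in> path_image f" for z
    using gamma[OF ab] that by (auto simp: f(4))
  have strip': "z \<in> {point c, point d} \<or> 0 < z $ 1 \<and> z $ 1 < 1" if "z \<in> path_image f'" for z
    using gamma[OF cd] that by (auto simp: f'(4))
  \<comment> \<open>An arc meets the line of the right column at most in its own ends, never goes
    beyond it, and stays below the top legs. So it avoids the detours of all other nodes.\<close>
  have region: "z \<notin> detour_region n M v"
    if v: "v \<in> {0, 1} \<times> {..<n}" and z: "z \<in> {point u, point w} \<or> 0 < z $ 1 \<and> z $ 1 < 1" "z $ 2 \<le> M"
      and uw: "u \<in> {0, 1} \<times> {..<n}" "w \<in> {0, 1} \<times> {..<n}" "v \<noteq> u" "v \<noteq> w" for z u v w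
  proof (cases "fst v = 0")
    case True
    then show ?thesis using z uw by (auto simp: detour_region_def)
  next
    case False
    then have v1: "fst v = 1" "real (snd v) < real n" using v by (auto simp: mem_Times_iff)
    have "z $ 1 \<le> 1" using z(1) uw(1,2) by (auto simp: mem_Times_iff)
    moreover have "\<not> (z $ 1 = 1 \<and> z $ 2 = real (snd v))"
    proof
      assume "z $ 1 = 1 \<and> z $ 2 = real (snd v)"
      then have "z = point v" using v1 by (simp add: vec2_eq_iff)
      then show False using z(1) uw(3,4) v1 by auto
    qed
    ultimately show ?thesis using v1 z(2) by (auto simp: detour_region_def)
  qed
  define F where "F = reversepath (detour n M a) +++ f +++ detour n M b"
  define F' where "F' = reversepath (detour n M c) +++ f' +++ detour n M d"
  have fst01: "fst a \<in> {0, 1}" "fst b \<in> {0, 1}" "fst c \<in> {0, 1}" "fst d \<in> {0, 1}" using nodes by auto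
  note det = detour_path[OF fst01(1)] detour_path[OF fst01(2)] detour_path[OF fst01(3)] detour_path[OF fst01(4)]
  have im: "path_image F = path_image (detour n M a) \<union> (path_image f \<union> path_image (detour n M b))"
    "path_image F' = path_image (detour n M c) \<union> (path_image f' \<union> path_image (detour n M d))"
    using f f' det by (simp_all add: F_def F'_def path_image_join)
  have nd: "a \<in> {0, 1} \<times> {..<n}" "b \<in> {0, 1} \<times> {..<n}" "c \<in> {0, 1} \<times> {..<n}" "d \<in> {0, 1} \<times> {..<n}" using nodes by auto
  note sub = detour_image[OF nd(1) M] detour_image[OF nd(2) M] detour_image[OF nd(3) M] detour_image[OF nd(4) M]
  have pos: "0 \<le> z $ 1" if "z \<in> detour_region n M v" "v \<in> {0, 1} \<times> {..<n}" for z v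
  proof -
    have "real (snd v) < real n" using that(2) by (auto simp: mem_Times_iff)
    then show ?thesis using that(1) by (auto simp: detour_region_def split: if_splits)
  qed
  \<comment> \<open>The detours end on the left line in the order of \<open>position\<close>: left
    nodes first, then the right ones from the top down, as \<open>M\<close> is at least n.\<close>
  have height: "detour_height n M v < detour_height n M w"
    if "position n v < position n w" "v \<in> {0, 1} \<times> {..<n}" "w \<in> {0, 1} \<times> {..<n}" for v w
  proof -
    have "snd v < n" "snd w < n" "fst v \<in> {0, 1}" "fst w \<in> {0, 1}" using that(2,3) by (auto simp: mem_Times_iff)
    then show ?thesis using that(1) M by (auto simp: detour_height_def position_def split: if_splits)
  qed
  have meet: "path_image F \<inter> path_image F' \<noteq> {}"
  proof (rule no_interlace)
    show "path F" "path F'" using f f' det by (simp_all add: F_def F'_def)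
    show "0 \<le> z $ 1" if "z \<in> path_image F \<union> path_image F'" for z
    proof -
      have "z \<in> path_image f \<union> path_image f' \<or> (\<exists>v\<in>{a, b, c, d}. z \<in> detour_region n M v)"
        using that sub unfolding im by blast
      then show ?thesis using pos nd strip[of z] strip'[of z] by (elim disjE UnE bexE) auto
    qed
  qed (use det order height nd in \<open>simp_all add: F_def F'_def\<close>)
  obtain z where z: "z \<in> path_image F" "z \<in> path_image F'" using meet by blast
  have zF: "z \<in> path_image f \<or> (\<exists>v\<in>{a, b}. z \<in> detour_region n M v)"
    using z(1) sub(1,2) unfolding im by blast
  have zF': "z \<in> path_image f' \<or> (\<exists>v\<in>{c, d}. z \<in> detour_region n M v)"
    using z(2) sub(3,4) unfolding im by blast
  have "z \<notin> path_image f \<or> z \<notin> path_image f'"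
    using disj[OF ab cd] ne unfolding f(4) f'(4) by (auto simp: doubleton_eq_iff)
  moreover have "z \<notin> detour_region n M v" if v: "v \<in> {c, d}" and "z \<in> path_image f" for v
  proof -
    have "v \<in> {0, 1} \<times> {..<n}" "v \<noteq> a" "v \<noteq> b" using v nd ne by auto
    then show ?thesis using region[OF _ strip[OF that(2)] low nd(1,2)] that(2) by simp
  qed
  moreover have "z \<notin> detour_region n M v" if v: "v \<in> {a, b}" and "z \<in> path_image f'" for v
  proof -
    have "v \<in> {0, 1} \<times> {..<n}" "v \<noteq> c" "v \<noteq> d" using v nd ne by auto
    then show ?thesis using region[OF _ strip'[OF that(2)] low nd(3,4)] that(2) by simp
  qed
  moreover have "z \<notin> detour_region n M v \<or> z \<notin> detour_region n M w"
    if v: "v \<in> {a, b}" and w: "w \<in> {c, d}" for v w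
  proof -
    have "v \<in> {0, 1} \<times> {..<n}" "w \<in> {0, 1} \<times> {..<n}" "v \<noteq> w" using v w nd ne by auto
    then show ?thesis using detour_region_disjoint[of v n w M] M by blast
  qed
  ultimately show False using zF zF' by metis
qed

section \<open>Explicit drawings of diagrams with short edges\<close>

definition curve :: "(real \<Rightarrow> real) \<Rightarrow> (real \<Rightarrow> real) \<Rightarrow> real \<Rightarrow> real ^ 2" where
  "curve f g t = f t *\<^sub>R axis 1 1 + g t *\<^sub>R axis 2 1"

lemma curve_component [simp]: "curve f g t $ 1 = f t" "curve f g t $ 2 = g t"
  by (simp_all add: curve_def axis_def)

lemma curve_arc:
  assumes "continuous_on {0..1} f" "continuous_on {0..1} g" "inj_on f {0..1} \<or> inj_on g {0..1}"
  shows "arc (curve f g)"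
proof -
  have "continuous_on {0..1} (\<lambda>t. curve f g t)"
    unfolding curve_def using assms by (intro continuous_intros)
  moreover have "inj_on (curve f g) {0..1}"
    using assms(3) by (auto simp: inj_on_def vec2_eq_iff)
  ultimately show ?thesis by (simp add: arc_def path_def)
qed

text \<open>The only edges in the diagrams whose planarity has to be shown: straight strands, and
  cups and caps between adjacent nodes.\<close>

definition simple_edge :: "node set \<Rightarrow> bool" where
  "simple_edge e \<longleftrightarrow> (\<exists>i. e = {(0, i), (1, i)} \<or> e = {(0, i), (0, Suc i)} \<or> e = {(1, i), (1, Suc i)})"

text \<open>Cups and caps are drawn as the bow t (1 - t), whose maximum is 1/4. The bounds 1/4 and
  3/4 thus keep a left bow and a right bow at the same height apart; disjoint edges of the other
  kinds are separated by their heights.\<close>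

definition edge_region :: "node set \<Rightarrow> (real ^ 2) set" where
  "edge_region e = {z. \<exists>i. e = {(0, i), (1, i)} \<and> z $ 2 = real i \<or>
     e = {(0, i), (0, Suc i)} \<and> real i \<le> z $ 2 \<and> z $ 2 \<le> real i + 1 \<and> z $ 1 \<le> 1 / 4 \<or>
     e = {(1, i), (1, Suc i)} \<and> real i \<le> z $ 2 \<and> z $ 2 \<le> real i + 1 \<and> 3 / 4 \<le> z $ 1}"

lemma edge_region_disjoint:
  assumes "simple_edge e" "simple_edge e'" "e \<inter> e' = {}"
  shows "edge_region e \<inter> edge_region e' = {}"
proof (rule equals0I)
  fix z assume z: "z \<in> edge_region e \<inter> edge_region e'"
  then obtain i j where
    i: "e = {(0, i), (1, i)} \<and> z $ 2 = real i \<or>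
     e = {(0, i), (0, Suc i)} \<and> real i \<le> z $ 2 \<and> z $ 2 \<le> real i + 1 \<and> z $ 1 \<le> 1 / 4 \<or>
     e = {(1, i), (1, Suc i)} \<and> real i \<le> z $ 2 \<and> z $ 2 \<le> real i + 1 \<and> 3 / 4 \<le> z $ 1"
    and j: "e' = {(0, j), (1, j)} \<and> z $ 2 = real j \<or>
     e' = {(0, j), (0, Suc j)} \<and> real j \<le> z $ 2 \<and> z $ 2 \<le> real j + 1 \<and> z $ 1 \<le> 1 / 4 \<or>
     e' = {(1, j), (1, Suc j)} \<and> real j \<le> z $ 2 \<and> z $ 2 \<le> real j + 1 \<and> 3 / 4 \<le> z $ 1"
    unfolding edge_region_def by blast
  consider "j < i" "Suc j \<noteq> i" | "Suc j = i" | "i = j" | "Suc i = j" | "i < j" "Suc i \<noteq> j" by linarith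
  then show False
  proof cases
    case 1
    then have "real j + 1 < real i" by linarith
    then show False using i j by (elim disjE conjE) auto
  next
    case 2
    then show False using i j assms(3) by (elim disjE conjE) auto
  next
    case 3
    then show False using i j assms(3) by (elim disjE conjE) auto
  next
    case 4
    then show False using i j assms(3) by (elim disjE conjE) auto
  next
    case 5
    then have "real i + 1 < real j" by linarith
    then show False using i j by (elim disjE conjE) auto
  qed
qed

lemma simple_edge_drawing:
  assumes "simple_edge e"
  shows "\<exists>\<gamma>. arc \<gamma> \<and> {pathstart \<gamma>, pathfinish \<gamma>} = point ` e \<and>
    path_image \<gamma> - point ` e \<subseteq> {z. 0 < z $ 1 \<and> z $ 1 < 1} \<and> path_image \<gamma> \<subseteq> edge_region e"
proof -
  have bow: "0 \<le> t * (1 - t) \<and> t * (1 - t) \<le> 1 / 4" if "t \<in> {0..1}" for t :: real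
  proof -
    have "0 \<le> (t - 1 / 2)\<^sup>2" by simp
    then show ?thesis using that by (simp add: power2_eq_square algebra_simps) (metis mult_left_le)
  qed
  have bow0: "0 < t * (1 - t)" if "t \<in> {0..1}" "t \<noteq> 0" "t \<noteq> 1" for t :: real
    using that by simp
  consider (line) i where "e = {(0, i), (1, i)}" | (left) i where "e = {(0, i), (0, Suc i)}"
    | (right) i where "e = {(1, i), (1, Suc i)}"
    using assms unfolding simple_edge_def by blast
  then show ?thesis
  proof cases
    case line
    let ?c = "curve (\<lambda>t. t) (\<lambda>t. real i)"
    have "arc ?c" by (rule curve_arc) (auto intro: continuous_intros inj_onI)
    moreover have ends: "?c 0 = point (0, i)" "?c 1 = point (1, i)" by (simp_all add: vec2_eq_iff)
    moreover have "path_image ?c - point ` e \<subseteq> {z. 0 < z $ 1 \<and> z $ 1 < 1}"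
    proof
      fix z assume "z \<in> path_image ?c - point ` e"
      then obtain t where t: "t \<in> {0..1}" "z = ?c t" "z \<noteq> ?c 0" "z \<noteq> ?c 1"
        using line by (auto simp: path_image_def ends)
      then have "t \<noteq> 0" "t \<noteq> 1" by auto
      then show "z \<in> {z. 0 < z $ 1 \<and> z $ 1 < 1}" using t by simp
    qed
    moreover have "path_image ?c \<subseteq> edge_region e" using line by (auto simp: path_image_def edge_region_def)
    ultimately show ?thesis using line by (intro exI[of _ ?c]) (auto simp: pathstart_def pathfinish_def)
  next
    case left
    let ?c = "curve (\<lambda>t. t * (1 - t)) (\<lambda>t. real i + t)"
    have "arc ?c" by (rule curve_arc) (auto intro!: continuous_intros inj_onI)
    moreover have ends: "?c 0 = point (0, i)" "?c 1 = point (0, Suc i)" by (simp_all add: vec2_eq_iff)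
    moreover have "path_image ?c - point ` e \<subseteq> {z. 0 < z $ 1 \<and> z $ 1 < 1}"
    proof
      fix z assume "z \<in> path_image ?c - point ` e"
      then obtain t where t: "t \<in> {0..1}" "z = ?c t" "z \<noteq> ?c 0" "z \<noteq> ?c 1"
        using left by (auto simp: path_image_def ends)
      then have "t \<noteq> 0" "t \<noteq> 1" by auto
      then show "z \<in> {z. 0 < z $ 1 \<and> z $ 1 < 1}" using t bow[of t] bow0[of t] by simp
    qed
    moreover have "path_image ?c \<subseteq> edge_region e"
    proof
      fix z assume "z \<in> path_image ?c"
      then obtain t where t: "t \<in> {0..1}" "z = ?c t" by (auto simp: path_image_def)
      then show "z \<in> edge_region e" using left bow[OF t(1)] unfolding edge_region_def
        by (intro CollectI exI[of _ i]) simp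
    qed
    ultimately show ?thesis using left by (intro exI[of _ ?c]) (auto simp: pathstart_def pathfinish_def)
  next
    case right
    let ?c = "curve (\<lambda>t. 1 - t * (1 - t)) (\<lambda>t. real i + t)"
    have "arc ?c" by (rule curve_arc) (auto intro!: continuous_intros inj_onI)
    moreover have ends: "?c 0 = point (1, i)" "?c 1 = point (1, Suc i)" by (simp_all add: vec2_eq_iff)
    moreover have "path_image ?c - point ` e \<subseteq> {z. 0 < z $ 1 \<and> z $ 1 < 1}"
    proof
      fix z assume "z \<in> path_image ?c - point ` e"
      then obtain t where t: "t \<in> {0..1}" "z = ?c t" "z \<noteq> ?c 0" "z \<noteq> ?c 1"
        using right by (auto simp: path_image_def ends)
      then have "t \<noteq> 0" "t \<noteq> 1" by auto
      then show "z \<in> {z. 0 < z $ 1 \<and> z $ 1 < 1}" using t bow[of t] bow0[of t] by simp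
    qed
    moreover have "path_image ?c \<subseteq> edge_region e"
    proof
      fix z assume "z \<in> path_image ?c"
      then obtain t where t: "t \<in> {0..1}" "z = ?c t" by (auto simp: path_image_def)
      then show "z \<in> edge_region e" using right bow[OF t(1)] unfolding edge_region_def
        by (intro CollectI exI[of _ i]) simp
    qed
    ultimately show ?thesis using right by (intro exI[of _ ?c]) (auto simp: pathstart_def pathfinish_def)
  qed
qed

lemma planar_simple:
  assumes simple: "\<And>x. x \<in> E \<Longrightarrow> simple_edge (fst x)"
    and disj: "\<And>x y. \<lbrakk>x \<in> E; y \<in> E; x \<noteq> y\<rbrakk> \<Longrightarrow> fst x \<inter> fst y = {}"
  shows "planar E"
proof -
  have "\<exists>\<gamma>. \<forall>x\<in>E. arc (\<gamma> x) \<and> {pathstart (\<gamma> x), pathfinish (\<gamma> x)} = point ` fst x \<and>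
      path_image (\<gamma> x) - point ` fst x \<subseteq> {z. 0 < z $ 1 \<and> z $ 1 < 1} \<and> path_image (\<gamma> x) \<subseteq> edge_region (fst x)"
    by (rule bchoice) (use simple_edge_drawing[OF simple] in blast)
  then obtain \<gamma> where g: "\<And>x. x \<in> E \<Longrightarrow> arc (\<gamma> x) \<and> {pathstart (\<gamma> x), pathfinish (\<gamma> x)} = point ` fst x \<and>
      path_image (\<gamma> x) - point ` fst x \<subseteq> {z. 0 < z $ 1 \<and> z $ 1 < 1} \<and> path_image (\<gamma> x) \<subseteq> edge_region (fst x)"
    by (elim exE) blast
  have "path_image (\<gamma> x) \<inter> path_image (\<gamma> y) = {}" if "x \<in> E" "y \<in> E" "x \<noteq> y" for x y
    using g[OF that(1)] g[OF that(2)] edge_region_disjoint[OF simple[OF that(1)] simple[OF that(2)] disj[OF that]] by blast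
  then show ?thesis unfolding planar_def using g by (intro exI[of _ \<gamma>]) simp
qed

section \<open>Cups of diagrams\<close>

lemma diagramD:
  assumes "E \<in> diagrams G n" "(e, g) \<in> E"
  shows "e \<subseteq> {0, 1} \<times> {..<n}" "card e = 2" "g \<in> carrier G"
  using assms by (auto simp: diagrams_def)

lemma diagram_ex1:
  assumes "E \<in> diagrams G n" "v \<in> {0, 1} \<times> {..<n}" shows "\<exists>!x. x \<in> E \<and> v \<in> fst x"
proof -
  have "\<forall>v \<in> {0, 1} \<times> {..<n}. \<exists>!x. x \<in> E \<and> v \<in> fst x" using assms(1) by (simp add: diagrams_def)
  then show ?thesis using assms(2) by (rule bspec)
qed

lemma diagram_unique:
  assumes "E \<in> diagrams G n" "x \<in> E" "y \<in> E" "v \<in> fst x" "v \<in> fst y"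
  shows "x = y"
proof -
  have "v \<in> {0, 1} \<times> {..<n}" using diagramD(1)[OF assms(1), of "fst x" "snd x"] assms(2,4) by auto
  then have "\<exists>!x. x \<in> E \<and> v \<in> fst x" by (rule diagram_ex1[OF assms(1)])
  then show ?thesis using assms by blast
qed

lemma diagram_partner:
  assumes E: "E \<in> diagrams G n" and v: "v \<in> {0, 1} \<times> {..<n}"
  obtains w g where "({v, w}, g) \<in> E" "w \<noteq> v" "w \<in> {0, 1} \<times> {..<n}" "g \<in> carrier G"
proof -
  obtain x where x: "x \<in> E" "v \<in> fst x" using diagram_ex1[OF E v] by blast
  define e g where "e = fst x" and "g = snd x"
  have e: "(e, g) \<in> E" "v \<in> e" using x by (simp_all add: e_def g_def)
  obtain a b where ab: "e = {a, b}" "a \<noteq> b" using diagramD(2)[OF E e(1)] by (auto simp: card_2_iff)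
  then consider "v = a" | "v = b" using e(2) by blast
  then obtain w where w: "e = {v, w}" "w \<noteq> v" using ab by cases blast+
  show thesis
  proof (rule that)
    show "({v, w}, g) \<in> E" using e(1) w(1) by simp
    show "w \<in> {0, 1} \<times> {..<n}" using diagramD(1)[OF E e(1)] w(1) by blast
  qed (rule w(2), rule diagramD(3)[OF E e(1)])
qed

lemma diagramsI:
  assumes "\<And>e g. (e, g) \<in> E \<Longrightarrow> e \<subseteq> {0, 1} \<times> {..<n} \<and> simple_edge e \<and> g \<in> carrier G"
    and ex: "\<And>v. v \<in> {0, 1} \<times> {..<n} \<Longrightarrow> \<exists>x\<in>E. v \<in> fst x"
    and un: "\<And>x y v. \<lbrakk>x \<in> E; y \<in> E; v \<in> fst x; v \<in> fst y\<rbrakk> \<Longrightarrow> x = y"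
  shows "E \<in> diagrams G n"
proof -
  have "card e = 2" if "(e, g) \<in> E" for e g
    using assms(1)[OF that] by (auto simp: simple_edge_def)
  moreover have "planar E"
  proof (rule planar_simple)
    show "simple_edge (fst x)" if "x \<in> E" for x using assms(1)[of "fst x" "snd x"] that by simp
    show "fst x \<inter> fst y = {}" if "x \<in> E" "y \<in> E" "x \<noteq> y" for x y using un that by blast
  qed
  moreover have "\<exists>!x. x \<in> E \<and> v \<in> fst x" if "v \<in> {0, 1} \<times> {..<n}" for v
    using ex[OF that] un by blast
  ultimately show ?thesis unfolding diagrams_def using assms(1) by (intro CollectI conjI) blast+
qed

text \<open>If \<open>b\<close> is not next to \<open>a\<close>, the partner of the node after
  \<open>a\<close> is strictly between \<open>a\<close> and \<open>b\<close>, for otherwise two arcs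
  would have alternating ends. That is a shorter cup, and the induction is on the distance.\<close>

lemma innermost_cup:
  assumes E: "E \<in> diagrams G n"
  shows "\<lbrakk>({(0, a), (0, b)}, g) \<in> E; a < b\<rbrakk> \<Longrightarrow> \<exists>i h. ({(0, i), (0, Suc i)}, h) \<in> E"
proof (induction "b - a" arbitrary: a b g rule: less_induct)
  case less
  have planar: "planar E" using E by (simp add: diagrams_def)
  have ab: "a < n" "b < n" using diagramD(1)[OF E less.prems(1)] by auto
  show ?case
  proof (cases "b = Suc a")
    case True
    then show ?thesis using less.prems by blast
  next
    case False
    let ?v = "(0, Suc a)"
    have v: "?v \<in> {0, 1} \<times> {..<n}" using less.prems(2) False ab by auto
    obtain w h where w: "({?v, w}, h) \<in> E" "w \<noteq> ?v" "w \<in> {0, 1} \<times> {..<n}" by (rule diagram_partner[OF E v])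
    have "w \<notin> {(0, a), (0, b)}"
    proof
      assume "w \<in> {(0, a), (0, b)}"
      then have "({?v, w}, h) = ({(0, a), (0, b)}, g)"
        using diagram_unique[OF E w(1) less.prems(1), of w] by auto
      then show False using False by (auto simp: doubleton_eq_iff)
    qed
    then have ne: "position n w \<noteq> a" "position n w \<noteq> b" "position n w \<noteq> Suc a"
      using w(2,3) v ab by (auto simp: position_def prod_eq_iff mem_Times_iff split: if_splits)
    have nodes: "{(0, a), ?v, (0, b), w} \<subseteq> {0, 1} \<times> {..<n}" using ab v w(3) by auto
    have pos: "position n (0, i) = i" for i by (simp add: position_def)
    have "\<not> position n w < a"
    proof
      assume "position n w < a"
      then show False
        using planar_noncrossing[OF planar, of w ?v h "(0, a)" "(0, b)" g n] w(1) less.prems False nodes pos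
        by (auto simp: insert_commute)
    qed
    moreover have "\<not> b < position n w"
    proof
      assume "b < position n w"
      then show False
        using planar_noncrossing[OF planar less.prems(1) w(1), of n] less.prems(2) False nodes pos by auto
    qed
    ultimately have pw: "Suc a < position n w" "position n w < b" using ne by linarith+
    have "fst w = 0"
      using pw(2) w(3) ab by (auto simp: position_def mem_Times_iff split: if_splits)
    then have "w = (0, position n w)" by (simp add: position_def prod_eq_iff)
    then have "({(0, Suc a), (0, position n w)}, h) \<in> E" using w(1) by simp
    moreover have "position n w - Suc a < b - a" using pw by linarith
    ultimately show ?thesis using less.hyps pw(1) by blast
  qed
qed

text \<open>If no edge has both ends in column \<open>s\<close>, all \<open>n\<close> nodes of column \<open>s\<close> are joined to the other
  column, and exhaust its \<open>n\<close> nodes.\<close>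

lemma no_cap_imp_no_cup:
  assumes E: "E \<in> diagrams G n" and s: "s \<in> {0, 1}"
    and none: "\<And>e g. (e, g) \<in> E \<Longrightarrow> \<not> e \<subseteq> {s} \<times> UNIV"
    and e: "(e, g) \<in> E"
  shows "\<not> e \<subseteq> {1 - s} \<times> UNIV"
proof
  assume sub: "e \<subseteq> {1 - s} \<times> UNIV"
  have "\<exists>j<n. \<exists>h. ({(s, i), (1 - s, j)}, h) \<in> E" if i: "i < n" for i
  proof -
    have "(s, i) \<in> {0, 1} \<times> {..<n}" using s i by auto
    then obtain w h where w: "({(s, i), w}, h) \<in> E" "w \<in> {0, 1} \<times> {..<n}" by (rule diagram_partner[OF E])
    then have "fst w \<noteq> s" using none[OF w(1)] by auto
    then have "w = (1 - s, snd w)" using w(2) s by (auto simp: prod_eq_iff)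
    then show ?thesis using w by (metis mem_Times_iff lessThan_iff)
  qed
  then obtain f where f: "\<And>i. i < n \<Longrightarrow> f i < n \<and> (\<exists>h. ({(s, i), (1 - s, f i)}, h) \<in> E)" by metis
  have "inj_on f {..<n}"
  proof (rule inj_onI)
    fix i j assume ij: "i \<in> {..<n}" "j \<in> {..<n}" "f i = f j"
    then obtain h h' where "({(s, i), (1 - s, f i)}, h) \<in> E" "({(s, j), (1 - s, f i)}, h') \<in> E" using f by (metis lessThan_iff)
    then have "({(s, i), (1 - s, f i)}, h) = ({(s, j), (1 - s, f i)}, h')"
      by (rule diagram_unique[OF E, of _ _ "(1 - s, f i)"]) simp_all
    then show "i = j" using s by (auto simp: doubleton_eq_iff)
  qed
  then have surj: "f ` {..<n} = {..<n}"
    using f by (intro endo_inj_surj) auto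
  have "e \<noteq> {}" using diagramD(2)[OF E e] by auto
  then obtain v where v: "v \<in> e" by blast
  then obtain j where j: "v = (1 - s, j)" "j < n" using sub diagramD(1)[OF E e] by auto
  then obtain i where "i < n" "j = f i" using surj by auto
  then obtain h where "({(s, i), (1 - s, j)}, h) \<in> E" using f by blast
  then have "e = {(s, i), (1 - s, j)}" using diagram_unique[OF E _ e, of _ v] v j(1) by fastforce
  then show False using sub s by auto
qed

definition cup_free :: "'g diagram \<Rightarrow> bool" where
  "cup_free E \<longleftrightarrow> (\<forall>(e, g)\<in>E. \<not> e \<subseteq> {0} \<times> UNIV \<and> \<not> e \<subseteq> {1} \<times> UNIV)"

lemma cup_free_iff:
  assumes "E \<in> diagrams G n" "s \<in> {0, 1}"
  shows "cup_free E \<longleftrightarrow> (\<forall>(e, g)\<in>E. \<not> e \<subseteq> {s} \<times> UNIV)"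
proof
  assume "\<forall>(e, g)\<in>E. \<not> e \<subseteq> {s} \<times> UNIV"
  then have "\<not> e \<subseteq> {s} \<times> UNIV \<and> \<not> e \<subseteq> {1 - s} \<times> UNIV" if "(e, g) \<in> E" for e g
    using no_cap_imp_no_cup[OF assms, of e g] that by blast
  then show "cup_free E" using assms(2) unfolding cup_free_def by (elim insertE) auto
qed (use assms(2) in \<open>auto simp: cup_free_def\<close>)

lemma not_cup_free:
  assumes E: "E \<in> diagrams G n" and c: "\<not> cup_free E"
  obtains i h where "({(0, i), (0, Suc i)}, h) \<in> E" "Suc i < n" "h \<in> carrier G"
proof -
  obtain e g where e: "(e, g) \<in> E" "e \<subseteq> {0} \<times> UNIV" using c cup_free_iff[OF E, of 0] by auto
  obtain v w where "e = {v, w}" "v \<noteq> w" using diagramD(2)[OF E e(1)] by (auto simp: card_2_iff)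
  then obtain a b where "e = {(0, a), (0, b)}" "a \<noteq> b" using e(2) by (cases v; cases w) auto
  then have "\<exists>a b. e = {(0, a), (0, b)} \<and> a < b" by (metis insert_commute linorder_neqE_nat)
  then obtain a b where "e = {(0, a), (0, b)}" "a < b" by blast
  then obtain i h where i: "({(0, i), (0, Suc i)}, h) \<in> E" using innermost_cup[OF E] e(1) by blast
  then show thesis using that diagramD[OF E i] by auto
qed

definition lines :: "nat \<Rightarrow> (nat \<Rightarrow> 'g) \<Rightarrow> 'g diagram" where
  "lines n a = {({(0, i), (1, i)}, a i) | i. i < n}"

lemma lines_diagram:
  assumes "\<And>i. i < n \<Longrightarrow> a i \<in> carrier G" shows "lines n a \<in> diagrams G n"
proof (rule diagramsI)
  show "e \<subseteq> {0, 1} \<times> {..<n} \<and> simple_edge e \<and> g \<in> carrier G" if "(e, g) \<in> lines n a" for e g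
    using that assms by (auto simp: lines_def simple_edge_def)
  show "\<exists>x\<in>lines n a. v \<in> fst x" if "v \<in> {0, 1} \<times> {..<n}" for v
  proof (rule bexI[of _ "({(0, snd v), (1, snd v)}, a (snd v))"])
    show "v \<in> fst ({(0, snd v), (1, snd v)}, a (snd v))" using that by (cases v) auto
    show "({(0, snd v), (1, snd v)}, a (snd v)) \<in> lines n a" using that by (auto simp: lines_def)
  qed
qed (auto simp: lines_def)

lemma cup_free_lines: "cup_free (lines n a)"
  by (auto simp: cup_free_def lines_def)

lemma strict_mono_on_lessThan_id:
  fixes f :: "nat \<Rightarrow> nat"
  assumes mono: "\<And>i j. \<lbrakk>i < j; j < n\<rbrakk> \<Longrightarrow> f i < f j" and range: "\<And>i. i < n \<Longrightarrow> f i < n" and i: "i < n"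
  shows "f i = i"
proof (rule antisym)
  show "i \<le> f i" using i
  proof (induction i)
    case (Suc i)
    then show ?case using mono[of i "Suc i"] by simp
  qed simp
  \<comment> \<open>The upper bound is proved by induction down from the last index, which is why
    the index is written as \<open>n - Suc k\<close>.\<close>
  have "f (n - Suc k) \<le> n - Suc k" if "k < n" for k
    using that
  proof (induction k)
    case 0
    then show ?case using range[of "n - 1"] by simp
  next
    case (Suc k)
    then have "f (n - Suc (Suc k)) < f (n - Suc k)" by (intro mono) auto
    then show ?case using Suc by simp
  qed
  from this[of "n - Suc i"] show "f i \<le> i" using i by simp
qed

text \<open>Every left node is joined to a right one. \<open>position\<close> numbers the right
  column backwards, so two strands in the wrong order would have alternating ends; the matching is
  strictly increasing, hence the identity.\<close>

lemma cup_free_eq_lines: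
  assumes E: "E \<in> diagrams G n" and cf: "cup_free E"
  obtains a where "\<And>i. i < n \<Longrightarrow> a i \<in> carrier G" "E = lines n a"
proof -
  have planar: "planar E" using E by (simp add: diagrams_def)
  have "\<exists>j h. j < n \<and> h \<in> carrier G \<and> ({(0, i), (1, j)}, h) \<in> E" if "i < n" for i
  proof -
    have "(0, i) \<in> {0, 1} \<times> {..<n}" using \<open>i < n\<close> by auto
    then obtain w h where w: "({(0, i), w}, h) \<in> E" "w \<in> {0, 1} \<times> {..<n}" "h \<in> carrier G"
      by (rule diagram_partner[OF E])
    have "\<not> {(0, i), w} \<subseteq> {0} \<times> UNIV" using cf w(1) unfolding cup_free_def by blast
    then have "w = (1, snd w)" "snd w < n" using w(2) by (auto simp: prod_eq_iff)
    then show ?thesis using w by metis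
  qed
  then obtain f a where fa: "\<And>i. i < n \<Longrightarrow> f i < n \<and> a i \<in> carrier G \<and> ({(0, i), (1, f i)}, a i) \<in> E" by metis
  have "f i = i" if "i < n" for i
  proof (rule strict_mono_on_lessThan_id[OF _ _ that])
    show "f i < n" if "i < n" for i using fa that by blast
    fix i j assume ij: "i < j" "j < n"
    note fi = fa[of i] and fj = fa[of j]
    have "f i \<noteq> f j"
    proof
      assume eq: "f i = f j"
      have "({(0 :: nat, i), (1, f i)}, a i) = ({(0, j), (1, f j)}, a j)"
        by (rule diagram_unique[OF E, of _ _ "(1, f i)"]) (use fi fj ij eq in auto)
      then show False using ij by (auto simp: doubleton_eq_iff)
    qed
    moreover have "\<not> f j < f i"
    proof
      assume "f j < f i"
      then have "j < 2 * n - 1 - f i" "2 * n - 1 - f i < 2 * n - 1 - f j" using fi fj ij by linarith+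
      then show False
        using planar_noncrossing[OF planar, of "(0, i)" "(1, f i)" "a i" "(0, j)" "(1, f j)" "a j" n] fi fj ij
        by (auto simp: position_def)
    qed
    ultimately show "f i < f j" by linarith
  qed
  then have line: "({(0, i), (1, i)}, a i) \<in> E" if "i < n" for i using fa[OF that] that by simp
  have "E = lines n a"
  proof (intro equalityI subsetI)
    fix x assume x: "x \<in> E"
    obtain e g where eg: "x = (e, g)" by (cases x)
    have "e \<noteq> {}" using diagramD(2)[OF E, of e g] x eg by auto
    then obtain v where v: "v \<in> e" by blast
    then obtain i where i: "i < n" "v = (0, i) \<or> v = (1, i)" using diagramD(1)[OF E] x eg by blast
    have "x = ({(0, i), (1, i)}, a i)"
      by (rule diagram_unique[OF E x line[OF i(1)], of v]) (use v i eg in auto)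
    then show "x \<in> lines n a" using i(1) by (auto simp: lines_def)
  next
    fix x assume "x \<in> lines n a"
    then show "x \<in> E" using line by (auto simp: lines_def)
  qed
  then show thesis using that fa by blast
qed

section \<open>Composition of diagrams\<close>

abbreviation shift :: "node set \<Rightarrow> node set" where
  "shift e \<equiv> (\<lambda>(c, i). (Suc c, i)) ` e"

definition link :: "'g diagram \<Rightarrow> 'g diagram \<Rightarrow> ((bool \<times> node set \<times> 'g) \<times> (bool \<times> node set \<times> 'g)) set" where
  "link x y = {(a, b). a \<in> glue x y \<and> b \<in> glue x y \<and> fst (snd a) \<inter> fst (snd b) \<noteq> {}}"

lemma components_link: "components x y = glue x y // (link x y)\<^sup>+"
  by (simp add: components_def link_def)

lemma glueI:
  "(e, g) \<in> x \<Longrightarrow> (False, e, g) \<in> glue x y"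
  "(e, g) \<in> y \<Longrightarrow> (True, shift e, g) \<in> glue x y"
  by (auto simp: glue_def)

lemma glueE:
  assumes "a \<in> glue x y"
  obtains (left) e g where "a = (False, e, g)" "(e, g) \<in> x" | (right) e g where "a = (True, shift e, g)" "(e, g) \<in> y"
  using assms by (auto simp: glue_def)

lemma shift_mem: "(c, i) \<in> shift e \<longleftrightarrow> (\<exists>b. c = Suc b \<and> (b, i) \<in> e)"
  by (auto simp: image_iff split: prod.splits)

text \<open>A criterion for a component that avoids transitive closures: some edge \<open>c0\<close>
  touches every edge of \<open>C\<close>, and nothing outside touches \<open>C\<close>. All
  components computed below have such a central edge.\<close>

lemma block_class:
  assumes C: "C \<subseteq> glue x y" and c0: "c0 \<in> C"
    and conn: "\<And>b. b \<in> C \<Longrightarrow> fst (snd c0) \<inter> fst (snd b) \<noteq> {}"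
    and closed: "\<And>a b v. \<lbrakk>a \<in> C; b \<in> glue x y; v \<in> fst (snd a); v \<in> fst (snd b)\<rbrakk> \<Longrightarrow> b \<in> C"
  shows "C \<in> components x y" and "\<And>C' a. \<lbrakk>C' \<in> components x y; a \<in> C; a \<in> C'\<rbrakk> \<Longrightarrow> C' = C"
proof -
  have sym: "(b, a) \<in> link x y" if "(a, b) \<in> link x y" for a b using that by (auto simp: link_def)
  have sym': "(b, a) \<in> (link x y)\<^sup>+" if "(a, b) \<in> (link x y)\<^sup>+" for a b
    by (rule symD[OF sym_trancl[OF symI] that]) (rule sym)
  have step: "(c0, b) \<in> (link x y)\<^sup>+" if "b \<in> C" for b
    using C c0 that conn[OF that] by (intro r_into_trancl) (auto simp: link_def)
  have inC: "b \<in> C" if "(a, b) \<in> (link x y)\<^sup>+" "a \<in> C" for a b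
    using that by (induction) (auto simp: link_def intro: closed)
  have cls: "(link x y)\<^sup>+ `` {a} = C" if a: "a \<in> C" for a
  proof
    show "(link x y)\<^sup>+ `` {a} \<subseteq> C" using inC a by auto
    show "C \<subseteq> (link x y)\<^sup>+ `` {a}" using trancl_trans[OF sym'[OF step[OF a]] step] by blast
  qed
  show "C \<in> components x y"
    unfolding components_link quotient_def using cls[OF c0] C c0 by blast
  show "C' = C" if "C' \<in> components x y" "a \<in> C" "a \<in> C'" for C' a
  proof -
    from that(1) obtain b where b: "C' = (link x y)\<^sup>+ `` {b}" unfolding components_link quotient_def by blast
    then have "(a, b) \<in> (link x y)\<^sup>+" using that(3) sym' by blast
    then have "b \<in> C" using inC that(2) by blast
    then show ?thesis using cls b by simp
  qed
qed

lemma component_subset_glue: "C \<in> components x y \<Longrightarrow> C \<subseteq> glue x y"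
proof -
  assume "C \<in> components x y"
  then obtain b where "C = (link x y)\<^sup>+ `` {b}" unfolding components_link quotient_def by blast
  moreover have "a \<in> glue x y" if "(b, a) \<in> (link x y)\<^sup>+" for a b using that by induction (auto simp: link_def)
  ultimately show ?thesis by auto
qed

lemma component_nonempty:
  assumes "C \<in> components x y" "x \<in> diagrams G n" "y \<in> diagrams G n"
  obtains a where "a \<in> C" "a \<in> glue x y"
proof -
  obtain b where b: "b \<in> glue x y" "C = (link x y)\<^sup>+ `` {b}"
    using assms(1) unfolding components_link quotient_def by blast
  have "e \<noteq> {}" if "(e, g) \<in> x \<or> (e, g) \<in> y" for e g
    using that diagramD(2)[OF assms(2), of e g] diagramD(2)[OF assms(3), of e g] by auto
  then have "fst (snd b) \<noteq> {}" using b(1) by (elim glueE) auto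
  \<comment> \<open>The components are classes of a transitive, not reflexive, closure. An edge
    belongs to its own class because it has end nodes and therefore touches itself.\<close>
  then have "(b, b) \<in> link x y" using b(1) by (auto simp: link_def)
  then show thesis using that b by blast
qed

abbreviation unfold_node :: "node \<Rightarrow> node" where
  "unfold_node \<equiv> \<lambda>(c, i). (if c = 0 then 0 else 1, i)"

lemma diagram_compI:
  assumes "C \<in> components x y" "unfold_node ` outer_nodes C = e" "e \<noteq> {}" "component_label G C = g"
  shows "(e, g) \<in> diagram_comp G x y"
  using assms unfolding diagram_comp_def by blast

context comm_group
begin

lemma component_label_closed:
  assumes "C \<in> components x y" "x \<in> diagrams G n" "y \<in> diagrams G n"
  shows "component_label G C \<in> carrier G"
proof -
  have "snd (snd a) \<in> carrier G" if "a \<in> C" for a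
  proof -
    have "a \<in> glue x y" using component_subset_glue[OF assms(1)] that by auto
    then show ?thesis using diagramD(3)[OF assms(2)] diagramD(3)[OF assms(3)] by (elim glueE) auto
  qed
  then show ?thesis unfolding component_label_def by (intro finprod_closed) auto
qed

text \<open>No other edge touches a left-to-left edge of the first factor, so it is a component by
  itself. Hence the diagrams with a given left cup span a right ideal.\<close>

lemma left_edge_comp:
  assumes x: "x \<in> diagrams G n" and e: "(e, g) \<in> x" "e \<subseteq> {0} \<times> UNIV"
  shows "(e, g) \<in> diagram_comp G x y"
proof (rule diagram_compI)
  let ?C = "{(False, e, g)}"
  have ne: "e \<noteq> {}" using diagramD(2)[OF x e(1)] by auto
  show "?C \<in> components x y"
  proof (rule block_class(1))
    show "?C \<subseteq> glue x y" using e(1) by (simp add: glueI)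
    fix a b v assume a: "a \<in> ?C" and b: "b \<in> glue x y" and v: "v \<in> fst (snd a)" "v \<in> fst (snd b)"
    have ve: "v \<in> e" "fst v = 0" using a v(1) e(2) by auto
    show "b \<in> ?C" using b
    proof (cases rule: glueE)
      case (left e' g')
      then show ?thesis using diagram_unique[OF x e(1) left(2), of v] ve v(2) by simp
    next
      case (right e' g')
      then show ?thesis using v(2) ve(2) by auto
    qed
  qed (use ne in auto)
  have "outer_nodes ?C = e" using e(2) by (auto simp: outer_nodes_def)
  moreover have "unfold_node ` e = id ` e" using e(2) by (intro image_cong) auto
  ultimately show "unfold_node ` outer_nodes ?C = e" by simp
  show "component_label G ?C = g" using diagramD(3)[OF x e(1)] by (simp add: component_label_def)
qed (use diagramD(2)[OF x e(1)] in auto)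

text \<open>The mirror image, for right-to-right edges of the second factor; it shows that the
  second factor of a cup-free composite is cup-free.\<close>

lemma right_edge_comp:
  assumes x: "x \<in> diagrams G n" and y: "y \<in> diagrams G n" and e: "(e, g) \<in> y" "e \<subseteq> {1} \<times> UNIV"
  shows "(e, g) \<in> diagram_comp G x y"
proof (rule diagram_compI)
  let ?C = "{(True, shift e, g)}"
  have ne: "e \<noteq> {}" using diagramD(2)[OF y e(1)] by auto
  show "?C \<in> components x y"
  proof (rule block_class(1))
    show "?C \<subseteq> glue x y" using e(1) by (simp add: glueI)
    fix a b v assume a: "a \<in> ?C" and b: "b \<in> glue x y" and v: "v \<in> fst (snd a)" "v \<in> fst (snd b)"
    obtain w where w: "w \<in> e" "v = (Suc (fst w), snd w)" "fst w = 1" using a v(1) e(2) by auto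
    show "b \<in> ?C" using b
    proof (cases rule: glueE)
      case (left e' g')
      then have "v \<in> {0, 1} \<times> {..<n}" using diagramD(1)[OF x left(2)] v(2) by auto
      then show ?thesis using w by auto
    next
      case (right e' g')
      then have "w \<in> e'" using v(2) w(2) by (auto simp: shift_mem)
      then show ?thesis using diagram_unique[OF y e(1) right(2), of w] w(1) right(1) by simp
    qed
  qed (use ne in auto)
  have outer: "outer_nodes ?C = shift e" using e(2) by (auto simp: outer_nodes_def)
  have "unfold_node ` shift e = id ` e" unfolding image_image using e(2) by (intro image_cong) auto
  then show "unfold_node ` outer_nodes ?C = e" unfolding outer by simp
  show "component_label G ?C = g" using diagramD(3)[OF y e(1)] by (simp add: component_label_def)
qed (use diagramD(2)[OF y e(1)] in auto)

text \<open>Diagrams are perfect matchings, so an inclusion is an equality. To compute a composite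
  that is known to be a diagram, it is enough to exhibit the expected edges in it.\<close>

lemma diagram_subset_eq:
  assumes x: "x \<in> diagrams G n" and y: "y \<in> diagrams G n" and sub: "x \<subseteq> y"
  shows "y = x"
proof
  show "y \<subseteq> x"
  proof
    fix a assume a: "a \<in> y"
    obtain e g where eg: "a = (e, g)" by (cases a)
    have "e \<noteq> {}" using diagramD(2)[OF y, of e g] a eg by auto
    then obtain v where v: "v \<in> e" by blast
    then have "v \<in> {0, 1} \<times> {..<n}" using diagramD(1)[OF y] a eg by blast
    then obtain b where b: "b \<in> x" "v \<in> fst b" using diagram_ex1[OF x] by blast
    have "a = b" by (rule diagram_unique[OF y a _ _ b(2)]) (use b sub v eg in auto)
    then show "a \<in> x" using b by simp
  qed
qed (rule sub)

section \<open>Composites of parallel strands, and composites with a cup diagram\<close>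

lemma lines_block:
  fixes a b :: "nat \<Rightarrow> 'a"
  assumes i: "i < n"
  defines "C \<equiv> {(False, {(0, i), (1, i)}, a i), (True, shift {(0, i), (1, i)}, b i)}"
  shows "C \<subseteq> glue (lines n a) (lines n b)"
    and "\<And>c d v. \<lbrakk>c \<in> C; d \<in> glue (lines n a) (lines n b); v \<in> fst (snd c); v \<in> fst (snd d)\<rbrakk> \<Longrightarrow> d \<in> C"
    and "C \<in> components (lines n a) (lines n b)"
    and "\<And>C' c. \<lbrakk>C' \<in> components (lines n a) (lines n b); c \<in> C; c \<in> C'\<rbrakk> \<Longrightarrow> C' = C"
proof -
  show sub: "C \<subseteq> glue (lines n a) (lines n b)"
  proof -
    have "({(0, i), (1, i)}, c i) \<in> lines n c" for c :: "nat \<Rightarrow> 'a" using i by (auto simp: lines_def)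
    then show ?thesis unfolding C_def by (intro insert_subsetI empty_subsetI glueI)
  qed
  show closed: "d \<in> C" if c: "c \<in> C" and d: "d \<in> glue (lines n a) (lines n b)" and v: "v \<in> fst (snd c)" "v \<in> fst (snd d)" for c d v
  proof -
    have "snd v = i" using c v(1) by (auto simp: C_def)
    then show ?thesis using d v(2) by (elim glueE) (auto simp: lines_def C_def)
  qed
  have c0: "(False, {(0, i), (1, i)}, a i) \<in> C" by (simp add: C_def)
  have conn: "fst (snd (False, {(0, i), (1, i)}, a i)) \<inter> fst (snd d) \<noteq> {}" if "d \<in> C" for d
    using that by (auto simp: C_def)
  show "C \<in> components (lines n a) (lines n b)" by (rule block_class(1)[OF sub c0 conn closed])
  show "C' = C" if "C' \<in> components (lines n a) (lines n b)" "c \<in> C" "c \<in> C'" for C' c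
    using block_class(2)[OF sub c0 conn closed that] .
qed

lemma lines_comp:
  assumes a: "\<And>i. i < n \<Longrightarrow> a i \<in> carrier G" and b: "\<And>i. i < n \<Longrightarrow> b i \<in> carrier G"
    and closed: "diagram_comp G (lines n a) (lines n b) \<in> diagrams G n"
  shows "diagram_comp G (lines n a) (lines n b) = lines n (\<lambda>i. a i \<otimes> b i)"
proof (rule diagram_subset_eq[OF _ closed])
  show "lines n (\<lambda>i. a i \<otimes> b i) \<in> diagrams G n" using a b by (intro lines_diagram) simp
  show "lines n (\<lambda>i. a i \<otimes> b i) \<subseteq> diagram_comp G (lines n a) (lines n b)"
  proof
    fix z assume "z \<in> lines n (\<lambda>i. a i \<otimes> b i)"
    then obtain i where i: "i < n" "z = ({(0, i), (1, i)}, a i \<otimes> b i)" by (auto simp: lines_def)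
    let ?C = "{(False, {(0, i), (1, i)}, a i), (True, shift {(0, i), (1, i)}, b i)}"
    have "outer_nodes ?C = {(0, i), (2, i)}" by (auto simp: outer_nodes_def)
    moreover have "component_label G ?C = a i \<otimes> b i"
      unfolding component_label_def using a[OF i(1)] b[OF i(1)] by (subst finprod_insert) auto
    ultimately show "z \<in> diagram_comp G (lines n a) (lines n b)"
      unfolding i(2) by (intro diagram_compI[OF lines_block(3)[OF i(1)]]) auto
  qed
qed

lemma lines_no_loop:
  assumes a: "\<And>i. i < n \<Longrightarrow> a i \<in> carrier G" and b: "\<And>i. i < n \<Longrightarrow> b i \<in> carrier G"
    and C: "C \<in> components (lines n a) (lines n b)"
  shows "outer_nodes C \<noteq> {}"
proof -
  obtain c where c: "c \<in> C" "c \<in> glue (lines n a) (lines n b)"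
    by (rule component_nonempty[OF C lines_diagram[OF a] lines_diagram[OF b]])
  from c(2) obtain i where i: "i < n" "c \<in> {(False, {(0, i), (1, i)}, a i), (True, shift {(0, i), (1, i)}, b i)}"
    by (elim glueE) (auto simp: lines_def)
  have "C = {(False, {(0, i), (1, i)}, a i), (True, shift {(0, i), (1, i)}, b i)}"
    by (rule lines_block(4)[OF i(1) C i(2) c(1)])
  then have "(0, i) \<in> outer_nodes C" by (auto simp: outer_nodes_def)
  then show ?thesis by blast
qed

text \<open>The cup on the left carries \<open>g\<close> and the cap on the right carries one. So
  the loop formed with a cup labelled \<open>g\<close> has label \<open>g\<close>, and the composite
  gets back exactly that cup.\<close>

definition cup_diagram :: "nat \<Rightarrow> nat \<Rightarrow> 'a \<Rightarrow> 'a diagram" where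
  "cup_diagram n j g = {({(0, j), (0, Suc j)}, g), ({(1, j), (1, Suc j)}, \<one>)} \<union>
     {({(0, i), (1, i)}, \<one>) | i. i < n \<and> i \<noteq> j \<and> i \<noteq> Suc j}"

lemma cup_diagram_closed:
  assumes j: "Suc j < n" and g: "g \<in> carrier G" shows "cup_diagram n j g \<in> diagrams G n"
proof (rule diagramsI)
  show "e \<subseteq> {0, 1} \<times> {..<n} \<and> simple_edge e \<and> h \<in> carrier G" if "(e, h) \<in> cup_diagram n j g" for e h
    using that j g by (auto simp: cup_diagram_def simple_edge_def)
  show "\<exists>x\<in>cup_diagram n j g. v \<in> fst x" if v: "v \<in> {0, 1} \<times> {..<n}" for v
  proof -
    obtain c i where ci: "v = (c, i)" "c = 0 \<or> c = 1" "i < n" using v by auto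
    show ?thesis
    proof (cases "i = j \<or> i = Suc j")
      case True
      then show ?thesis using ci by (auto simp: cup_diagram_def)
    next
      case False
      then have "({(0, i), (1, i)}, \<one>) \<in> cup_diagram n j g" using ci by (auto simp: cup_diagram_def)
      then show ?thesis using ci by (intro bexI[of _ "({(0, i), (1, i)}, \<one>)"]) auto
    qed
  qed
  show "x = y" if x: "x \<in> cup_diagram n j g" and y: "y \<in> cup_diagram n j g" and "v \<in> fst x" "v \<in> fst y" for x y v
    using that unfolding cup_diagram_def by auto
qed

text \<open>An edge of \<open>y\<close> that avoids the left nodes \<open>j\<close> and
  \<open>Suc j\<close> is only prolonged by straight strands labelled one, so it reappears
  unchanged. The same block also shows that its component is no loop.\<close>

lemma cup_comp_block:
  assumes j: "Suc j < n" and g: "g \<in> carrier G" and y: "y \<in> diagrams G n"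
    and f: "(f, h) \<in> y" "(0, j) \<notin> f" "(0, Suc j) \<notin> f"
  defines "C \<equiv> insert (True, shift f, h) ((\<lambda>i. (False, {(0, i), (1, i)}, \<one>)) ` {i. (0, i) \<in> f})"
  shows "C \<in> components (cup_diagram n j g) y" and "outer_nodes C \<noteq> {}"
    and "\<And>C' c. \<lbrakk>C' \<in> components (cup_diagram n j g) y; c \<in> C; c \<in> C'\<rbrakk> \<Longrightarrow> C' = C"
    and "(f, h) \<in> diagram_comp G (cup_diagram n j g) y"
proof -
  let ?x = "cup_diagram n j g"
  have x: "?x \<in> diagrams G n" by (rule cup_diagram_closed[OF j g])
  have fn: "f \<subseteq> {0, 1} \<times> {..<n}" by (rule diagramD(1)[OF y f(1)])
  have line: "({(0, i), (1, i)}, \<one>) \<in> ?x" if i: "(0, i) \<in> f" for i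
  proof -
    have "i < n" "i \<noteq> j" "i \<noteq> Suc j" using fn i f(2,3) by auto
    then show ?thesis by (auto simp: cup_diagram_def)
  qed
  have sub: "C \<subseteq> glue ?x y" using f(1) line by (auto simp: C_def intro: glueI)
  have closed: "b \<in> C" if a: "a \<in> C" and b: "b \<in> glue ?x y" and v: "v \<in> fst (snd a)" "v \<in> fst (snd b)" for a b v
  proof -
    have in_right: "b \<in> C" if "(0, i) \<in> f" "b = (True, shift e', g')" "(e', g') \<in> y" "v = (1, i)" for i e' g'
    proof -
      have "(0, i) \<in> e'" using v(2) that by (auto simp: shift_mem)
      then have "(f, h) = (e', g')" using diagram_unique[OF y f(1) that(3), of "(0, i)"] that(1) by simp
      then show ?thesis using that(2) by (simp add: C_def)
    qed
    have in_left: "b \<in> C" if "(0, i) \<in> f" "b = (False, e', g')" "(e', g') \<in> ?x" "v \<in> {(0, i), (1, i)}" for i e' g'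
    proof -
      have "({(0, i), (1, i)}, \<one>) = (e', g')"
        using diagram_unique[OF x line[OF that(1)] that(3), of v] that v(2) by simp
      then show ?thesis using that(1,2) by (auto simp: C_def)
    qed
    consider (f) "a = (True, shift f, h)" | (line) i where "(0, i) \<in> f" "a = (False, {(0, i), (1, i)}, \<one>)"
      using a by (auto simp: C_def)
    then show ?thesis
    proof cases
      case fcase: f
      obtain w where w: "w \<in> f" "v = (Suc (fst w), snd w)" using v(1) fcase by auto
      show ?thesis using b
      proof (cases rule: glueE)
        case (left e' g')
        have "v \<in> {0, 1} \<times> {..<n}" using diagramD(1)[OF x left(2)] v(2) left(1) by auto
        then have "fst w = 0" using w(2) by auto
        then have "(0, snd w) \<in> f" "v \<in> {(0, snd w), (1, snd w)}" using w by (cases w; simp)+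
        then show ?thesis using in_left left by blast
      next
        case (right e' g')
        have "w \<in> e'" using v(2) w(2) right(1) by (auto simp: shift_mem)
        then have "(f, h) = (e', g')" using diagram_unique[OF y f(1) right(2), of w] w(1) by simp
        then show ?thesis using right(1) by (simp add: C_def)
      qed
    next
      case (line i)
      then have vi: "v \<in> {(0, i), (1, i)}" using v(1) by simp
      show ?thesis using b
      proof (cases rule: glueE)
        case (left e' g')
        then show ?thesis using in_left line(1) vi by blast
      next
        case (right e' g')
        then have "v = (1, i)" using vi v(2) by auto
        then show ?thesis using in_right line(1) right by blast
      qed
    qed
  qed
  have c0: "(True, shift f, h) \<in> C" by (simp add: C_def)
  have fne: "f \<noteq> {}" using diagramD(2)[OF y f(1)] by auto
  have conn: "fst (snd (True, shift f, h)) \<inter> fst (snd b) \<noteq> {}" if "b \<in> C" for b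
    using that fne by (auto simp: C_def shift_mem)
  show C: "C \<in> components ?x y" by (rule block_class(1)[OF sub c0 conn closed])
  show "C' = C" if "C' \<in> components ?x y" "c \<in> C" "c \<in> C'" for C' c
    using block_class(2)[OF sub c0 conn closed that] .
  have f01: "c = 0 \<or> c = 1" if "(c, i) \<in> f" for c i using fn that by auto
  have outer: "outer_nodes C = {(0, i) | i. (0, i) \<in> f} \<union> {(2, i) | i. (1, i) \<in> f}"
  proof (intro equalityI subsetI)
    fix v assume "v \<in> outer_nodes C"
    then have "fst v \<noteq> 1 \<and> (v \<in> shift f \<or> (\<exists>i. (0, i) \<in> f \<and> v \<in> {(0, i), (1, i)}))"
      unfolding outer_nodes_def C_def by fastforce
    then consider "fst v \<noteq> 1" "v \<in> shift f" | i where "fst v \<noteq> 1" "(0, i) \<in> f" "v \<in> {(0, i), (1, i)}"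
      by blast
    then show "v \<in> {(0, i) | i. (0, i) \<in> f} \<union> {(2, i) | i. (1, i) \<in> f}"
    proof cases
      case 1
      then obtain c i where ci: "(c, i) \<in> f" "v = (Suc c, i)" by auto
      then show ?thesis using f01[OF ci(1)] 1(1) by (elim disjE) auto
    qed auto
  next
    fix v :: node assume "v \<in> {(0, i) | i. (0, i) \<in> f} \<union> {(2, i) | i. (1, i) \<in> f}"
    then consider i where "v = (0, i)" "(0, i) \<in> f" | i where "v = (2, i)" "(1, i) \<in> f" by blast
    then show "v \<in> outer_nodes C"
    proof cases
      case 1
      then show ?thesis by (auto simp: outer_nodes_def C_def)
    next
      case 2
      then have "v \<in> shift f" by (auto simp: shift_mem)
      then show ?thesis using 2 by (auto simp: outer_nodes_def C_def)
    qed
  qed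
  obtain v where v: "v \<in> f" using fne by blast
  then have "v = (0, snd v) \<or> v = (1, snd v)" using f01[of "fst v" "snd v"] by (auto simp: prod_eq_iff)
  then have "(0, snd v) \<in> outer_nodes C \<or> (2, snd v) \<in> outer_nodes C" using v unfolding outer by auto
  then show "outer_nodes C \<noteq> {}" by blast
  show "(f, h) \<in> diagram_comp G ?x y"
  proof (rule diagram_compI[OF C _ fne])
    show "unfold_node ` outer_nodes C = f"
    proof (intro equalityI subsetI)
      fix v assume "v \<in> unfold_node ` outer_nodes C"
      then show "v \<in> f" unfolding outer by auto
    next
      fix v assume v: "v \<in> f"
      obtain c i where ci: "v = (c, i)" by (cases v)
      show "v \<in> unfold_node ` outer_nodes C"
      proof (cases "c = 0")
        case True
        then show ?thesis unfolding outer using v ci by (intro image_eqI[of _ _ "(0, i)"]) auto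
      next
        case False
        then have "c = 1" using f01 v ci by blast
        then show ?thesis unfolding outer using v ci by (intro image_eqI[of _ _ "(2, i)"]) auto
      qed
    qed
    have hG: "h \<in> carrier G" by (rule diagramD(3)[OF y f(1)])
    let ?L = "(\<lambda>i. (False, {(0 :: nat, i), (1, i)}, \<one>)) ` {i. (0, i) \<in> f}"
    have "finite {i. (0, i) \<in> f}" by (rule finite_subset[of _ "{..<n}"]) (use fn in auto)
    then have fin: "finite ?L" by simp
    have one: "(\<Otimes>a\<in>?L. snd (snd a)) = \<one>"
    proof -
      have "(\<Otimes>a\<in>?L. snd (snd a)) = (\<Otimes>a\<in>?L. \<one>)" by (rule finprod_cong') auto
      then show ?thesis by simp
    qed
    have "component_label G C = h \<otimes> (\<Otimes>a\<in>?L. snd (snd a))"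
      unfolding component_label_def C_def using fin hG by (subst finprod_insert) auto
    then show "component_label G C = h" using one hG by simp
  qed
qed

text \<open>The cup of the composite is that of the cup diagram, and all other edges of
  \<open>y\<close> survive; as matchings, the two then coincide.\<close>

lemma cup_diagram_comp:
  assumes j: "Suc j < n" and g: "g \<in> carrier G" and y: "y \<in> diagrams G n"
    and cup: "({(0, j), (0, Suc j)}, g) \<in> y"
    and closed: "diagram_comp G (cup_diagram n j g) y \<in> diagrams G n"
  shows "diagram_comp G (cup_diagram n j g) y = y"
proof (rule diagram_subset_eq[OF y closed])
  show "y \<subseteq> diagram_comp G (cup_diagram n j g) y"
  proof
    fix z assume z: "z \<in> y"
    obtain f h where fh: "z = (f, h)" by (cases z)
    show "z \<in> diagram_comp G (cup_diagram n j g) y"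
    proof (cases "z = ({(0, j), (0, Suc j)}, g)")
      case True
      then show ?thesis
        using left_edge_comp[OF cup_diagram_closed[OF j g], of "{(0, j), (0, Suc j)}" g]
        by (simp add: cup_diagram_def)
    next
      case False
      have "v \<notin> f" if v: "v \<in> {(0, j), (0, Suc j)}" for v
      proof
        assume "v \<in> f"
        then have "z = ({(0, j), (0, Suc j)}, g)"
          by (intro diagram_unique[OF y z cup, of v]) (simp_all only: fh fst_conv v)
        then show False using False by contradiction
      qed
      then have "(0, j) \<notin> f" "(0, Suc j) \<notin> f" by blast+
      then show ?thesis using cup_comp_block(4)[OF j g y, of f h] z unfolding fh by blast
    qed
  qed
qed

text \<open>The cap and the cup of \<open>y\<close> at the same place close up to one loop. Every
  other component has an outer node, since it contains a straight strand, the outer cup or an edge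
  of \<open>y\<close> elsewhere.\<close>

lemma cup_diagram_loops:
  assumes j: "Suc j < n" and g: "g \<in> carrier G" and y: "y \<in> diagrams G n"
    and cup: "({(0, j), (0, Suc j)}, g) \<in> y"
  shows "\<exists>K. {C \<in> components (cup_diagram n j g) y. outer_nodes C = {}} = {K} \<and> component_label G K = g"
proof -
  let ?x = "cup_diagram n j g"
  have x: "?x \<in> diagrams G n" by (rule cup_diagram_closed[OF j g])
  let ?s = "{(1 :: nat, j), (1, Suc j)}"
  let ?K = "{(False, ?s, \<one>), (True, shift {(0, j), (0, Suc j)}, g)}"
  have rcup: "(?s, \<one>) \<in> ?x" and lcup: "({(0, j), (0, Suc j)}, g) \<in> ?x" by (simp_all add: cup_diagram_def)
  have sh: "shift {(0, j), (0, Suc j)} = ?s" by auto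
  have sub: "?K \<subseteq> glue ?x y" using glueI(1)[OF rcup] glueI(2)[OF cup] by simp
  have closed: "b \<in> ?K" if a: "a \<in> ?K" and b: "b \<in> glue ?x y" and v: "v \<in> fst (snd a)" "v \<in> fst (snd b)" for a b v
  proof -
    have vs: "v \<in> ?s" using a v(1) by auto
    show ?thesis using b
    proof (cases rule: glueE)
      case (left e' g')
      then show ?thesis using diagram_unique[OF x rcup left(2), of v] vs v(2) by simp
    next
      case (right e' g')
      then have "(0, snd v) \<in> e'" using v(2) vs by (auto simp: shift_mem)
      then have "({(0, j), (0, Suc j)}, g) = (e', g')"
        using diagram_unique[OF y cup right(2), of "(0, snd v)"] vs by auto
      then show ?thesis using right(1) by auto
    qed
  qed
  have c0: "(False, ?s, \<one>) \<in> ?K" by simp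
  have conn: "fst (snd (False, ?s, \<one>)) \<inter> fst (snd b) \<noteq> {}" if "b \<in> ?K" for b using that by auto
  have K: "?K \<in> components ?x y" by (rule block_class(1)[OF sub c0 conn closed])
  have K_unique: "C' = ?K" if "C' \<in> components ?x y" "c \<in> ?K" "c \<in> C'" for C' c
    by (rule block_class(2)[OF sub c0 conn closed that])
  have K_outer: "outer_nodes ?K = {}" by (auto simp: outer_nodes_def)
  have K_label: "component_label G ?K = g"
    unfolding component_label_def using g by (subst finprod_insert) auto
  have "C = ?K" if C: "C \<in> components ?x y" and loop: "outer_nodes C = {}" for C
  proof -
    obtain c where c: "c \<in> C" "c \<in> glue ?x y" by (rule component_nonempty[OF C x y])
    \<comment> \<open>A component that meets the block of an edge of \<open>y\<close> away from the
      cup is that block, which has an outer node.\<close>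
    have block: False if f: "(f, h) \<in> y" "(0, j) \<notin> f" "(0, Suc j) \<notin> f"
      and cf: "c \<in> insert (True, shift f, h) ((\<lambda>i. (False, {(0, i), (1, i)}, \<one>)) ` {i. (0, i) \<in> f})" for f h
      using cup_comp_block(2)[OF j g y f] cup_comp_block(3)[OF j g y f C cf c(1)] loop by simp
    show ?thesis using c(2)
    proof (cases rule: glueE)
      case (left e' g')
      \<comment> \<open>An end in the left column would be an outer node of the loop. Among the
        edges of the cup diagram this leaves only the cap.\<close>
      have nz: "(0, i) \<notin> e'" for i
      proof
        assume "(0, i) \<in> e'"
        then have "(0, i) \<in> outer_nodes C" unfolding outer_nodes_def using c(1) left(1) by force
        then show False using loop by blast
      qed
      have "(e', g') = (?s, \<one>)"
        using left(2) unfolding cup_diagram_def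
      proof (elim UnE insertE CollectE exE conjE emptyE)
        assume "(e', g') = ({(0, j), (0, Suc j)}, g)"
        then show ?thesis using nz[of j] by simp
      next
        fix i assume "(e', g') = ({(0, i), (1, i)}, \<one>)"
        then show ?thesis using nz[of i] by simp
      qed
      then have "c \<in> ?K" using left(1) by simp
      then show ?thesis by (rule K_unique[OF C _ c(1)])
    next
      case (right e' g')
      show ?thesis
      proof (cases "(e', g') = ({(0, j), (0, Suc j)}, g)")
        case True
        then have "c \<in> ?K" using right(1) by simp
        then show ?thesis by (rule K_unique[OF C _ c(1)])
      next
        case False
        have "v \<notin> e'" if v: "v \<in> {(0, j), (0, Suc j)}" for v
        proof
          assume "v \<in> e'"
          then have "(e', g') = ({(0, j), (0, Suc j)}, g)"
            by (intro diagram_unique[OF y right(2) cup, of v]) (simp_all only: fst_conv v)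
          then show False using False by contradiction
        qed
        then have "(0, j) \<notin> e'" "(0, Suc j) \<notin> e'" by blast+
        moreover have "c \<in> insert (True, shift e', g') ((\<lambda>i. (False, {(0, i), (1, i)}, \<one>)) ` {i. (0, i) \<in> e'})"
          using right(1) by simp
        ultimately show ?thesis using block[OF right(2)] by blast
      qed
    qed
  qed
  then have "{C \<in> components ?x y. outer_nodes C = {}} = {?K}" using K K_outer by blast
  then show ?thesis using K_label by blast
qed

end

section \<open>The Temperley--Lieb algebra and its through-strand quotient\<close>

lemma (in comm_monoid) finprod_Units:
  assumes "\<And>i. i \<in> I \<Longrightarrow> f i \<in> Units G" shows "finprod G f I \<in> Units G"
proof (cases "finite I")
  case True
  then show ?thesis using assms
  proof (induction I rule: finite_induct)
    case (insert i I)
    then have "f i \<in> Units G" "f \<in> I \<rightarrow> carrier G" "f i \<in> carrier G" by (auto intro: Units_closed)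
    then show ?case using insert by (simp add: Units_m_closed)
  qed simp
qed (simp add: finprod_infinite)

text \<open>The product of the basis elements \<open>x\<close> and \<open>y\<close> is supported
  exactly at \<open>p x y\<close> if its coefficient is nonzero, and elements of the algebra are
  supported in \<open>B\<close>. So closure of the diagrams under composition follows from the ring,
  without drawing a composite.\<close>

lemma basis_algebra_p_closed:
  assumes k: "cring k" "\<one>\<^bsub>k\<^esub> \<noteq> \<zero>\<^bsub>k\<^esub>" and A: "ring (basis_algebra k B p c u)"
    and xy: "x \<in> B" "y \<in> B" and c: "c x y \<in> carrier k" "c x y \<noteq> \<zero>\<^bsub>k\<^esub>"
  shows "p x y \<in> B"
proof (rule ccontr)
  let ?A = "basis_algebra k B p c u"
  interpret cring k by (rule k(1))
  have A_iff: "f \<in> carrier ?A \<longleftrightarrow> f \<in> carrier (free_module k B)" for f by (simp add: basis_algebra_def free_module_def)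
  assume "p x y \<notin> B"
  have "single k x \<otimes>\<^bsub>?A\<^esub> single k y \<in> carrier ?A"
    using single_closed[OF ring_axioms] xy by (intro ring.ring_simprules(5)[OF A]) (simp_all add: A_iff)
  then have "(single k x \<otimes>\<^bsub>?A\<^esub> single k y) (p x y) = \<zero>\<^bsub>k\<^esub>"
    using \<open>p x y \<notin> B\<close> by (simp add: A_iff free_module_carrier)
  moreover have "{(x', y'). single k x x' \<noteq> \<zero>\<^bsub>k\<^esub> \<and> single k y y' \<noteq> \<zero>\<^bsub>k\<^esub> \<and> p x' y' = p x y} = {(x, y)}"
    using k(2) by (auto simp: single_def)
  ultimately show False using c by (simp add: basis_algebra_def single_def)
qed

text \<open>If 1 = 0 in \<open>k\<close>, all coefficients vanish and the ring says nothing about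
  composites of basis elements. But then the algebra has a single element and all
  \<open>k\<close>-modules are zero, so the comparison of Tor is immediate.\<close>

lemma augmented_algebra_trivial_scalars:
  assumes k: "cring k" "\<one>\<^bsub>k\<^esub> = \<zero>\<^bsub>k\<^esub>" and A: "ring (basis_algebra k B p c u)"
  shows "augmented_algebra k (basis_algebra k B p c u) (\<lambda>f. \<Oplus>\<^bsub>k\<^esub>b\<in>{b \<in> T. f b \<noteq> \<zero>\<^bsub>k\<^esub>}. f b)"
proof -
  let ?A = "basis_algebra k B p c u"
  interpret k: cring k by (rule k(1))
  interpret A: ring ?A by (rule A)
  have k0: "r = \<zero>\<^bsub>k\<^esub>" if "r \<in> carrier k" for r using k.one_zeroD[OF k(2)] that by simp
  have A0: "f = (\<lambda>b. \<zero>\<^bsub>k\<^esub>)" if "f \<in> carrier ?A" for f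
    using that k0 by (auto simp: basis_algebra_def free_module_def)
  have aug: "(\<Oplus>\<^bsub>k\<^esub>b\<in>{b \<in> T. f b \<noteq> \<zero>\<^bsub>k\<^esub>}. f b) = \<zero>\<^bsub>k\<^esub>" if "f \<in> carrier ?A" for f
    unfolding A0[OF that] by simp
  have smult: "r \<odot>\<^bsub>?A\<^esub> \<one>\<^bsub>?A\<^esub> = \<one>\<^bsub>?A\<^esub>" if "r \<in> carrier k" for r
  proof -
    have "r \<odot>\<^bsub>?A\<^esub> \<one>\<^bsub>?A\<^esub> = (\<lambda>b. \<zero>\<^bsub>k\<^esub>)"
      unfolding A0[OF A.one_closed] using that by (simp add: basis_algebra_def free_module_def)
    then show ?thesis using A0[OF A.one_closed] by simp
  qed
  have eqA: "f = g" if "f \<in> carrier ?A" "g \<in> carrier ?A" for f g using A0[OF that(1)] A0[OF that(2)] by simp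
  show ?thesis
  proof (intro augmented_algebra.intro augmented_algebra_axioms.intro)
    show "(\<lambda>r. r \<odot>\<^bsub>?A\<^esub> \<one>\<^bsub>?A\<^esub>) \<in> ring_hom k ?A"
      by (rule ring_hom_memI) (auto simp: smult intro: eqA)
    show "(\<lambda>f. \<Oplus>\<^bsub>k\<^esub>b\<in>{b \<in> T. f b \<noteq> \<zero>\<^bsub>k\<^esub>}. f b) \<in> ring_hom ?A k"
      by (rule ring_hom_memI) (simp_all only: aug A.m_closed A.a_closed A.one_closed k(2) k.zero_closed k.l_zero k.l_null)
    show "(\<Oplus>\<^bsub>k\<^esub>b\<in>{b \<in> T. (r \<odot>\<^bsub>?A\<^esub> \<one>\<^bsub>?A\<^esub>) b \<noteq> \<zero>\<^bsub>k\<^esub>}. (r \<odot>\<^bsub>?A\<^esub> \<one>\<^bsub>?A\<^esub>) b) = r" if "r \<in> carrier k" for r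
      unfolding smult[OF that] using aug[OF A.one_closed] k0[OF that] by simp
  qed (rule k, rule A)
qed

lemma left_modules_trivial_scalars_iso:
  assumes "cring k" "\<one>\<^bsub>k\<^esub> = \<zero>\<^bsub>k\<^esub>" "left_module k M" "left_module k N"
  shows "module_isomorphic k M N"
proof -
  interpret k: cring k by fact
  interpret M: left_module k M by fact
  interpret N: left_module k N by fact
  have M0: "x = \<zero>\<^bsub>M\<^esub>" if "x \<in> carrier M" for x
    using M.lsmult_one[OF that] M.lsmult_l_null[OF that] assms(2) by simp
  have N0: "x = \<zero>\<^bsub>N\<^esub>" if "x \<in> carrier N" for x
    using N.lsmult_one[OF that] N.lsmult_l_null[OF that] assms(2) by simp
  have "(\<lambda>x. \<zero>\<^bsub>N\<^esub>) \<in> lin_hom k M N"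
    by (rule lin_homI) (simp_all add: N.lsmult_r_null)
  moreover have "bij_betw (\<lambda>x. \<zero>\<^bsub>N\<^esub>) (carrier M) (carrier N)"
    using M0 N0 by (intro bij_betwI[where g = "\<lambda>x. \<zero>\<^bsub>M\<^esub>"]) auto
  ultimately show ?thesis unfolding module_isomorphic_def by blast
qed

lemma left_module_Tor:
  assumes "augmented_algebra k A \<epsilon>" and P: "resolution A (aug_module k \<epsilon>) P d e"
  shows "left_module k (Tor k A (aug_module k \<epsilon>) P d q)"
proof -
  interpret augmented_algebra k A \<epsilon> by fact
  show ?thesis
    by (rule Tor_presentation[of P d q, OF resolutionD(1,2)[OF P]]) (rule resolutionD(6)[OF P], assumption)
qed

lemma act_Units:
  assumes "commutative_G_ring G k act" "\<delta> \<in> Units k" "g \<in> carrier G"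
  shows "act g \<delta> \<in> Units k"
proof -
  interpret k: cring k using assms(1) by (simp add: commutative_G_ring_def)
  have "act g \<in> ring_hom k k"
    using assms(1,3) by (auto simp: commutative_G_ring_def ring_aut_group_def hom_def ring_iso_def)
  note act = ring_hom_closed[OF this] ring_hom_mult[OF this, symmetric] ring_hom_one[OF this]
  have inv: "inv\<^bsub>k\<^esub> \<delta> \<in> carrier k" "\<delta> \<in> carrier k" using assms(2) by auto
  show ?thesis
    unfolding Units_def using inv assms(2)
    by (auto simp: act k.Units_l_inv k.Units_r_inv intro!: bexI[of _ "act g (inv\<^bsub>k\<^esub> \<delta>)"])
qed

lemma lines_cong: "(\<And>i. i < n \<Longrightarrow> a i = b i) \<Longrightarrow> lines n a = lines n b"
  by (auto simp: lines_def)

lemma lines_inj: "lines n a = lines n b \<Longrightarrow> i < n \<Longrightarrow> a i = b i"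
proof -
  assume eq: "lines n a = lines n b" and i: "i < n"
  have "({(0, i), (1, i)}, a i) \<in> lines n b" unfolding eq[symmetric] using i by (auto simp: lines_def)
  then show ?thesis by (auto simp: lines_def doubleton_eq_iff)
qed

theorem theorem8p7:
  fixes G :: "('g, 'y) monoid_scheme" and k :: "('k, 'x) ring_scheme"
    and act :: "'g \<Rightarrow> 'k \<Rightarrow> 'k" and n :: nat and \<delta> :: 'k
    and P :: "nat \<Rightarrow> ('g diagram \<Rightarrow> 'k, 'p) module" and d :: "nat \<Rightarrow> 'p \<Rightarrow> 'p" and e :: "'p \<Rightarrow> 'k"
    and Q :: "nat \<Rightarrow> ((nat \<Rightarrow> 'g) \<Rightarrow> 'k, 'q) module" and d' :: "nat \<Rightarrow> 'q \<Rightarrow> 'q" and e' :: "'q \<Rightarrow> 'k"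
  assumes "comm_group G"
    and "commutative_G_ring G k act"
    and "\<delta> \<in> Units k"
    and "projective_resolution (GTL G k act n \<delta>) (GTL_trivial G k n) P d e"
    and "projective_resolution (group_algebra k (group_power G n)) (group_trivial k (group_power G n)) Q d' e'"
  shows "\<forall>q. module_isomorphic k
    (Tor k (GTL G k act n \<delta>) (GTL_trivial G k n) P d q)
    (Tor k (group_algebra k (group_power G n)) (group_trivial k (group_power G n)) Q d' q)"
proof
  fix q
  note G = assms(1) and act = assms(2) and \<delta> = assms(3) and P = assms(4) and Q = assms(5)
  interpret G: comm_group G by (rule G)
  have cr: "cring k" using act by (simp add: commutative_G_ring_def)
  interpret k: cring k by (rule cr)
  let ?D = "diagrams G n" and ?c = "loop_factor G k act \<delta>" and ?u = "identity_diagram G n"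
  let ?H = "group_power G n"
  let ?A = "basis_algebra k ?D (diagram_comp G) ?c ?u"
  let ?B = "basis_algebra k (carrier ?H) (monoid.mult ?H) (\<lambda>x y. \<one>\<^bsub>k\<^esub>) \<one>\<^bsub>?H\<^esub>"
  define T where "T = {E \<in> ?D. cup_free E}"
  define \<epsilon> where "\<epsilon> f = (\<Oplus>\<^bsub>k\<^esub>b\<in>{b \<in> T. f b \<noteq> \<zero>\<^bsub>k\<^esub>}. f b)" for f :: "'g diagram \<Rightarrow> 'k"
  define \<epsilon>' where "\<epsilon>' f = (\<Oplus>\<^bsub>k\<^esub>b\<in>{b \<in> carrier ?H. f b \<noteq> \<zero>\<^bsub>k\<^esub>}. f b)" for f :: "(nat \<Rightarrow> 'g) \<Rightarrow> 'k"
  have A: "GTL G k act n \<delta> = ?A" by (simp add: GTL_def)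
  have B: "group_algebra k ?H = ?B" by (simp add: group_algebra_def)
  have TA: "GTL_trivial G k n = aug_module k \<epsilon>"
    by (simp add: GTL_trivial_def trivial_module_eq_aug_module \<epsilon>_def[abs_def] T_def cup_free_def)
  have TB: "group_trivial k ?H = aug_module k \<epsilon>'"
    by (simp add: group_trivial_def trivial_module_eq_aug_module \<epsilon>'_def[abs_def])
  note P = P[unfolded A TA] and Q = Q[unfolded B TB]
  have resP: "resolution ?A (aug_module k \<epsilon>) P d e" and projP: "\<And>i. projective ?A (P i)"
    using P by (auto simp: projective_resolution_iff)
  have resQ: "resolution ?B (aug_module k \<epsilon>') Q d' e'" using Q by (auto simp: projective_resolution_iff)
  have ringA: "ring ?A" by (rule left_module_ring[OF resolutionD(1)[OF resP]])
  have ringB: "ring ?B" by (rule left_module_ring[OF resolutionD(1)[OF resQ]])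
  show "module_isomorphic k
    (Tor k (GTL G k act n \<delta>) (GTL_trivial G k n) P d q)
    (Tor k (group_algebra k ?H) (group_trivial k ?H) Q d' q)"
    unfolding A B TA TB
  proof (cases "\<one>\<^bsub>k\<^esub> = \<zero>\<^bsub>k\<^esub>")
    case True
    have aug: "augmented_algebra k ?A \<epsilon>" "augmented_algebra k ?B \<epsilon>'"
      using augmented_algebra_trivial_scalars[OF cr True ringA, of T]
        augmented_algebra_trivial_scalars[OF cr True ringB, of "carrier ?H"]
      by (simp_all add: \<epsilon>_def[abs_def] \<epsilon>'_def[abs_def])
    show "module_isomorphic k (Tor k ?A (aug_module k \<epsilon>) P d q) (Tor k ?B (aug_module k \<epsilon>') Q d' q)"
      by (rule left_modules_trivial_scalars_iso[OF cr True left_module_Tor[OF aug(1) resP] left_module_Tor[OF aug(2) resQ]])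
  next
    case False
    have label: "component_label G C \<in> carrier G" if "C \<in> components x y" "x \<in> ?D" "y \<in> ?D" for C x y
      by (rule G.component_label_closed[OF that])
    have c_unit: "?c x y \<in> Units k" if "x \<in> ?D" "y \<in> ?D" for x y
      unfolding loop_factor_def by (rule k.finprod_Units) (use act_Units[OF act \<delta>] label that in blast)
    have c_closed: "?c x y \<in> carrier k" if "x \<in> ?D" "y \<in> ?D" for x y
      using c_unit[OF that] by (rule k.Units_closed)
    have c_nonzero: "?c x y \<noteq> \<zero>\<^bsub>k\<^esub>" if "x \<in> ?D" "y \<in> ?D" for x y
    proof
      assume "?c x y = \<zero>\<^bsub>k\<^esub>"
      then have "\<zero>\<^bsub>k\<^esub> \<otimes>\<^bsub>k\<^esub> inv\<^bsub>k\<^esub> \<zero>\<^bsub>k\<^esub> = \<one>\<^bsub>k\<^esub>" "inv\<^bsub>k\<^esub> \<zero>\<^bsub>k\<^esub> \<in> carrier k"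
        using c_unit[OF that] k.Units_r_inv[of "\<zero>\<^bsub>k\<^esub>"] k.Units_inv_closed[of "\<zero>\<^bsub>k\<^esub>"] by auto
      then show False using False by simp
    qed
    have comp: "diagram_comp G x y \<in> ?D" if "x \<in> ?D" "y \<in> ?D" for x y
      by (rule basis_algebra_p_closed[where p = "diagram_comp G" and c = ?c, OF cr False ringA that c_closed[OF that] c_nonzero[OF that]])
    have u: "?u = lines n (\<lambda>_. \<one>\<^bsub>G\<^esub>)" by (simp add: identity_diagram_def lines_def)
    have H: "group ?H" by (rule product_group) (rule G.is_group)
    then interpret H: group ?H .
    interpret A: basis_ring k ?D "diagram_comp G" ?c ?u
      by (intro basis_ring.intro basis_ring_axioms.intro cr ringA comp c_closed)
        (simp_all add: u lines_diagram)
    interpret B: basis_ring k "carrier ?H" "monoid.mult ?H" "\<lambda>x y. \<one>\<^bsub>k\<^esub>" "\<one>\<^bsub>?H\<^esub>"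
      by (intro basis_ring.intro basis_ring_axioms.intro cr ringB H.m_closed H.one_closed) auto
    have eps: "\<epsilon> = A.aug T" "\<epsilon>' = B.aug (carrier ?H)"
      by (simp_all add: fun_eq_iff \<epsilon>_def \<epsilon>'_def A.aug_def B.aug_def)
    have carrier_H: "carrier ?H = {..<n} \<rightarrow>\<^sub>E carrier G" by (simp add: product_group_def)
    have inH: "a i \<in> carrier G" if "a \<in> carrier ?H" "i < n" for a i
      using that by (auto simp: carrier_H PiE_iff)
    have mult_H: "lines n (a \<otimes>\<^bsub>?H\<^esub> b) = lines n (\<lambda>i. a i \<otimes>\<^bsub>G\<^esub> b i)" for a b
      by (rule lines_cong) (simp add: product_group_def)
    have one_H: "lines n \<one>\<^bsub>?H\<^esub> = ?u" unfolding u by (rule lines_cong) (simp add: product_group_def)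
    have image_T: "lines n ` carrier ?H = T"
    proof (intro equalityI subsetI)
      fix E assume "E \<in> lines n ` carrier ?H"
      then obtain a where "a \<in> carrier ?H" "E = lines n a" by blast
      then show "E \<in> T" using inH by (simp add: T_def lines_diagram cup_free_lines)
    next
      fix E assume "E \<in> T"
      then have "E \<in> ?D" "cup_free E" by (simp_all add: T_def)
      then obtain a where a: "\<And>i. i < n \<Longrightarrow> a i \<in> carrier G" "E = lines n a" by (rule cup_free_eq_lines) blast
      have "restrict a {..<n} \<in> carrier ?H" using a(1) by (auto simp: carrier_H)
      moreover have "E = lines n (restrict a {..<n})" unfolding a(2) by (rule lines_cong) simp
      ultimately show "E \<in> lines n ` carrier ?H" by blast
    qed
    have inj: "inj_on (lines n) (carrier ?H)"
    proof (rule inj_onI)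
      fix a b assume ab: "a \<in> carrier ?H" "b \<in> carrier ?H" "lines n a = lines n b"
      show "a = b"
        using ab(1,2) unfolding carrier_H by (rule PiE_ext) (use lines_inj[OF ab(3)] in auto)
    qed
    \<comment> \<open>A left-to-left edge of \<open>x\<close> and a right-to-right edge of
      \<open>y\<close> survive in the composite. For each factor a single column decides whether it
      is cup-free, so both factors of a cup-free composite are cup-free.\<close>
    have prime: "x \<in> T \<and> y \<in> T" if "x \<in> ?D" "y \<in> ?D" "diagram_comp G x y \<in> T" for x y
    proof -
      have cf: "\<not> f \<subseteq> {0} \<times> UNIV" "\<not> f \<subseteq> {1} \<times> UNIV" if "(f, h) \<in> diagram_comp G x y" for f h
        using \<open>diagram_comp G x y \<in> T\<close> that by (auto simp: T_def cup_free_def)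
      have "cup_free x"
        unfolding cup_free_iff[OF that(1), of 0, simplified] using G.left_edge_comp[OF that(1)] cf(1) by blast
      moreover have "cup_free y"
        unfolding cup_free_iff[OF that(2), of 1, simplified] using G.right_edge_comp[OF that(1,2)] cf(2) by force
      ultimately show ?thesis using that by (simp add: T_def)
    qed
    have lines_mult: "diagram_comp G (lines n a) (lines n b) = lines n (a \<otimes>\<^bsub>?H\<^esub> b) \<and> ?c (lines n a) (lines n b) = \<one>\<^bsub>k\<^esub>"
      if ab: "a \<in> carrier ?H" "b \<in> carrier ?H" for a b
    proof
      have D: "lines n a \<in> ?D" "lines n b \<in> ?D" using inH ab by (auto intro: lines_diagram)
      show "diagram_comp G (lines n a) (lines n b) = lines n (a \<otimes>\<^bsub>?H\<^esub> b)"
        unfolding mult_H by (rule G.lines_comp[OF _ _ comp[OF D]]) (use inH ab in auto)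
      have empty: "{C \<in> components (lines n a) (lines n b). outer_nodes C = {}} = {}"
        using G.lines_no_loop[of n a b] inH[OF ab(1)] inH[OF ab(2)] by blast
      show "?c (lines n a) (lines n b) = \<one>\<^bsub>k\<^esub>" unfolding loop_factor_def empty by simp
    qed
    define \<phi> where "\<phi> = (\<lambda>f a. if a \<in> carrier ?H then f (lines n a) else \<zero>\<^bsub>k\<^esub>)"
    have lines_D: "lines n \<in> carrier ?H \<rightarrow> ?D" using inH by (auto intro: lines_diagram)
    note restr = restriction_ring_hom[where L = "lines n" and p = "diagram_comp G" and p' = "monoid.mult ?H",
        OF A.basis_ring_axioms B.basis_ring_axioms lines_D inj _ _ one_H]
    have hom: "\<phi> \<in> ring_hom ?A ?B" "\<phi> ` carrier ?A = carrier ?B"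
      "\<And>f. f \<in> carrier ?A \<Longrightarrow> B.aug (carrier ?H) (\<phi> f) = A.aug (lines n ` carrier ?H) f"
      "\<And>r. r \<in> carrier k \<Longrightarrow> \<phi> (r \<odot>\<^bsub>?A\<^esub> \<one>\<^bsub>?A\<^esub>) = r \<odot>\<^bsub>?B\<^esub> \<one>\<^bsub>?B\<^esub>"
      unfolding \<phi>_def by (rule restr; (rule prime[folded image_T] lines_mult)?; assumption)+
    define cups where "cups j g = {E \<in> ?D. ({(0, j), (0, Suc j)}, g) \<in> E}" for j g
    have cups_not_T: "E \<notin> T" if E: "E \<in> cups j g" for E j g
    proof
      assume "E \<in> T"
      then have "\<forall>(e, h)\<in>E. \<not> e \<subseteq> {0} \<times> UNIV \<and> \<not> e \<subseteq> {1} \<times> UNIV" by (simp add: T_def cup_free_def)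
      moreover have "({(0, j), (0, Suc j)}, g) \<in> E" using E by (simp add: cups_def)
      ultimately have "\<not> {(0, j), (0, Suc j)} \<subseteq> {0 :: nat} \<times> (UNIV :: nat set)" by blast
      then show False by simp
    qed
    \<comment> \<open>A cup at the place \<open>j\<close> needs \<open>Suc j < n\<close>, hence the
      bound \<open>n - 1\<close>, which leaves no place if n is 0 or 1. The scalar inverts the
      factor of the loop between the cap of a cup diagram and the cup of the diagram after
      it.\<close>
    have exact: "span_exact P d (A.supp_in (\<Union>j<n - 1. \<Union>g\<in>carrier G. cups j g))"
    proof (rule A.cups_span_exact[where e = "G.cup_diagram n" and r = "\<lambda>j g. inv\<^bsub>k\<^esub> (act g \<delta>)" and T = T and \<epsilon> = e])
      show "resolution ?A (aug_module k (A.aug T)) P d e" using resP by (simp only: eps)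
      show "projective ?A (P i)" for i by (rule projP)
      fix j g assume "j < n - 1" and g: "g \<in> carrier G"
      then have j: "Suc j < n" by simp
      have E: "G.cup_diagram n j g \<in> ?D" by (rule G.cup_diagram_closed[OF j g])
      show "G.cup_diagram n j g \<in> cups j g" using E by (simp add: cups_def G.cup_diagram_def)
      show "inv\<^bsub>k\<^esub> (act g \<delta>) \<in> carrier k" using act_Units[OF act \<delta> g] by simp
      show "cups j g \<subseteq> ?D - T" using cups_not_T[of _ j g] by (auto simp: cups_def)
      show "diagram_comp G x y \<in> cups j g" if "x \<in> cups j g" "y \<in> ?D" for x y
        using that comp G.left_edge_comp[of x n "{(0, j), (0, Suc j)}" g y] by (auto simp: cups_def)
      show "diagram_comp G (G.cup_diagram n j g) y = y \<and> inv\<^bsub>k\<^esub> (act g \<delta>) \<otimes>\<^bsub>k\<^esub> ?c (G.cup_diagram n j g) y = \<one>\<^bsub>k\<^esub>"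
        if "y \<in> cups j g" for y
      proof
        have y: "y \<in> ?D" "({(0, j), (0, Suc j)}, g) \<in> y" using that by (simp_all add: cups_def)
        show "diagram_comp G (G.cup_diagram n j g) y = y"
          by (rule G.cup_diagram_comp[OF j g y comp[OF E y(1)]])
        obtain K where "{C \<in> components (G.cup_diagram n j g) y. outer_nodes C = {}} = {K}" "component_label G K = g"
          using G.cup_diagram_loops[OF j g y] by blast
        then have "?c (G.cup_diagram n j g) y = act g \<delta>"
          unfolding loop_factor_def using act_Units[OF act \<delta> g] by (simp add: k.Units_closed)
        then show "inv\<^bsub>k\<^esub> (act g \<delta>) \<otimes>\<^bsub>k\<^esub> ?c (G.cup_diagram n j g) y = \<one>\<^bsub>k\<^esub>"
          using act_Units[OF act \<delta> g] by (simp add: k.Units_l_inv)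
      qed
      show "cups j g \<inter> cups j h = {}" if "g \<noteq> h" for h
      proof (rule equals0I)
        fix E assume "E \<in> cups j g \<inter> cups j h"
        then have "({(0, j), (0, Suc j)}, g) = ({(0 :: nat, j), (0, Suc j)}, h)"
          by (intro diagram_unique[of E G n _ _ "(0, j)"]) (simp_all add: cups_def)
        then show False using that by simp
      qed
      show "diagram_comp G (G.cup_diagram n j g) y \<in> cups i h" if "Suc i < j" "h \<in> carrier G" "y \<in> cups i h" for i h y
      proof -
        have y: "y \<in> ?D" "({(0, i), (0, Suc i)}, h) \<in> y" using that(3) by (simp_all add: cups_def)
        have "({(0, i), (0, Suc i)}, h) \<in> diagram_comp G (G.cup_diagram n j g) y"
          by (rule G.cup_comp_block(4)[OF j g y]) (use that(1) in auto)
        then show ?thesis using comp[OF E y(1)] by (simp add: cups_def)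
      qed
    next
      fix j g h
      show "cups (Suc j) g \<inter> cups j h = {}"
      proof (rule equals0I)
        fix E assume "E \<in> cups (Suc j) g \<inter> cups j h"
        then have "({(0 :: nat, Suc j), (0, Suc (Suc j))}, g) = ({(0, j), (0, Suc j)}, h)"
          by (intro diagram_unique[of E G n _ _ "(0, Suc j)"]) (simp_all add: cups_def)
        then show False by (simp add: doubleton_eq_iff)
      qed
    qed
    have cups_T: "(\<Union>j<n - 1. \<Union>g\<in>carrier G. cups j g) = ?D - T"
    proof (intro equalityI subsetI)
      fix E assume "E \<in> (\<Union>j<n - 1. \<Union>g\<in>carrier G. cups j g)"
      then obtain j g where "E \<in> cups j g" by blast
      then show "E \<in> ?D - T" using cups_not_T[of E j g] by (simp add: cups_def)
    next
      fix E assume "E \<in> ?D - T"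
      then have E: "E \<in> ?D" "\<not> cup_free E" by (auto simp: T_def)
      obtain i h where i: "({(0, i), (0, Suc i)}, h) \<in> E" "Suc i < n" "h \<in> carrier G" by (rule not_cup_free[OF E])
      then have "i < n - 1" by linarith
      then show "E \<in> (\<Union>j<n - 1. \<Union>g\<in>carrier G. cups j g)" using E(1) i by (auto simp: cups_def)
    qed
    have zero_B: "\<zero>\<^bsub>?B\<^esub> = (\<lambda>a. \<zero>\<^bsub>k\<^esub>)" by (rule B.basis_algebra_simps(1))
    have kernel: "A.supp_in (?D - T) = {f \<in> carrier ?A. \<phi> f = \<zero>\<^bsub>?B\<^esub>}"
    proof (intro equalityI subsetI)
      fix f assume f: "f \<in> A.supp_in (?D - T)"
      have "\<phi> f a = \<zero>\<^bsub>k\<^esub>" for a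
        using A.supp_inD(2)[OF f, of "lines n a"] image_T by (auto simp: \<phi>_def)
      then have "\<phi> f = \<zero>\<^bsub>?B\<^esub>" unfolding zero_B by (intro ext)
      then show "f \<in> {f \<in> carrier ?A. \<phi> f = \<zero>\<^bsub>?B\<^esub>}" using A.supp_inD(1)[OF f] by blast
    next
      fix f assume f: "f \<in> {f \<in> carrier ?A. \<phi> f = \<zero>\<^bsub>?B\<^esub>}"
      show "f \<in> A.supp_in (?D - T)"
      proof (rule A.supp_inI)
        show fA: "f \<in> carrier ?A" using f by blast
        fix b assume b: "f b \<noteq> \<zero>\<^bsub>k\<^esub>"
        have "b \<notin> T"
        proof
          assume "b \<in> T"
          then obtain a where a: "a \<in> carrier ?H" "b = lines n a" using image_T by blast
          have "\<phi> f a = \<zero>\<^bsub>k\<^esub>" using f unfolding zero_B by (elim CollectE conjE) (simp only:)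
          then show False using a b by (simp add: \<phi>_def)
        qed
        then show "b \<in> ?D - T" using A.basis_carrierD(2)[OF fA b] by simp
      qed
    qed
    have uT: "?u \<in> T" using imageI[OF B.u_closed, of "lines n"] by (simp only: one_H image_T)
    have augA: "augmented_algebra k ?A \<epsilon>"
      using A.augmented_algebra_aug[OF uT] left_module_aug_module[OF resP cr] by (simp only: eps)
    have augB: "augmented_algebra k ?B \<epsilon>'"
      using B.augmented_algebra_aug[OF B.u_closed] left_module_aug_module[OF resQ cr] by (simp only: eps)
    show "module_isomorphic k (Tor k ?A (aug_module k \<epsilon>) P d q) (Tor k ?B (aug_module k \<epsilon>') Q d' q)"
    proof (rule Tor_change_of_rings[OF augA augB hom(1,2) _ hom(4) P Q])
      show "\<epsilon>' (\<phi> f) = \<epsilon> f" if "f \<in> carrier ?A" for f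
        using hom(3)[OF that] by (simp only: eps image_T)
      show "\<exists>w\<in>smult_span (P (Suc q)) {a \<in> carrier ?A. \<phi> a = \<zero>\<^bsub>?B\<^esub>}. d q w = y"
        if "y \<in> smult_span (P q) {a \<in> carrier ?A. \<phi> a = \<zero>\<^bsub>?B\<^esub>}"
          "case q of 0 \<Rightarrow> True | Suc i \<Rightarrow> d i y = \<zero>\<^bsub>P i\<^esub>" for q y
        using exact that unfolding cups_T kernel span_exact_def by blast
    qed
  qed
qed

end
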